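(* Let $K$ be a field, $P=K[x_1,\dots,x_n]$, $I\subset P$ a 0-dimensional ideal, and $R=P/I$. For a field extension $K\subseteq L$ write $R_L=R\otimes_K L\cong L[x_1,\dots,x_n]/I\,L[x_1,\dots,x_n]$. Then the following conditions are equivalent. (a) There exist a field extension $K\subseteq L$ and an element $\varphi\in\omega_{R_L}$ such that $\mathrm{ord}_{\mathcal G}(\varphi)=-\mathrm{ri}(R_L)$ and $\mathrm{Ann}_{R_L}(\varphi)=\{0\}$. (b) The ring $R$ is locally Gorenstein and has the Cayley-Bacharach property. Moreover, if $K$ is infinite and these conditions hold, then condition (a) is satisfied with $L=K$.
   Context: Setting: $I$ is a proper ideal of $P=K[x_1,\dots,x_n]$ such that $\dim_K(P/I)<\infty$; $R=P/I$ is always considered with this fixed presentation. All notions below are applied to $R_L$ via its presentation $L[x_1,\dots,x_n]/I\,L[x_1,\dots,x_n]$ over the field $L$. Degree filtration: $F_iP=\{f\in P\mid \deg f\le i\}\cup\{0\}$, $F_iI=F_iP\cap I$, and $F_iR=F_iP/F_iI$ is the image of $F_iP$ in $R$ ($i\in\mathbb Z$). $\mathrm{HF}^a_R(i)=\dim_K F_iR$. The regularity index is $\mathrm{ri}(R)=\min\{i\in\mathbb Z\mid \mathrm{HF}^a_R(j)=\dim_K R \text{ for all } j\ge i\}$. For $f\in R\setminus\{0\}$, $\mathrm{ord}_{\mathcal F}(f)=\min\{i\mid f\in F_iR\}$. Cayley-Bacharach property (CBP): let $I=\mathfrak Q_1\cap\dots\cap\mathfrak Q_s$ be the primary decomposition,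 $\mathfrak M_i=\mathrm{Rad}(\mathfrak Q_i)$ (maximal ideals), $\ell_i=\dim_K(P/\mathfrak M_i)$. A $\mathfrak Q_i$-divisor of $I$ is an ideal $J=\mathfrak Q_1\cap\dots\cap\mathfrak Q_i'\cap\dots\cap\mathfrak Q_s$ ($\mathfrak Q_i$ replaced by $\mathfrak Q_i'$), where $\mathfrak Q_i'$ is an ideal of $P$ with $\mathfrak Q_i\subsetneq\mathfrak Q_i'$ (so $\mathfrak Q_i'\subseteq\mathfrak M_i$ or $\mathfrak Q_i'=P$). It is minimal if $\dim_K(J/I)=\ell_i$. For a minimal $\mathfrak Q_i$-divisor $J$ with image $\bar J=J/I$ in $R$, put $\mathrm{ri}(\bar J)=\max\{\mathrm{ord}_{\mathcal F}(f)\mid f\in\bar J\setminus\{0\}\}$. $R$ has the CBP if for every $i\in\{1,\dots,s\}$ and every minimal $\mathfrak Q_i$-divisor $J$ of $I$ we have $\mathrm{ri}(\bar J)=\mathrm{ri}(R)$. Canonical module: $\omega_R=\mathrm{Hom}_K(R,K)$ with $(f\cdot\varphi)(g)=\varphi(fg)$; $G_i\omega_R=\{\varphi\in\omega_R\mid\varphi(F_{-i-1}R)=0\}$; for $\varphi\ne0$, $\mathrm{ord}_{\mathcal G}(\varphi)=\min\{i\in\mathbb Z\mid\varphi\in G_i\omega_R\}$. Locally Gorenstein: let $\mathfrak q_i$ be the image of $\mathfrak Q_i$ in $R$, so $R\cong R/\mathfrak q_1\times\dots\times R/\mathfrak q_s$ with local factors. A 0-dimensional local ring $(A,\mathfrak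 m)$ is Gorenstein if $\dim_{A/\mathfrak m}\mathrm{Soc}(A)=1$, where $\mathrm{Soc}(A)=\mathrm{Ann}_A(\mathfrak m)$. $R$ is locally Gorenstein if every $R/\mathfrak q_i$ is a Gorenstein local ring. *)

theory Defs
  imports
    "HOL-Algebra.Algebraic_Closure"
    "HOL-Algebra.QuotRing"
    "Jordan_Normal_Form.Missing_VectorSpace"
begin

section \<open>Polynomial rings and affine algebras\<close>

text \<open>
  As in \<^theory>\<open>HOL-Algebra.Indexed_Polynomials\<close>, a monomial is the multiset of its variables, with
  variables indexed by \<open>{..<n}\<close>, and a polynomial maps monomials to coefficients. That theory has
  no product of two polynomials.
\<close>

definition mpoly_mult ::
  "('a, 'm) ring_scheme \<Rightarrow> (nat multiset \<Rightarrow> 'a) \<Rightarrow> (nat multiset \<Rightarrow> 'a) \<Rightarrow> (nat multiset \<Rightarrow> 'a)" where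
  "mpoly_mult K f g = (\<lambda>m. \<Oplus>\<^bsub>K\<^esub> u\<in>{u. u \<subseteq># m}. f u \<otimes>\<^bsub>K\<^esub> g (m - u))"

definition mpoly_ring :: "('a, 'm) ring_scheme \<Rightarrow> nat \<Rightarrow> (nat multiset \<Rightarrow> 'a) ring" where
  "mpoly_ring K n =
    \<lparr>carrier = ring.indexed_pset K {..<n} (carrier K),
     monoid.mult = mpoly_mult K,
     one = ring.indexed_const K \<one>\<^bsub>K\<^esub>,
     zero = ring.indexed_const K \<zero>\<^bsub>K\<^esub>,
     add = ring.indexed_padd K\<rparr>"

definition quot_alg ::
  "('a, 'm) ring_scheme \<Rightarrow> nat \<Rightarrow> (nat multiset \<Rightarrow> 'a) set \<Rightarrow> ('a, (nat multiset \<Rightarrow> 'a) set) module" where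
  "quot_alg K n I = (let P = mpoly_ring K n; R = P Quot I in
    \<lparr>carrier = carrier R, monoid.mult = monoid.mult R, one = one R, zero = zero R, add = add R,
     smult = (\<lambda>c x. (I +>\<^bsub>P\<^esub> ring.indexed_const K c) \<otimes>\<^bsub>R\<^esub> x)\<rparr>)"

definition image_in_quot ::
  "('a, 'm) ring_scheme \<Rightarrow> nat \<Rightarrow> (nat multiset \<Rightarrow> 'a) set \<Rightarrow> (nat multiset \<Rightarrow> 'a) set
    \<Rightarrow> (nat multiset \<Rightarrow> 'a) set set" where
  "image_in_quot K n I S = (\<lambda>f. I +>\<^bsub>mpoly_ring K n\<^esub> f) ` S"

definition subspace_dim ::
  "('a, 'm) ring_scheme \<Rightarrow> nat \<Rightarrow> (nat multiset \<Rightarrow> 'a) set \<Rightarrow> (nat multiset \<Rightarrow> 'a) set set \<Rightarrow> nat" where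
  "subspace_dim K n I U = vectorspace.dim K (quot_alg K n I\<lparr>carrier := U\<rparr>)"

definition zero_dim_ideal ::
  "('a, 'm) ring_scheme \<Rightarrow> nat \<Rightarrow> (nat multiset \<Rightarrow> 'a) set \<Rightarrow> bool" where
  "zero_dim_ideal K n I \<longleftrightarrow>
     ideal I (mpoly_ring K n) \<and> I \<noteq> carrier (mpoly_ring K n)
     \<and> vectorspace.fin_dim K (quot_alg K n I)"

text \<open>The ideal \<open>I L[x\<^sub>1,\<dots>,x\<^sub>n]\<close>, for a field extension given by an embedding \<open>h\<close> of \<open>K\<close> into \<open>L\<close>.\<close>

definition extend_ideal ::
  "('b, 'l) ring_scheme \<Rightarrow> ('a \<Rightarrow> 'b) \<Rightarrow> nat \<Rightarrow> (nat multiset \<Rightarrow> 'a) set \<Rightarrow> (nat multiset \<Rightarrow> 'b) set" where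
  "extend_ideal L h n I = Idl\<^bsub>mpoly_ring L n\<^esub> ((\<lambda>f. h \<circ> f) ` I)"


section \<open>The degree filtration\<close>

definition total_degree :: "('a, 'm) ring_scheme \<Rightarrow> (nat multiset \<Rightarrow> 'a) \<Rightarrow> nat" where
  "total_degree K f = Max (size ` {m. f m \<noteq> \<zero>\<^bsub>K\<^esub>})"

definition filt_poly :: "('a, 'm) ring_scheme \<Rightarrow> nat \<Rightarrow> int \<Rightarrow> (nat multiset \<Rightarrow> 'a) set" where
  "filt_poly K n i =
    {f \<in> carrier (mpoly_ring K n). f = \<zero>\<^bsub>mpoly_ring K n\<^esub> \<or> int (total_degree K f) \<le> i}"

definition filt ::
  "('a, 'm) ring_scheme \<Rightarrow> nat \<Rightarrow> (nat multiset \<Rightarrow> 'a) set \<Rightarrow> int \<Rightarrow> (nat multiset \<Rightarrow> 'a) set set" where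
  "filt K n I i = image_in_quot K n I (filt_poly K n i)"

definition affine_HF ::
  "('a, 'm) ring_scheme \<Rightarrow> nat \<Rightarrow> (nat multiset \<Rightarrow> 'a) set \<Rightarrow> int \<Rightarrow> nat" where
  "affine_HF K n I i = subspace_dim K n I (filt K n I i)"

definition reg_index :: "('a, 'm) ring_scheme \<Rightarrow> nat \<Rightarrow> (nat multiset \<Rightarrow> 'a) set \<Rightarrow> int" where
  "reg_index K n I =
    (LEAST i. \<forall>j\<ge>i. affine_HF K n I j = vectorspace.dim K (quot_alg K n I))"

definition ord_filt ::
  "('a, 'm) ring_scheme \<Rightarrow> nat \<Rightarrow> (nat multiset \<Rightarrow> 'a) set \<Rightarrow> (nat multiset \<Rightarrow> 'a) set \<Rightarrow> int" where
  "ord_filt K n I x = (LEAST i. x \<in> filt K n I i)"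


section \<open>Primary decomposition\<close>

definition radical :: "('b, 'm) ring_scheme \<Rightarrow> 'b set \<Rightarrow> 'b set" where
  "radical A Q = {a \<in> carrier A. \<exists>k::nat. a [^]\<^bsub>A\<^esub> k \<in> Q}"

definition primary_ideal :: "('b, 'm) ring_scheme \<Rightarrow> 'b set \<Rightarrow> bool" where
  "primary_ideal A Q \<longleftrightarrow> ideal Q A \<and> Q \<noteq> carrier A
     \<and> (\<forall>a\<in>carrier A. \<forall>b\<in>carrier A. a \<otimes>\<^bsub>A\<^esub> b \<in> Q \<longrightarrow> a \<in> Q \<or> b \<in> radical A Q)"

definition minimal_primary_decomposition :: "('b, 'm) ring_scheme \<Rightarrow> 'b set \<Rightarrow> 'b set set \<Rightarrow> bool" where
  "minimal_primary_decomposition A I QS \<longleftrightarrow>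
     finite QS \<and> (\<forall>Q\<in>QS. primary_ideal A Q) \<and> carrier A \<inter> \<Inter>QS = I
     \<and> inj_on (radical A) QS
     \<and> (\<forall>Q\<in>QS. carrier A \<inter> \<Inter>(QS - {Q}) \<noteq> I)"

text \<open>
  For a zero-dimensional ideal of a polynomial ring the minimal primary decomposition exists and is
  unique, since the radicals of the components are maximal ideals.
\<close>

definition primary_components :: "('b, 'm) ring_scheme \<Rightarrow> 'b set \<Rightarrow> 'b set set" where
  "primary_components A I = (THE QS. minimal_primary_decomposition A I QS)"


section \<open>The Cayley-Bacharach property\<close>

definition ideal_divisor ::
  "('a, 'm) ring_scheme \<Rightarrow> nat \<Rightarrow> (nat multiset \<Rightarrow> 'a) set \<Rightarrow> (nat multiset \<Rightarrow> 'a) set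
    \<Rightarrow> (nat multiset \<Rightarrow> 'a) set \<Rightarrow> bool" where
  "ideal_divisor K n I Q J \<longleftrightarrow>
     (\<exists>Q'. ideal Q' (mpoly_ring K n) \<and> Q \<subset> Q'
        \<and> J = Q' \<inter> \<Inter>(primary_components (mpoly_ring K n) I - {Q}))"

definition minimal_ideal_divisor ::
  "('a, 'm) ring_scheme \<Rightarrow> nat \<Rightarrow> (nat multiset \<Rightarrow> 'a) set \<Rightarrow> (nat multiset \<Rightarrow> 'a) set
    \<Rightarrow> (nat multiset \<Rightarrow> 'a) set \<Rightarrow> bool" where
  "minimal_ideal_divisor K n I Q J \<longleftrightarrow> ideal_divisor K n I Q J
     \<and> subspace_dim K n I (image_in_quot K n I J)
        = vectorspace.dim K (quot_alg K n (radical (mpoly_ring K n) Q))"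

definition reg_index_ideal ::
  "('a, 'm) ring_scheme \<Rightarrow> nat \<Rightarrow> (nat multiset \<Rightarrow> 'a) set \<Rightarrow> (nat multiset \<Rightarrow> 'a) set set \<Rightarrow> int" where
  "reg_index_ideal K n I U = Max (ord_filt K n I ` (U - {\<zero>\<^bsub>quot_alg K n I\<^esub>}))"

definition cayley_bacharach :: "('a, 'm) ring_scheme \<Rightarrow> nat \<Rightarrow> (nat multiset \<Rightarrow> 'a) set \<Rightarrow> bool" where
  "cayley_bacharach K n I \<longleftrightarrow>
     (\<forall>Q\<in>primary_components (mpoly_ring K n) I. \<forall>J. minimal_ideal_divisor K n I Q J \<longrightarrow>
        reg_index_ideal K n I (image_in_quot K n I J) = reg_index K n I)"


section \<open>Locally Gorenstein algebras\<close>

definition local_cring :: "('b, 'm) ring_scheme \<Rightarrow> bool" where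
  "local_cring A \<longleftrightarrow> cring A \<and> (\<exists>!M. maximalideal M A)"

definition max_ideal :: "('b, 'm) ring_scheme \<Rightarrow> 'b set" where
  "max_ideal A = (THE M. maximalideal M A)"

definition socle :: "('b, 'm) ring_scheme \<Rightarrow> 'b set" where
  "socle A = {x \<in> carrier A. \<forall>y\<in>max_ideal A. y \<otimes>\<^bsub>A\<^esub> x = \<zero>\<^bsub>A\<^esub>}"

text \<open>
  The socle as a vector space over the residue field. An element of the residue field is a coset,
  all of whose elements act in the same way on the socle.
\<close>

definition socle_space :: "('b, 'm) ring_scheme \<Rightarrow> ('b set, 'b) module" where
  "socle_space A =
    \<lparr>carrier = socle A, monoid.mult = monoid.mult A, one = one A, zero = zero A, add = add A,
     smult = (\<lambda>C x. the_elem ((\<lambda>a. a \<otimes>\<^bsub>A\<^esub> x) ` C))\<rparr>"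

definition gorenstein_local :: "('b, 'm) ring_scheme \<Rightarrow> bool" where
  "gorenstein_local A \<longleftrightarrow> local_cring A
     \<and> vectorspace.fin_dim (A Quot max_ideal A) (socle_space A)
     \<and> vectorspace.dim (A Quot max_ideal A) (socle_space A) = 1"

definition locally_gorenstein :: "('a, 'm) ring_scheme \<Rightarrow> nat \<Rightarrow> (nat multiset \<Rightarrow> 'a) set \<Rightarrow> bool" where
  "locally_gorenstein K n I \<longleftrightarrow>
     (\<forall>Q\<in>primary_components (mpoly_ring K n) I.
        gorenstein_local (quot_alg K n I Quot image_in_quot K n I Q))"


section \<open>The canonical module\<close>

definition self_module :: "('a, 'm) ring_scheme \<Rightarrow> ('a, 'a) module" where
  "self_module K =
    \<lparr>carrier = carrier K, monoid.mult = monoid.mult K, one = one K, zero = zero K, add = add K,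
     smult = monoid.mult K\<rparr>"

text \<open>
  Linear forms are taken to be extensional, so that equality of functions is equality of linear
  forms. The ring components \<open>mult\<close> and \<open>one\<close> of a module record have no meaning here.
\<close>

definition canonical_module ::
  "('a, 'm) ring_scheme \<Rightarrow> nat \<Rightarrow> (nat multiset \<Rightarrow> 'a) set
    \<Rightarrow> ((nat multiset \<Rightarrow> 'a) set, (nat multiset \<Rightarrow> 'a) set \<Rightarrow> 'a) module" where
  "canonical_module K n I = (let R = quot_alg K n I in
    \<lparr>carrier = module_hom K R (self_module K) \<inter> extensional (carrier R),
     monoid.mult = undefined, one = undefined,
     zero = (\<lambda>x\<in>carrier R. \<zero>\<^bsub>K\<^esub>),
     add = (\<lambda>\<phi> \<psi>. \<lambda>x\<in>carrier R. \<phi> x \<oplus>\<^bsub>K\<^esub> \<psi> x),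
     smult = (\<lambda>f \<phi>. \<lambda>g\<in>carrier R. \<phi> (f \<otimes>\<^bsub>R\<^esub> g))\<rparr>)"

definition canonical_filt ::
  "('a, 'm) ring_scheme \<Rightarrow> nat \<Rightarrow> (nat multiset \<Rightarrow> 'a) set \<Rightarrow> int
    \<Rightarrow> ((nat multiset \<Rightarrow> 'a) set \<Rightarrow> 'a) set" where
  "canonical_filt K n I i =
    {\<phi> \<in> carrier (canonical_module K n I). \<forall>x\<in>filt K n I (- i - 1). \<phi> x = \<zero>\<^bsub>K\<^esub>}"

definition ord_canonical ::
  "('a, 'm) ring_scheme \<Rightarrow> nat \<Rightarrow> (nat multiset \<Rightarrow> 'a) set
    \<Rightarrow> ((nat multiset \<Rightarrow> 'a) set \<Rightarrow> 'a) \<Rightarrow> int" where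
  "ord_canonical K n I \<phi> = (LEAST i. \<phi> \<in> canonical_filt K n I i)"

definition annihilator :: "('r, 'm) ring_scheme \<Rightarrow> ('r, 'b, 'n) module_scheme \<Rightarrow> 'b \<Rightarrow> 'r set" where
  "annihilator A M x = {a \<in> carrier A. a \<odot>\<^bsub>M\<^esub> x = \<zero>\<^bsub>M\<^esub>}"

text \<open>
  The order of a linear form is only meaningful if the form is nonzero. This is implied here: the
  annihilator of the zero form is the whole algebra, which is nonzero.
\<close>

definition has_faithful_form_of_min_order ::
  "('a, 'm) ring_scheme \<Rightarrow> nat \<Rightarrow> (nat multiset \<Rightarrow> 'a) set \<Rightarrow> bool" where
  "has_faithful_form_of_min_order K n I \<longleftrightarrow>
     (\<exists>\<phi>\<in>carrier (canonical_module K n I).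
        ord_canonical K n I \<phi> = - reg_index K n I
        \<and> annihilator (quot_alg K n I) (canonical_module K n I) \<phi> = {\<zero>\<^bsub>quot_alg K n I\<^esub>})"

text \<open>
  HOL cannot quantify over types, so the extension fields range over all field structures on subsets
  of a type \<open>'l\<close>, together with an embedding of \<open>K\<close>. The quantifier over all field extensions is
  recovered by leaving \<open>'l\<close> arbitrary where an extension is assumed, and by choosing a sufficiently
  large type where one is to be found.
\<close>

definition faithful_form_over_extension ::
  "'l itself \<Rightarrow> ('a, 'm) ring_scheme \<Rightarrow> nat \<Rightarrow> (nat multiset \<Rightarrow> 'a) set \<Rightarrow> bool" where
  "faithful_form_over_extension T K n I \<longleftrightarrow>
     (\<exists>(L :: 'l ring) h. field L \<and> h \<in> ring_hom K L
        \<and> has_faithful_form_of_min_order L n (extend_ideal L h n I))"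

text \<open>
  The carrier type of \<^const>\<open>field.alg_closure\<close>: it has room for an isomorphic copy of an
  algebraic closure of any field on \<open>'k\<close>, hence of an infinite extension field.
\<close>

type_synonym 'k closure_type = "('k list \<times> nat) multiset \<Rightarrow> 'k"

end

theory Submission
  imports Defs
begin

text \<open>
  Over a field \<open>L\<close>, a linear form of order \<open>- ri(R\<^sub>L)\<close> is one that vanishes on \<open>F\<^sub>r\<^sub>-\<^sub>1\<close> but not on
  \<open>F\<^sub>r = R\<^sub>L\<close>, where \<open>r = ri(R) = ri(R\<^sub>L)\<close>, and it has annihilator zero iff its kernel contains no
  nonzero ideal. The minimal \<open>Q\<^sub>i\<close>-divisors of \<open>I\<close> correspond to the minimal nonzero ideals of \<open>R\<close>, so
  that CBP says that no nonzero ideal of \<open>R\<close> is contained in \<open>F\<^sub>r\<^sub>-\<^sub>1\<close>.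

  Given a faithful form \<open>\<Phi>\<close> over \<open>L\<close> that vanishes on \<open>F\<^sub>r\<^sub>-\<^sub>1\<close>, a nonzero ideal inside \<open>F\<^sub>r\<^sub>-\<^sub>1\<close> would
  extend to a nonzero ideal in the kernel of \<open>\<Phi>\<close>, and the socle of a local factor with residue field
  \<open>k\<close>, after extension to \<open>L\<close>, embeds into the dual of \<open>k \<otimes> L\<close>, so that it has length one.

  Conversely, every minimal ideal \<open>S\<close> of \<open>R\<close> is the full socle of a local factor, and CBP gives a form
  over \<open>K\<close> that vanishes on \<open>F\<^sub>r\<^sub>-\<^sub>1\<close> but not on \<open>S\<close>; by flatness it is faithful on \<open>S \<otimes> L\<close>. A sum
  \<open>\<Phi> + k \<Psi>\<close> stays faithful on a given \<open>S \<otimes> L\<close>, if \<open>\<Phi>\<close> or \<open>\<Psi>\<close> is, for all but finitely many \<open>k \<in> L\<close>,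
  because the exceptions are eigenvalues. Hence over an infinite field \<open>L\<close> there is one form that is
  faithful on all of the finitely many \<open>S \<otimes> L\<close>, and it is faithful on \<open>R\<^sub>L\<close>. If \<open>K\<close> is infinite take
  \<open>L = K\<close>, and otherwise an algebraic closure.

  Linear algebra is done in the polynomial ring modulo \<open>I\<close>, without bases and coordinates: dimensions
  are counted by codimensions of subspaces.
\<close>

section \<open>Subspaces and linear forms of a commutative algebra over a field\<close>

text \<open>The extension field is forced by finite K: the forms over K that vanish on a given
  minimal ideal make up a proper subspace, and over a finite field finitely many proper subspaces
  can cover the whole space of forms.

  The extension in turn has a price. A maximal ideal of P need not generate a maximal, or even a
  radical, ideal over L, so the primary decomposition of R_L is never touched. Only ideals of P are
  decomposed, and their L-spans are compared by exactness: a common kernel of K-forms, if it has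
  finite codimension, spans over L the common kernel of the extended forms. In particular S
  \<otimes> L can lose the simplicity of S, and the faithfulness of a form on it comes instead from
  a description of I inside S as a common kernel of translates of one form over K.

  Codimension does the work of the Artinian property: it is bounded by that of I for everything that
  contains I, and it drops strictly under strict inclusion of subspaces. All chain arguments and all
  choices of minimal ideals rest on these two facts.\<close>

locale field_algebra = K: field K + cring P
  for K :: "('k, 'm) ring_scheme" and P :: "('p, 'q) ring_scheme" (structure) and c :: "'k \<Rightarrow> 'p" +
  assumes scalar_hom: "c \<in> ring_hom K P"
begin

lemma c_closed [simp, intro]: "k \<in> carrier K \<Longrightarrow> c k \<in> carrier P"
  and c_add: "\<lbrakk>k \<in> carrier K; l \<in> carrier K\<rbrakk> \<Longrightarrow> c (k \<oplus>\<^bsub>K\<^esub> l) = c k \<oplus> c l"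
  and c_mult: "\<lbrakk>k \<in> carrier K; l \<in> carrier K\<rbrakk> \<Longrightarrow> c (k \<otimes>\<^bsub>K\<^esub> l) = c k \<otimes> c l"
  and c_one [simp]: "c \<one>\<^bsub>K\<^esub> = \<one>"
  and c_zero [simp]: "c \<zero>\<^bsub>K\<^esub> = \<zero>"
  using scalar_hom ring_hom_zero[OF scalar_hom K.ring_axioms ring_axioms]
  by (auto simp: ring_hom_def)

lemma add_diff_cancel: "\<lbrakk>x \<in> carrier P; y \<in> carrier P\<rbrakk> \<Longrightarrow> (x \<oplus> y) \<ominus> y = x"
  by (simp add: a_minus_def a_assoc r_neg)

lemma diff_add_cancel: "\<lbrakk>x \<in> carrier P; y \<in> carrier P\<rbrakk> \<Longrightarrow> (x \<ominus> y) \<oplus> y = x"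
  by (simp add: a_minus_def a_assoc l_neg)

lemma diff_diff_cancel: "\<lbrakk>x \<in> carrier P; y \<in> carrier P\<rbrakk> \<Longrightarrow> x \<ominus> (x \<ominus> y) = y"
  by (simp add: a_minus_def minus_add a_assoc[symmetric] r_neg)

lemma add_diff_add:
  "\<lbrakk>x \<in> carrier P; y \<in> carrier P; u \<in> carrier P; v \<in> carrier P\<rbrakk>
    \<Longrightarrow> (x \<oplus> y) \<ominus> (u \<oplus> v) = (x \<ominus> u) \<oplus> (y \<ominus> v)"
  by (simp add: a_minus_def minus_add a_ac)

lemma diff_diff_same:
  "\<lbrakk>x \<in> carrier P; y \<in> carrier P; u \<in> carrier P\<rbrakk> \<Longrightarrow> (x \<ominus> y) \<ominus> (x \<ominus> u) = u \<ominus> y"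
  using add_diff_add[of x "\<ominus> y" x "\<ominus> u"] by (simp add: a_minus_def r_neg a_comm)

lemma mult_diff:
  "\<lbrakk>x \<in> carrier P; y \<in> carrier P; u \<in> carrier P\<rbrakk> \<Longrightarrow> x \<otimes> (y \<ominus> u) = x \<otimes> y \<ominus> x \<otimes> u"
  by (simp add: a_minus_def r_distr r_minus)

lemma diff_mult:
  "\<lbrakk>x \<in> carrier P; y \<in> carrier P; u \<in> carrier P\<rbrakk> \<Longrightarrow> (x \<ominus> y) \<otimes> u = x \<otimes> u \<ominus> y \<otimes> u"
  by (simp add: a_minus_def l_distr l_minus)

lemma c_inv: "\<lbrakk>k \<in> carrier K; k \<noteq> \<zero>\<^bsub>K\<^esub>\<rbrakk> \<Longrightarrow> c (inv\<^bsub>K\<^esub> k) \<otimes> c k = \<one>"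
  using c_mult[of "inv\<^bsub>K\<^esub> k" k] K.field_Units K.Units_l_inv[of k] K.Units_inv_closed[of k] by simp

lemma c_uminus: "k \<in> carrier K \<Longrightarrow> c (\<ominus>\<^bsub>K\<^esub> k) = \<ominus> c k"
  using c_add[of "\<ominus>\<^bsub>K\<^esub> k" k] by (simp add: K.l_neg minus_equality)

lemma c_diff: "\<lbrakk>k \<in> carrier K; l \<in> carrier K\<rbrakk> \<Longrightarrow> c (k \<ominus>\<^bsub>K\<^esub> l) = c k \<ominus> c l"
  by (simp add: a_minus_def c_add c_uminus)

section \<open>Subspaces and spans\<close>

definition subsp :: "'p set \<Rightarrow> bool" where
  "subsp U \<longleftrightarrow> U \<subseteq> carrier P \<and> \<zero> \<in> U \<and> (\<forall>x\<in>U. \<forall>y\<in>U. x \<oplus> y \<in> U)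
     \<and> (\<forall>k\<in>carrier K. \<forall>x\<in>U. c k \<otimes> x \<in> U)"

lemma subsp_carrier: "\<lbrakk>subsp U; x \<in> U\<rbrakk> \<Longrightarrow> x \<in> carrier P"
  and subsp_subset: "subsp U \<Longrightarrow> U \<subseteq> carrier P"
  and subsp_zero: "subsp U \<Longrightarrow> \<zero> \<in> U"
  and subsp_add: "\<lbrakk>subsp U; x \<in> U; y \<in> U\<rbrakk> \<Longrightarrow> x \<oplus> y \<in> U"
  and subsp_smult: "\<lbrakk>subsp U; k \<in> carrier K; x \<in> U\<rbrakk> \<Longrightarrow> c k \<otimes> x \<in> U"
  by (auto simp: subsp_def)

lemma subsp_uminus: assumes "subsp U" "x \<in> U" shows "\<ominus> x \<in> U"
proof -
  have "c (\<ominus>\<^bsub>K\<^esub> \<one>\<^bsub>K\<^esub>) \<otimes> x \<in> U" using assms by (simp add: subsp_smult)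
  then show ?thesis using assms subsp_carrier[OF assms] by (simp add: c_uminus l_minus)
qed

lemma subsp_diff: "\<lbrakk>subsp U; x \<in> U; y \<in> U\<rbrakk> \<Longrightarrow> x \<ominus> y \<in> U"
  by (simp add: a_minus_def subsp_add subsp_uminus)

lemma subsp_smult_cancel:
  assumes "subsp U" "k \<in> carrier K" "k \<noteq> \<zero>\<^bsub>K\<^esub>" "x \<in> carrier P" "c k \<otimes> x \<in> U" shows "x \<in> U"
proof -
  have ik: "inv\<^bsub>K\<^esub> k \<in> carrier K" using assms K.field_Units by auto
  have "c (inv\<^bsub>K\<^esub> k) \<otimes> (c k \<otimes> x) \<in> U" using assms ik by (simp add: subsp_smult)
  moreover have "c (inv\<^bsub>K\<^esub> k) \<otimes> (c k \<otimes> x) = x"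
    using assms ik c_inv[of k] m_assoc[of "c (inv\<^bsub>K\<^esub> k)" "c k" x] by simp
  ultimately show ?thesis by simp
qed

lemma subsp_add_iff:
  assumes "subsp U" "x \<in> carrier P" "y \<in> U" shows "x \<oplus> y \<in> U \<longleftrightarrow> x \<in> U"
proof
  assume "x \<oplus> y \<in> U"
  then have "(x \<oplus> y) \<ominus> y \<in> U" using assms by (simp add: subsp_diff)
  moreover have "(x \<oplus> y) \<ominus> y = x" using assms subsp_carrier[OF assms(1,3)] by (simp add: add_diff_cancel)
  ultimately show "x \<in> U" by simp
qed (use assms subsp_add in auto)

lemma subsp_diff_iff:
  assumes "subsp U" "x \<in> carrier P" "y \<in> carrier P" "x \<ominus> y \<in> U" shows "x \<in> U \<longleftrightarrow> y \<in> U"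
proof -
  have "x = y \<oplus> (x \<ominus> y)" using assms diff_add_cancel[of x y] by (simp add: a_comm)
  then show ?thesis using subsp_add_iff[OF assms(1,3,4)] by simp
qed

lemma subsp_carrier_P [simp]: "subsp (carrier P)" by (auto simp: subsp_def)

lemma subsp_Int: "\<lbrakk>subsp U; subsp V\<rbrakk> \<Longrightarrow> subsp (U \<inter> V)" by (auto simp: subsp_def)

lemma subsp_ideal: assumes "ideal J P" shows "subsp J"
proof -
  interpret J: ideal J P by fact
  show ?thesis unfolding subsp_def using J.a_subset J.I_l_closed by auto
qed

text \<open>\<open>spn_base\<close> skips the elements of S outside the carrier, so that
  \<open>spn S\<close> is a subspace for every S. The inductive form supplies the rule by which
  identities pass from a spanning set to all of P.\<close>

inductive_set spn :: "'p set \<Rightarrow> 'p set" for S where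
  spn_zero: "\<zero> \<in> spn S"
| spn_base: "\<lbrakk>x \<in> S; x \<in> carrier P\<rbrakk> \<Longrightarrow> x \<in> spn S"
| spn_add: "\<lbrakk>x \<in> spn S; y \<in> spn S\<rbrakk> \<Longrightarrow> x \<oplus> y \<in> spn S"
| spn_smult: "\<lbrakk>k \<in> carrier K; x \<in> spn S\<rbrakk> \<Longrightarrow> c k \<otimes> x \<in> spn S"

lemma spn_closed: "x \<in> spn S \<Longrightarrow> x \<in> carrier P" by (induction rule: spn.induct) auto

lemma subsp_spn [simp]: "subsp (spn S)"
  using spn_closed by (auto simp: subsp_def intro: spn.intros)

lemma spn_least: assumes "subsp U" "S \<inter> carrier P \<subseteq> U" shows "spn S \<subseteq> U"
proof
  fix x assume "x \<in> spn S" then show "x \<in> U"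
    by induction (use assms in \<open>auto simp: subsp_def\<close>)
qed

lemma spn_superset: "S \<subseteq> carrier P \<Longrightarrow> S \<subseteq> spn S" by (auto intro: spn_base)

lemma spn_mono: "S \<subseteq> T \<Longrightarrow> spn S \<subseteq> spn T" by (rule spn_least) (auto intro: spn_base)

lemma spn_subsp: "subsp U \<Longrightarrow> spn U = U"
  using spn_least[of U U] spn_superset[of U] subsp_subset[of U] by auto

text \<open>The coefficient of x is built along the induction: 1 at x itself, 0 at members of S, and
  linear in between.\<close>

lemma spn_insert:
  assumes x: "x \<in> carrier P" and y: "y \<in> spn (insert x S)"
  shows "\<exists>k\<in>carrier K. y \<ominus> c k \<otimes> x \<in> spn S"
  using y
proof induction
  case spn_zero
  then show ?case using x by (intro bexI[of _ "\<zero>\<^bsub>K\<^esub>"]) (auto intro: spn.intros simp: a_minus_def)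
next
  case (spn_base z)
  show ?case
  proof (cases "z = x")
    case True
    then show ?thesis using x
      by (intro bexI[of _ "\<one>\<^bsub>K\<^esub>"]) (auto intro: spn.intros simp: a_minus_def r_neg)
  next
    case False
    then show ?thesis using x spn_base
      by (intro bexI[of _ "\<zero>\<^bsub>K\<^esub>"]) (auto intro: spn.intros simp: a_minus_def)
  qed
next
  case (spn_add y z)
  then obtain k l where kl: "k \<in> carrier K" "y \<ominus> c k \<otimes> x \<in> spn S" "l \<in> carrier K" "z \<ominus> c l \<otimes> x \<in> spn S" by auto
  have "y \<in> carrier P" "z \<in> carrier P" using spn_add spn_closed by auto
  then have "(y \<oplus> z) \<ominus> c (k \<oplus>\<^bsub>K\<^esub> l) \<otimes> x = (y \<ominus> c k \<otimes> x) \<oplus> (z \<ominus> c l \<otimes> x)"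
    using kl x by (simp add: c_add l_distr add_diff_add)
  then show ?case using kl by (intro bexI[of _ "k \<oplus>\<^bsub>K\<^esub> l"]) (auto intro: spn.intros)
next
  case (spn_smult m y)
  then obtain k where kl: "k \<in> carrier K" "y \<ominus> c k \<otimes> x \<in> spn S" by auto
  have "y \<in> carrier P" using spn_smult spn_closed by auto
  then have "(c m \<otimes> y) \<ominus> c (m \<otimes>\<^bsub>K\<^esub> k) \<otimes> x = c m \<otimes> (y \<ominus> c k \<otimes> x)"
    using kl x spn_smult by (simp add: c_mult m_assoc mult_diff)
  then show ?case using kl spn_smult by (intro bexI[of _ "m \<otimes>\<^bsub>K\<^esub> k"]) (auto intro: spn.intros)
qed

lemma spn_insert_subsp:
  assumes "subsp U" "x \<in> carrier P" "y \<in> spn (insert x U)"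
  obtains k where "k \<in> carrier K" "y \<ominus> c k \<otimes> x \<in> U"
  using spn_insert[OF assms(2,3)] spn_subsp[OF assms(1)] by auto

text \<open>The coefficient of x in y is nonzero because y is outside U, so the relation can be
  solved for x.\<close>

lemma exchange:
  assumes "subsp U" "x \<in> carrier P" "y \<in> spn (insert x U)" "y \<notin> U"
  shows "x \<in> spn (insert y U)"
proof -
  obtain k where k: "k \<in> carrier K" "y \<ominus> c k \<otimes> x \<in> U" using spn_insert_subsp assms(1-3) by blast
  have y: "y \<in> carrier P" using assms spn_closed by blast
  have k0: "k \<noteq> \<zero>\<^bsub>K\<^esub>" using k(2) assms(2,4) y by (auto simp: a_minus_def)
  have U: "U \<subseteq> spn (insert y U)" "y \<in> spn (insert y U)"
    using subsp_subset[OF assms(1)] y by (auto intro: spn_base)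
  have "y \<ominus> (y \<ominus> c k \<otimes> x) \<in> spn (insert y U)" by (rule subsp_diff) (use U k in auto)
  moreover have "y \<ominus> (y \<ominus> c k \<otimes> x) = c k \<otimes> x" using y k assms(2) by (simp add: diff_diff_cancel)
  ultimately show ?thesis using subsp_smult_cancel[OF subsp_spn k(1) k0 assms(2)] by simp
qed

section \<open>Linear forms and the separation of a vector from a subspace\<close>

definition form :: "('p \<Rightarrow> 'k) \<Rightarrow> bool" where
  "form \<Psi> \<longleftrightarrow> \<Psi> \<in> carrier P \<rightarrow> carrier K
     \<and> (\<forall>x\<in>carrier P. \<forall>y\<in>carrier P. \<Psi> (x \<oplus> y) = \<Psi> x \<oplus>\<^bsub>K\<^esub> \<Psi> y)
     \<and> (\<forall>k\<in>carrier K. \<forall>x\<in>carrier P. \<Psi> (c k \<otimes> x) = k \<otimes>\<^bsub>K\<^esub> \<Psi> x)"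

lemma form_closed: "\<lbrakk>form \<Psi>; x \<in> carrier P\<rbrakk> \<Longrightarrow> \<Psi> x \<in> carrier K"
  and form_add: "\<lbrakk>form \<Psi>; x \<in> carrier P; y \<in> carrier P\<rbrakk> \<Longrightarrow> \<Psi> (x \<oplus> y) = \<Psi> x \<oplus>\<^bsub>K\<^esub> \<Psi> y"
  and form_smult: "\<lbrakk>form \<Psi>; k \<in> carrier K; x \<in> carrier P\<rbrakk> \<Longrightarrow> \<Psi> (c k \<otimes> x) = k \<otimes>\<^bsub>K\<^esub> \<Psi> x"
  by (auto simp: form_def)

lemma form_zero: "form \<Psi> \<Longrightarrow> \<Psi> \<zero> = \<zero>\<^bsub>K\<^esub>"
  using form_smult[of \<Psi> "\<zero>\<^bsub>K\<^esub>" \<zero>] form_closed[of \<Psi> \<zero>] by simp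

lemma form_uminus: assumes "form \<Psi>" "x \<in> carrier P" shows "\<Psi> (\<ominus> x) = \<ominus>\<^bsub>K\<^esub> \<Psi> x"
proof -
  have "\<Psi> (\<ominus> x) \<oplus>\<^bsub>K\<^esub> \<Psi> x = \<zero>\<^bsub>K\<^esub>"
    using form_add[OF assms(1), of "\<ominus> x" x] assms form_zero by (simp add: l_neg)
  then show ?thesis using assms form_closed[OF assms(1)] by (simp add: K.minus_equality)
qed

lemma form_diff: "\<lbrakk>form \<Psi>; x \<in> carrier P; y \<in> carrier P\<rbrakk> \<Longrightarrow> \<Psi> (x \<ominus> y) = \<Psi> x \<ominus>\<^bsub>K\<^esub> \<Psi> y"
  by (simp add: a_minus_def form_add form_uminus K.minus_eq)

lemma form_translate: "\<lbrakk>form \<Psi>; g \<in> carrier P\<rbrakk> \<Longrightarrow> form (\<lambda>x. \<Psi> (g \<otimes> x))"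
  unfolding form_def by (auto simp: form_closed r_distr form_add form_smult m_lcomm[of g])

definition ker :: "('p \<Rightarrow> 'k) \<Rightarrow> 'p set" where
  "ker \<Psi> = {x \<in> carrier P. \<Psi> x = \<zero>\<^bsub>K\<^esub>}"

lemma subsp_ker: "form \<Psi> \<Longrightarrow> subsp (ker \<Psi>)"
  by (auto simp: subsp_def ker_def form_zero form_add form_smult)

text \<open>Zorn's lemma gives a subspace M that is maximal among those containing U and missing f.
  Then P is the direct sum of M and the line through f, and the coordinate along f is the
  form.\<close>

lemma form_separation:
  assumes U: "subsp U" and f: "f \<in> carrier P" "f \<notin> U"
  obtains \<Psi> where "form \<Psi>" "\<And>u. u \<in> U \<Longrightarrow> \<Psi> u = \<zero>\<^bsub>K\<^esub>" "\<Psi> f = \<one>\<^bsub>K\<^esub>"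
proof -
  let ?A = "{V :: 'p set. subsp V \<and> U \<subseteq> V \<and> f \<notin> V}"
  have "\<exists>M\<in>?A. \<forall>V\<in>?A. M \<subseteq> V \<longrightarrow> V = M"
  proof (rule subset_Zorn_nonempty)
    show "?A \<noteq> {}" using assms by auto
    fix C assume C: "C \<noteq> {}" "subset.chain ?A C"
    then have sub: "\<And>V. V \<in> C \<Longrightarrow> subsp V \<and> U \<subseteq> V \<and> f \<notin> V" by (auto simp: subset.chain_def)
    have tot: "\<And>V W. V \<in> C \<Longrightarrow> W \<in> C \<Longrightarrow> V \<subseteq> W \<or> W \<subseteq> V" using C by (auto simp: subset.chain_def)
    have "x \<oplus> y \<in> \<Union>C" if xy: "x \<in> \<Union>C" "y \<in> \<Union>C" for x y
    proof -
      obtain V W where "V \<in> C" "x \<in> V" "W \<in> C" "y \<in> W" using xy by auto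
      then show ?thesis using tot[of V W] sub by (metis UnionI subsetD subsp_add)
    qed
    moreover have "\<zero> \<in> \<Union>C" using C(1) sub subsp_zero by blast
    moreover have "\<Union>C \<subseteq> carrier P" using sub subsp_subset by blast
    moreover have "c k \<otimes> x \<in> \<Union>C" if "k \<in> carrier K" "x \<in> \<Union>C" for k x
      using that sub by (meson Union_iff subsp_smult)
    ultimately have "subsp (\<Union>C)" unfolding subsp_def by blast
    then show "\<Union>C \<in> ?A" using sub C(1) by auto
  qed
  then obtain M where M: "subsp M" "U \<subseteq> M" "f \<notin> M"
    and max: "\<And>V. \<lbrakk>subsp V; U \<subseteq> V; f \<notin> V; M \<subseteq> V\<rbrakk> \<Longrightarrow> V = M" by auto
  \<comment> \<open>If g is outside M, maximality puts f into the span of M and g, and the exchange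
    property turns this round.\<close>
  have ex: "\<exists>k\<in>carrier K. g \<ominus> c k \<otimes> f \<in> M" if g: "g \<in> carrier P" for g
  proof -
    have "g \<in> spn (insert f M)"
    proof (cases "g \<in> M")
      case True
      then show ?thesis using g by (auto intro: spn_base)
    next
      case False
      have gM: "g \<in> spn (insert g M)" "M \<subseteq> spn (insert g M)"
        using g M(1) by (auto intro: spn_base subsp_carrier)
      then have "f \<in> spn (insert g M)" using max[of "spn (insert g M)"] M(2) False by auto
      then show ?thesis using exchange[OF M(1) g] M(3) by auto
    qed
    then show ?thesis using spn_insert_subsp[OF M(1) f(1)] by blast
  qed
  have uniq: "k = l" if kl: "k \<in> carrier K" "l \<in> carrier K" "g \<in> carrier P"
      "g \<ominus> c k \<otimes> f \<in> M" "g \<ominus> c l \<otimes> f \<in> M" for k l g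
  proof (rule ccontr)
    assume "k \<noteq> l"
    then have n: "k \<ominus>\<^bsub>K\<^esub> l \<noteq> \<zero>\<^bsub>K\<^esub>" using kl by simp
    have "(g \<ominus> c l \<otimes> f) \<ominus> (g \<ominus> c k \<otimes> f) \<in> M" by (rule subsp_diff) (use kl M in auto)
    moreover have "(g \<ominus> c l \<otimes> f) \<ominus> (g \<ominus> c k \<otimes> f) = c (k \<ominus>\<^bsub>K\<^esub> l) \<otimes> f"
      using kl f by (simp add: diff_diff_same c_diff diff_mult)
    ultimately show False using subsp_smult_cancel[OF M(1) _ n f(1)] kl M(3) by simp
  qed
  define \<Psi> where "\<Psi> g = (THE k. k \<in> carrier K \<and> g \<ominus> c k \<otimes> f \<in> M)" for g
  have eq: "\<Psi> g = k" if "g \<in> carrier P" "k \<in> carrier K" "g \<ominus> c k \<otimes> f \<in> M" for g k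
    unfolding \<Psi>_def by (rule the_equality) (use that uniq in blast)+
  have P: "\<Psi> g \<in> carrier K" "g \<ominus> c (\<Psi> g) \<otimes> f \<in> M" if "g \<in> carrier P" for g
    using ex[OF that] eq[OF that] by auto
  show thesis
  proof (rule that[of \<Psi>])
    show "form \<Psi>" unfolding form_def
    proof (intro conjI ballI funcsetI)
      fix x y assume xy: "x \<in> carrier P" "y \<in> carrier P"
      have "(x \<oplus> y) \<ominus> c (\<Psi> x \<oplus>\<^bsub>K\<^esub> \<Psi> y) \<otimes> f = (x \<ominus> c (\<Psi> x) \<otimes> f) \<oplus> (y \<ominus> c (\<Psi> y) \<otimes> f)"
        using xy P(1)[of x] P(1)[of y] f by (simp add: c_add l_distr add_diff_add)
      then show "\<Psi> (x \<oplus> y) = \<Psi> x \<oplus>\<^bsub>K\<^esub> \<Psi> y"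
        using P xy by (intro eq) (auto intro: subsp_add M)
    next
      fix k x assume xy: "k \<in> carrier K" "x \<in> carrier P"
      have "(c k \<otimes> x) \<ominus> c (k \<otimes>\<^bsub>K\<^esub> \<Psi> x) \<otimes> f = c k \<otimes> (x \<ominus> c (\<Psi> x) \<otimes> f)"
        using xy P(1)[of x] f by (simp add: c_mult m_assoc mult_diff)
      then show "\<Psi> (c k \<otimes> x) = k \<otimes>\<^bsub>K\<^esub> \<Psi> x"
        using P xy by (intro eq) (auto intro: subsp_smult M)
    qed (use P in auto)
    show "\<Psi> u = \<zero>\<^bsub>K\<^esub>" if "u \<in> U" for u
      using that M(2) subsp_carrier[OF U] f by (intro eq) (auto simp: a_minus_def)
    show "\<Psi> f = \<one>\<^bsub>K\<^esub>"
      using f subsp_zero[OF M(1)] by (intro eq) (auto simp: a_minus_def r_neg)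
  qed
qed

section \<open>Codimension, counted by generators modulo a subspace\<close>

definition fin_codim :: "'p set \<Rightarrow> bool" where
  "fin_codim U \<longleftrightarrow> (\<exists>B. finite B \<and> B \<subseteq> carrier P \<and> spn (U \<union> B) = carrier P)"

text \<open>For a subspace U this is the dimension of P/U. The value is unspecified unless
  \<open>fin_codim U\<close> holds.\<close>

definition codim :: "'p set \<Rightarrow> nat" where
  "codim U = (LEAST d. \<exists>B. finite B \<and> card B = d \<and> B \<subseteq> carrier P \<and> spn (U \<union> B) = carrier P)"

lemma codim_basis:
  assumes "fin_codim U"
  obtains B where "finite B" "card B = codim U" "B \<subseteq> carrier P" "spn (U \<union> B) = carrier P"
proof -
  have "\<exists>d B. finite B \<and> card B = d \<and> B \<subseteq> carrier P \<and> spn (U \<union> B) = carrier P"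
    using assms unfolding fin_codim_def by auto
  then have "\<exists>B. finite B \<and> card B = codim U \<and> B \<subseteq> carrier P \<and> spn (U \<union> B) = carrier P"
    unfolding codim_def by (rule LeastI_ex)
  then show thesis using that by auto
qed

lemma codim_le:
  "\<lbrakk>finite B; B \<subseteq> carrier P; spn (U \<union> B) = carrier P\<rbrakk> \<Longrightarrow> codim U \<le> card B"
  unfolding codim_def by (rule Least_le) auto

lemma spn_carrier_mono: "\<lbrakk>spn S = carrier P; S \<subseteq> T\<rbrakk> \<Longrightarrow> spn T = carrier P"
  using spn_mono[of S T] spn_closed by blast

lemma fin_codim_mono: "\<lbrakk>fin_codim U; U \<subseteq> V\<rbrakk> \<Longrightarrow> fin_codim V"
proof -
  assume a: "fin_codim U" "U \<subseteq> V"
  then obtain B where B: "finite B" "B \<subseteq> carrier P" "spn (U \<union> B) = carrier P" by (auto simp: fin_codim_def)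
  then have "spn (V \<union> B) = carrier P" using a by (intro spn_carrier_mono[OF B(3)]) auto
  then show ?thesis using B by (auto simp: fin_codim_def)
qed

lemma codim_mono: "\<lbrakk>fin_codim U; U \<subseteq> V\<rbrakk> \<Longrightarrow> codim V \<le> codim U"
proof -
  assume a: "fin_codim U" "U \<subseteq> V"
  obtain B where B: "finite B" "card B = codim U" "B \<subseteq> carrier P" "spn (U \<union> B) = carrier P"
    using codim_basis[OF a(1)] .
  then have "spn (V \<union> B) = carrier P" using a by (intro spn_carrier_mono[OF B(4)]) auto
  then show ?thesis using codim_le[OF B(1,3)] B(2) by simp
qed

lemma codim_carrier: "codim (carrier P) = 0"
  using codim_le[of "{}" "carrier P"] spn_subsp[OF subsp_carrier_P] by simp

text \<open>Elements of B are peeled off as long as v stays in the span of the rest and U; the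
  element whose removal expels v can be traded for v.\<close>

lemma exchange_finite:
  assumes "finite B" "B \<subseteq> carrier P" "subsp U" "v \<in> spn (U \<union> B)" "v \<notin> U"
  shows "\<exists>b\<in>B. b \<in> spn (insert v (U \<union> (B - {b})))"
  using assms(1,2,4)
proof (induction B rule: finite_induct)
  case empty
  then show ?case using spn_subsp[OF assms(3)] assms(5) by simp
next
  case (insert x B)
  show ?case
  proof (cases "v \<in> spn (U \<union> B)")
    case True
    then obtain b where "b \<in> B" "b \<in> spn (insert v (U \<union> (B - {b})))" using insert by auto
    then show ?thesis using spn_mono[of "insert v (U \<union> (B - {b}))" "insert v (U \<union> (insert x B - {b}))"] by auto
  next
    case False
    have "v \<in> spn (insert x (spn (U \<union> B)))"
      using insert.prems(2) spn_least[of "spn (insert x (spn (U \<union> B)))" "U \<union> insert x B"]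
      by (auto intro: spn_base)
    then have "x \<in> spn (insert v (spn (U \<union> B)))" using exchange[OF subsp_spn _ _ False] insert by auto
    moreover have "spn (insert v (spn (U \<union> B))) \<subseteq> spn (insert v (U \<union> B))"
      by (rule spn_least) (auto intro: spn_base, meson spn_mono subsetD subset_insertI)
    ultimately show ?thesis using insert.hyps by auto
  qed
qed

lemma codim_strict:
  assumes "subsp U" "fin_codim U" "U \<subset> V" "V \<subseteq> carrier P" shows "codim V < codim U"
proof -
  obtain B where B: "finite B" "card B = codim U" "B \<subseteq> carrier P" "spn (U \<union> B) = carrier P"
    using codim_basis[OF assms(2)] .
  obtain v where v: "v \<in> V" "v \<notin> U" "v \<in> carrier P" using assms by auto
  obtain b where b: "b \<in> B" "b \<in> spn (insert v (U \<union> (B - {b})))"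
    using exchange_finite[OF B(1,3) assms(1), of v] v B(4) by auto
  have "insert v (U \<union> (B - {b})) \<subseteq> V \<union> (B - {b})" using v assms by auto
  then have sub: "spn (insert v (U \<union> (B - {b}))) \<subseteq> spn (V \<union> (B - {b}))" by (rule spn_mono)
  have "spn (U \<union> B) \<subseteq> spn (V \<union> (B - {b}))"
    by (rule spn_least) (use sub b assms in \<open>auto intro: spn_base\<close>)
  then have "spn (V \<union> (B - {b})) = carrier P" using B(4) spn_closed by auto
  then have "codim V \<le> card (B - {b})" using B by (intro codim_le) auto
  also have "\<dots> < card B" using B b by (meson card_Diff1_less)
  finally show ?thesis using B by simp
qed

lemma codim_insert:
  assumes "fin_codim U" "b \<in> carrier P" shows "codim U \<le> Suc (codim (spn (insert b U)))"
proof -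
  have "fin_codim (spn (insert b U))"
  proof -
    obtain B where B: "finite B" "B \<subseteq> carrier P" "spn (U \<union> B) = carrier P"
      using assms(1) unfolding fin_codim_def by auto
    have "spn (U \<union> B) \<subseteq> spn (spn (insert b U) \<union> B)"
      by (rule spn_least) (auto intro: spn_base)
    then have "spn (spn (insert b U) \<union> B) = carrier P" using B(3) spn_closed by auto
    then show ?thesis unfolding fin_codim_def using B(1,2) by auto
  qed
  then obtain B where B: "finite B" "card B = codim (spn (insert b U))" "B \<subseteq> carrier P"
      "spn (spn (insert b U) \<union> B) = carrier P" using codim_basis by blast
  have "spn (insert b U) \<subseteq> spn (U \<union> insert b B)" by (rule spn_mono) auto
  then have "spn (spn (insert b U) \<union> B) \<subseteq> spn (U \<union> insert b B)"
    by (intro spn_least) (auto intro: spn_base)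
  then have "spn (U \<union> insert b B) = carrier P" using B(4) spn_closed by auto
  then have "codim U \<le> card (insert b B)" using B assms by (intro codim_le) auto
  also have "\<dots> \<le> Suc (card B)" by (rule card_insert_le_m1) auto
  finally show ?thesis using B by simp
qed

text \<open>Inside U the kernel is a hyperplane with complement spanned by f: subtracting (\<Psi> u
  / \<Psi> f) f moves any u into the kernel.\<close>

lemma ker_split:
  assumes U: "subsp U" and \<Psi>: "form \<Psi>" and f: "f \<in> U" "\<Psi> f \<noteq> \<zero>\<^bsub>K\<^esub>"
  shows "U = spn (insert f (U \<inter> ker \<Psi>))"
proof
  show "spn (insert f (U \<inter> ker \<Psi>)) \<subseteq> U" by (rule spn_least) (use U f in auto)
  show "U \<subseteq> spn (insert f (U \<inter> ker \<Psi>))"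
  proof
    fix u assume u: "u \<in> U"
    have fu: "f \<in> carrier P" "u \<in> carrier P" using subsp_carrier[OF U] u f by auto
    have K: "\<Psi> f \<in> carrier K" "\<Psi> u \<in> carrier K" "inv\<^bsub>K\<^esub> (\<Psi> f) \<in> carrier K"
      using form_closed[OF \<Psi>] fu f K.field_Units by auto
    define k where "k = \<Psi> u \<otimes>\<^bsub>K\<^esub> inv\<^bsub>K\<^esub> (\<Psi> f)"
    have k: "k \<in> carrier K" using K by (simp add: k_def)
    have "k \<otimes>\<^bsub>K\<^esub> \<Psi> f = \<Psi> u"
      unfolding k_def using K f(2) by (simp add: K.m_assoc K.Units_l_inv K.field_Units)
    then have "\<Psi> (u \<ominus> c k \<otimes> f) = \<zero>\<^bsub>K\<^esub>"
      using k fu K by (simp add: form_diff[OF \<Psi>] form_smult[OF \<Psi>] K.r_neg K.minus_eq)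
    then have w: "u \<ominus> c k \<otimes> f \<in> U \<inter> ker \<Psi>"
      using u f U fu k by (auto simp: ker_def intro: subsp_diff subsp_smult)
    have "(u \<ominus> c k \<otimes> f) \<oplus> c k \<otimes> f \<in> spn (insert f (U \<inter> ker \<Psi>))"
      using w fu k by (intro spn_add spn_smult) (auto intro: spn_base)
    moreover have "(u \<ominus> c k \<otimes> f) \<oplus> c k \<otimes> f = u" using fu k by (simp add: diff_add_cancel)
    ultimately show "u \<in> spn (insert f (U \<inter> ker \<Psi>))" by simp
  qed
qed

lemma codim_Int_ker:
  assumes "subsp U" "form \<Psi>" "fin_codim (U \<inter> ker \<Psi>)" shows "codim (U \<inter> ker \<Psi>) \<le> Suc (codim U)"
proof (cases "U \<subseteq> ker \<Psi>")
  case True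
  then show ?thesis by (simp add: inf.absorb1)
next
  case False
  then obtain f where f: "f \<in> U" "f \<notin> ker \<Psi>" by auto
  have fc: "f \<in> carrier P" using f assms subsp_carrier by auto
  show ?thesis using codim_insert[OF assms(3) fc] ker_split[OF assms(1,2), of f] f fc
    by (simp add: ker_def)
qed

end

section \<open>Maximal ideals and socles modulo an ideal of finite codimension\<close>

context field_algebra
begin

text \<open>Multiplication by -1 supplies negatives, and commutativity the absorption on the other
  side.\<close>

lemma idealI':
  assumes "S \<subseteq> carrier P" "\<zero> \<in> S" "\<And>x y. \<lbrakk>x \<in> S; y \<in> S\<rbrakk> \<Longrightarrow> x \<oplus> y \<in> S"
    and "\<And>a x. \<lbrakk>a \<in> carrier P; x \<in> S\<rbrakk> \<Longrightarrow> a \<otimes> x \<in> S"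
  shows "ideal S P"
proof (rule idealI[OF ring_axioms])
  show "subgroup S (add_monoid P)"
  proof (rule add.subgroupI)
    fix a assume a: "a \<in> S"
    then have "(\<ominus> \<one>) \<otimes> a \<in> S" using assms by auto
    moreover have "(\<ominus> \<one>) \<otimes> a = \<ominus> a" using a assms(1) by (auto simp: l_minus)
    ultimately show "\<ominus> a \<in> S" by simp
  qed (use assms in auto)
  show "x \<otimes> a \<in> S" "a \<otimes> x \<in> S" if "a \<in> S" "x \<in> carrier P" for a x
    using that assms(4)[of x a] m_comm[of a x] assms(1) by auto
qed

lemma
  assumes "ideal J P"
  shows ideal_carrier: "x \<in> J \<Longrightarrow> x \<in> carrier P"
    and ideal_subset: "J \<subseteq> carrier P"
    and ideal_zero: "\<zero> \<in> J"
    and ideal_add: "\<lbrakk>x \<in> J; y \<in> J\<rbrakk> \<Longrightarrow> x \<oplus> y \<in> J"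
    and ideal_lmult: "\<lbrakk>x \<in> J; a \<in> carrier P\<rbrakk> \<Longrightarrow> a \<otimes> x \<in> J"
    and ideal_rmult: "\<lbrakk>x \<in> J; a \<in> carrier P\<rbrakk> \<Longrightarrow> x \<otimes> a \<in> J"
    and ideal_diff: "\<lbrakk>x \<in> J; y \<in> J\<rbrakk> \<Longrightarrow> x \<ominus> y \<in> J"
proof -
  interpret J: ideal J P by fact
  show "x \<in> J \<Longrightarrow> x \<in> carrier P" "J \<subseteq> carrier P" "\<zero> \<in> J" "\<lbrakk>x \<in> J; y \<in> J\<rbrakk> \<Longrightarrow> x \<oplus> y \<in> J"
    "\<lbrakk>x \<in> J; a \<in> carrier P\<rbrakk> \<Longrightarrow> a \<otimes> x \<in> J" "\<lbrakk>x \<in> J; a \<in> carrier P\<rbrakk> \<Longrightarrow> x \<otimes> a \<in> J"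
    using J.a_subset J.I_l_closed J.I_r_closed by auto
  show "\<lbrakk>x \<in> J; y \<in> J\<rbrakk> \<Longrightarrow> x \<ominus> y \<in> J" using subsp_diff[OF subsp_ideal[OF assms]] .
qed

lemma ideal_one: "ideal J P \<Longrightarrow> \<one> \<in> J \<longleftrightarrow> J = carrier P"
  using ideal.one_imp_carrier by auto

lemma ideal_Int: "\<lbrakk>ideal I P; ideal J P\<rbrakk> \<Longrightarrow> ideal (I \<inter> J) P"
  using i_intersect by blast

lemma ideal_Inter: assumes "\<And>N. N \<in> S \<Longrightarrow> ideal N P" shows "ideal (carrier P \<inter> \<Inter>S) P"
  by (rule idealI') (use assms ideal_zero ideal_add ideal_lmult in auto)

section \<open>Adjoining an element to an ideal, colon ideals and socles\<close>

definition adj :: "'p set \<Rightarrow> 'p \<Rightarrow> 'p set" where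
  "adj I f = {i \<oplus> a \<otimes> f | i a. i \<in> I \<and> a \<in> carrier P}"

lemma adjI: "\<lbrakk>i \<in> I; a \<in> carrier P\<rbrakk> \<Longrightarrow> i \<oplus> a \<otimes> f \<in> adj I f"
  by (auto simp: adj_def)

lemma adj_ideal:
  assumes "ideal I P" "f \<in> carrier P" shows "ideal (adj I f) P"
proof -
  have "adj I f = I <+>\<^bsub>P\<^esub> (PIdl f)"
    by (auto simp: adj_def set_add_def set_mult_def cgenideal_def)
  then show ?thesis using add_ideals[OF assms(1) cgenideal_ideal[OF assms(2)]] by simp
qed

lemma adj_superset: assumes "ideal I P" "f \<in> carrier P" shows "I \<subseteq> adj I f"
proof
  fix i assume "i \<in> I"
  then show "i \<in> adj I f" using adjI[of i I \<zero> f] assms ideal_carrier[OF assms(1)] by simp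
qed

lemma adj_member: assumes "ideal I P" "f \<in> carrier P" shows "f \<in> adj I f"
  using adjI[of \<zero> I \<one> f] assms ideal_zero[OF assms(1)] by simp

lemma adj_least: assumes "ideal J P" "I \<subseteq> J" "f \<in> J" shows "adj I f \<subseteq> J"
  using assms by (auto simp: adj_def intro!: ideal_add ideal_lmult)

lemma adj_psubset: "\<lbrakk>ideal I P; f \<in> carrier P; f \<notin> I\<rbrakk> \<Longrightarrow> I \<subset> adj I f"
  using adj_superset adj_member by blast

definition colon :: "'p set \<Rightarrow> 'p \<Rightarrow> 'p set" where
  "colon I f = {g \<in> carrier P. g \<otimes> f \<in> I}"

lemma colon_ideal: "\<lbrakk>ideal I P; f \<in> carrier P\<rbrakk> \<Longrightarrow> ideal (colon I f) P"
  by (rule idealI')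
    (auto simp: colon_def l_distr m_assoc ideal_zero intro: ideal_add ideal_lmult)

lemma colon_superset: "\<lbrakk>ideal I P; f \<in> carrier P\<rbrakk> \<Longrightarrow> I \<subseteq> colon I f"
  by (auto simp: colon_def ideal_carrier intro: ideal_rmult)

lemma colon_proper: "\<lbrakk>f \<in> carrier P; f \<notin> I\<rbrakk> \<Longrightarrow> \<one> \<notin> colon I f"
  by (auto simp: colon_def)

text \<open>The colon ideal I : M. For a maximal ideal M over I its image in P/I is the part of the
  socle that belongs to M.\<close>

definition soc :: "'p set \<Rightarrow> 'p set \<Rightarrow> 'p set" where
  "soc I M = {f \<in> carrier P. \<forall>m\<in>M. m \<otimes> f \<in> I}"

lemma soc_ideal:
  assumes "ideal I P" "M \<subseteq> carrier P" shows "ideal (soc I M) P"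
proof (rule idealI')
  fix a x assume ax: "a \<in> carrier P" "x \<in> soc I M"
  have "m \<otimes> (a \<otimes> x) \<in> I" if m: "m \<in> M" for m
  proof -
    have "m \<otimes> (a \<otimes> x) = a \<otimes> (m \<otimes> x)" using m_lcomm[of m a x] ax m assms by (auto simp: soc_def)
    then show ?thesis using ax m assms(1) by (auto simp: soc_def intro: ideal_lmult)
  qed
  then show "a \<otimes> x \<in> soc I M" using ax by (auto simp: soc_def)
next
  fix x y assume xy: "x \<in> soc I M" "y \<in> soc I M"
  have "m \<otimes> (x \<oplus> y) \<in> I" if m: "m \<in> M" for m
  proof -
    have "m \<in> carrier P" using m assms by auto
    then show ?thesis using xy m assms(1) by (auto simp: soc_def r_distr intro: ideal_add)
  qed
  then show "x \<oplus> y \<in> soc I M" using xy by (auto simp: soc_def)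
qed (use assms ideal_zero[OF assms(1)] in \<open>auto simp: soc_def\<close>)

lemma soc_superset: "\<lbrakk>ideal I P; M \<subseteq> carrier P\<rbrakk> \<Longrightarrow> I \<subseteq> soc I M"
  by (auto simp: soc_def ideal_carrier intro: ideal_lmult)

section \<open>Maximal ideals\<close>

lemma
  assumes "maximalideal M P"
  shows maximal_ideal: "ideal M P"
    and maximal_subset: "M \<subseteq> carrier P"
    and maximal_one: "\<one> \<notin> M"
    and maximal_eq: "\<lbrakk>ideal J P; M \<subseteq> J; J \<noteq> carrier P\<rbrakk> \<Longrightarrow> J = M"
proof -
  interpret M: maximalideal M P by fact
  show id: "ideal M P" by (rule M.is_ideal)
  show "M \<subseteq> carrier P" using ideal_subset[OF id] .
  show "\<one> \<notin> M" using ideal_one[OF id] M.I_notcarr by auto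
  show "\<lbrakk>ideal J P; M \<subseteq> J; J \<noteq> carrier P\<rbrakk> \<Longrightarrow> J = M"
    using M.I_maximal ideal_subset by blast
qed

lemma maximal_inverse:
  assumes M: "maximalideal M P" and a: "a \<in> carrier P" "a \<notin> M"
  obtains b where "b \<in> carrier P" "\<one> \<ominus> b \<otimes> a \<in> M"
proof -
  note id = maximal_ideal[OF M]
  have "adj M a = carrier P"
    using maximal_eq[OF M adj_ideal[OF id a(1)] adj_superset[OF id a(1)]] adj_member[OF id a(1)] a by auto
  then obtain m b where mb: "m \<in> M" "b \<in> carrier P" "\<one> = m \<oplus> b \<otimes> a"
    using one_closed unfolding adj_def by blast
  have "\<one> \<ominus> b \<otimes> a = m" using mb a ideal_carrier[OF id] by (simp add: add_diff_cancel)
  then show thesis using that mb by auto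
qed

lemma maximal_prime:
  assumes M: "maximalideal M P" and "a \<in> carrier P" "b \<in> carrier P" "a \<otimes> b \<in> M"
  shows "a \<in> M \<or> b \<in> M"
proof -
  interpret primeideal M P by (rule maximalideal_prime[OF M])
  show ?thesis using I_prime assms by blast
qed

lemma maximal_distinct:
  assumes "maximalideal M P" "maximalideal N P" "M \<noteq> N" obtains x where "x \<in> N" "x \<notin> M"
  using maximal_eq[OF assms(2) maximal_ideal[OF assms(1)]] maximal_one[OF assms(1)] assms(3) that by auto

text \<open>Take the product of one element from each ideal, chosen outside M. It lies in all of
  them, and outside M because M is prime.\<close>

lemma avoid_maximal:
  assumes "finite S" "\<And>N. N \<in> S \<Longrightarrow> ideal N P" "maximalideal M P"
    "\<And>N. N \<in> S \<Longrightarrow> \<not> N \<subseteq> M"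
  shows "\<exists>g\<in>carrier P. g \<in> \<Inter>S \<and> g \<notin> M"
  using assms(1,2,4)
proof (induction S rule: finite_induct)
  case empty
  then show ?case using maximal_one[OF assms(3)] by auto
next
  case (insert N S)
  then obtain g where g: "g \<in> carrier P" "g \<in> \<Inter>S" "g \<notin> M" by auto
  obtain x where x: "x \<in> N" "x \<notin> M" using insert by blast
  have xc: "x \<in> carrier P" using x insert.prems(1)[of N] ideal_carrier by auto
  have "g \<otimes> x \<in> \<Inter>(insert N S)" using g x xc insert.prems(1) by (auto intro: ideal_lmult ideal_rmult)
  moreover have "g \<otimes> x \<notin> M" using maximal_prime[OF assms(3) g(1) xc] g x by auto
  ultimately show ?case using g xc by (intro bexI[of _ "g \<otimes> x"]) auto
qed

definition max_over :: "'p set \<Rightarrow> 'p set set" where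
  "max_over I = {M. maximalideal M P \<and> I \<subseteq> M}"

text \<open>Each further maximal ideal strictly shrinks the intersection of the previous ones, by
  avoidance. So n of them have an intersection of codimension at least n, and this is at most the
  codimension of I.\<close>

lemma finite_max_over:
  assumes I: "ideal I P" "fin_codim I" shows "finite (max_over I)"
proof -
  have "card S \<le> codim (carrier P \<inter> \<Inter>S)" if "finite S" "S \<subseteq> max_over I" for S
    using that
  proof (induction S rule: finite_induct)
    case (insert M S)
    have M: "maximalideal M P" "I \<subseteq> M" and S: "\<And>N. N \<in> S \<Longrightarrow> maximalideal N P \<and> I \<subseteq> N"
      using insert by (auto simp: max_over_def)
    have "\<not> N \<subseteq> M" if "N \<in> S" for N
      using S that insert.hyps maximal_distinct[OF M(1), of N] by (metis subsetD)
    then obtain g where g: "g \<in> carrier P" "g \<in> \<Inter>S" "g \<notin> M"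
      using avoid_maximal[OF insert.hyps(1) _ M(1)] S maximal_ideal by metis
    have "subsp (carrier P \<inter> \<Inter>(insert M S))"
      by (rule subsp_ideal[OF ideal_Inter]) (use M S maximal_ideal in auto)
    moreover have "fin_codim (carrier P \<inter> \<Inter>(insert M S))"
      by (rule fin_codim_mono[OF I(2)]) (use M S ideal_carrier[OF I(1)] in auto)
    ultimately have "codim (carrier P \<inter> \<Inter>S) < codim (carrier P \<inter> \<Inter>(insert M S))"
      by (rule codim_strict) (use g in auto)
    then show ?case using insert by auto
  qed simp
  moreover have "codim (carrier P \<inter> \<Inter>S) \<le> codim I" if "S \<subseteq> max_over I" for S
    by (rule codim_mono[OF I(2)]) (use that ideal_carrier[OF I(1)] in \<open>auto simp: max_over_def\<close>)
  ultimately show ?thesis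
    using finite_if_finite_subsets_card_bdd[of "max_over I" "codim I"] by (meson le_trans)
qed

section \<open>Minimal ideals over I and their generation by socle elements\<close>

definition minimal_over :: "'p set \<Rightarrow> 'p set \<Rightarrow> bool" where
  "minimal_over I J \<longleftrightarrow> ideal J P \<and> I \<subset> J \<and> (\<forall>J'. ideal J' P \<longrightarrow> I \<subset> J' \<longrightarrow> J' \<subseteq> J \<longrightarrow> J' = J)"

text \<open>An ideal of greatest codimension among those strictly above I and inside J is minimal,
  since a smaller one would have greater codimension.\<close>

lemma minimal_over_exists:
  assumes I: "ideal I P" "fin_codim I" and J: "ideal J P" "I \<subset> J"
  obtains J' where "minimal_over I J'" "J' \<subseteq> J"
proof -
  let ?Q = "\<lambda>J'. ideal J' P \<and> I \<subset> J' \<and> J' \<subseteq> J"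
  have "\<exists>J'. ?Q J' \<and> (\<forall>y. ?Q y \<longrightarrow> codim y \<le> codim J')"
    by (rule ex_has_greatest_nat[of ?Q J _ "Suc (codim I)"])
      (use J codim_mono[OF I(2)] in \<open>auto simp: less_Suc_eq_le\<close>)
  then obtain J' where J': "?Q J'" and max: "\<And>y. ?Q y \<Longrightarrow> codim y \<le> codim J'" by blast
  have "y = J'" if y: "ideal y P" "I \<subset> y" "y \<subseteq> J'" for y
  proof -
    have "codim y \<le> codim J'" using max[of y] y J' by auto
    then show ?thesis
      using codim_strict[of y J'] y J' subsp_ideal fin_codim_mono[OF I(2), of y] ideal_subset[of J']
      by (metis less_imp_le not_less psubset_imp_subset psubsetI)
  qed
  then have "minimal_over I J'" using J' by (auto simp: minimal_over_def)
  then show thesis using that J' by blast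
qed

lemma minimal_over_adj:
  assumes I: "ideal I P" and J: "minimal_over I J" and f: "f \<in> J" "f \<notin> I" shows "J = adj I f"
proof -
  have id: "ideal J P" and sub: "I \<subseteq> J" using J by (auto simp: minimal_over_def)
  have fc: "f \<in> carrier P" using ideal_carrier[OF id f(1)] .
  have "adj I f \<subseteq> J" using adj_least[OF id sub f(1)] .
  then show ?thesis using J adj_ideal[OF I fc] adj_psubset[OF I fc f(2)] unfolding minimal_over_def by metis
qed

text \<open>J/I is a simple module generated by f, hence isomorphic to P/(I : f), and the
  annihilator of a simple module is maximal.\<close>

lemma minimal_over_maximal:
  assumes I: "ideal I P" and J: "minimal_over I J" and f: "f \<in> J" "f \<notin> I"
  shows "colon I f \<in> max_over I" "J \<subseteq> soc I (colon I f)"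
proof -
  have id: "ideal J P" and sub: "I \<subseteq> J" using J by (auto simp: minimal_over_def)
  have fc: "f \<in> carrier P" using ideal_carrier[OF id f(1)] .
  note cid = colon_ideal[OF I fc]
  have "maximalideal (colon I f) P"
  proof (rule maximalidealI[OF cid])
    show "carrier P \<noteq> colon I f" using colon_proper[OF fc f(2)] by auto
    fix N assume N: "ideal N P" "colon I f \<subseteq> N" "N \<subseteq> carrier P"
    show "N = colon I f \<or> N = carrier P"
    proof (rule disjCI)
      assume "N \<noteq> carrier P"
      show "N = colon I f"
      proof (rule ccontr)
        assume "N \<noteq> colon I f"
        then obtain g where g: "g \<in> N" "g \<notin> colon I f" using N by auto
        have gc: "g \<in> carrier P" using g N by auto
        \<comment> \<open>Since g is outside the colon ideal, g f is again outside I and generates J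
          by minimality. From f = a g f modulo I it follows that 1 - a g lies in the colon ideal,
          hence in N.\<close>
        have "f \<in> adj I (g \<otimes> f)"
          using minimal_over_adj[OF I J, of "g \<otimes> f"] ideal_lmult[OF id f(1) gc] g gc f by (auto simp: colon_def)
        then obtain i a where ia: "i \<in> I" "a \<in> carrier P" "f = i \<oplus> a \<otimes> (g \<otimes> f)" by (auto simp: adj_def)
        have "(\<one> \<ominus> a \<otimes> g) \<otimes> f = f \<ominus> a \<otimes> (g \<otimes> f)" using ia(2) gc fc by (simp add: diff_mult m_assoc)
        also have "\<dots> = i" using ia fc gc ideal_carrier[OF I] by (metis add_diff_cancel m_closed)
        finally have "\<one> \<ominus> a \<otimes> g \<in> N" using N ia gc by (auto simp: colon_def)
        then have "(\<one> \<ominus> a \<otimes> g) \<oplus> a \<otimes> g \<in> N" using ideal_add[OF N(1)] ideal_lmult[OF N(1) g(1) ia(2)] by blast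
        then have "\<one> \<in> N" using ia gc by (simp add: diff_add_cancel)
        then show False using ideal_one[OF N(1)] \<open>N \<noteq> carrier P\<close> by simp
      qed
    qed
  qed
  then show "colon I f \<in> max_over I" using colon_superset[OF I fc] by (simp add: max_over_def)
  have "J = adj I f" by (rule minimal_over_adj[OF I J f])
  also have "adj I f \<subseteq> soc I (colon I f)"
    by (rule adj_least[OF soc_ideal[OF I] soc_superset[OF I]]) (use fc in \<open>auto simp: colon_def soc_def\<close>)
  finally show "J \<subseteq> soc I (colon I f)" .
qed

lemma colon_soc:
  assumes "ideal I P" "maximalideal M P" "f \<in> soc I M" "f \<notin> I" shows "colon I f = M"
proof -
  have fc: "f \<in> carrier P" using assms by (simp add: soc_def)
  have "M \<subseteq> colon I f" using assms maximal_subset[OF assms(2)] by (auto simp: colon_def soc_def)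
  then show ?thesis
    using maximal_eq[OF assms(2) colon_ideal[OF assms(1) fc]] colon_proper[OF fc assms(4)] by auto
qed

text \<open>Modulo I the multiples of f form a line over P/M. An element a f outside I has a outside
  M, and an inverse of a modulo M recovers f.\<close>

lemma adj_soc_minimal:
  assumes "ideal I P" "maximalideal M P" "f \<in> soc I M" "f \<notin> I" shows "minimal_over I (adj I f)"
proof -
  have fc: "f \<in> carrier P" using assms by (simp add: soc_def)
  have "J = adj I f" if J: "ideal J P" "I \<subset> J" "J \<subseteq> adj I f" for J
  proof -
    obtain x where x: "x \<in> J" "x \<notin> I" using J by auto
    then have "x \<in> adj I f" using J by blast
    then obtain i a where ia: "i \<in> I" "a \<in> carrier P" "x = i \<oplus> a \<otimes> f" by (auto simp: adj_def)
    have ic: "i \<in> carrier P" using ia ideal_carrier[OF assms(1)] by simp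
    have "a \<notin> M" using x ia assms by (auto simp: soc_def intro: ideal_add)
    then obtain b where b: "b \<in> carrier P" "\<one> \<ominus> b \<otimes> a \<in> M" using maximal_inverse[OF assms(2) ia(2)] by blast
    have "a \<otimes> f = x \<ominus> i" using ia ic fc by (simp add: a_comm[of i] add_diff_cancel)
    then have af: "a \<otimes> f \<in> J" using ideal_diff[OF J(1) x(1), of i] ia J(2) by auto
    have "(\<one> \<ominus> b \<otimes> a) \<otimes> f \<in> J" using b assms J by (auto simp: soc_def)
    then have "(\<one> \<ominus> b \<otimes> a) \<otimes> f \<oplus> b \<otimes> (a \<otimes> f) \<in> J"
      by (rule ideal_add[OF J(1)]) (use af b ideal_lmult[OF J(1)] in auto)
    moreover have "(\<one> \<ominus> b \<otimes> a) \<otimes> f \<oplus> b \<otimes> (a \<otimes> f) = f"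
      using ia b fc by (simp add: diff_mult m_assoc diff_add_cancel)
    ultimately have "adj I f \<subseteq> J" using adj_least[OF J(1)] J(2) by auto
    then show ?thesis using J by auto
  qed
  then show ?thesis using adj_ideal[OF assms(1) fc] adj_psubset[OF assms(1) fc assms(4)]
    unfolding minimal_over_def by auto
qed

text \<open>Multiplication by f induces an isomorphism of P/M with (I + P f)/I. The inequality
  follows from injectivity alone, by climbing from M to P one vector at a time.\<close>

lemma codim_adj_soc:
  assumes I: "ideal I P" "fin_codim I" and M: "M \<in> max_over I" and f: "f \<in> soc I M" "f \<notin> I"
  shows "codim (adj I f) + codim M \<le> codim I"
proof -
  have M': "maximalideal M P" "I \<subseteq> M" using M by (auto simp: max_over_def)
  have fc: "f \<in> carrier P" using f by (simp add: soc_def)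
  \<comment> \<open>The subspace I + U f interpolates between I + M f, which contains I, and I + P
    f, which is \<open>adj I f\<close>.\<close>
  let ?T = "\<lambda>U. {i \<oplus> u \<otimes> f | i u. i \<in> I \<and> u \<in> U}"
  have Isub: "I \<subseteq> ?T U" if "subsp U" for U
  proof
    fix i assume i: "i \<in> I"
    then have "i = i \<oplus> \<zero> \<otimes> f" using fc ideal_carrier[OF I(1)] by simp
    then show "i \<in> ?T U" using i subsp_zero[OF that] by blast
  qed
  have subT: "subsp (?T U)" if U: "subsp U" for U
  proof -
    have uc: "u \<in> carrier P" if "u \<in> U" for u using subsp_carrier[OF U] that .
    have ic: "i \<in> carrier P" if "i \<in> I" for i using ideal_carrier[OF I(1)] that .
    show ?thesis unfolding subsp_def
    proof (intro conjI ballI)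
      show "?T U \<subseteq> carrier P" using uc ic fc by auto
      show "\<zero> \<in> ?T U" using Isub[OF U] ideal_zero[OF I(1)] by blast
      fix x assume "x \<in> ?T U"
      then obtain i u where x: "x = i \<oplus> u \<otimes> f" "i \<in> I" "u \<in> U" by auto
      show "c k \<otimes> x \<in> ?T U" if k: "k \<in> carrier K" for k
      proof -
        have "c k \<otimes> x = c k \<otimes> i \<oplus> (c k \<otimes> u) \<otimes> f" using x uc ic fc k by (simp add: r_distr m_assoc)
        moreover have "c k \<otimes> i \<in> I" "c k \<otimes> u \<in> U"
          using x k ideal_lmult[OF I(1)] subsp_smult[OF U] by auto
        ultimately show ?thesis by blast
      qed
      fix y assume "y \<in> ?T U"
      then obtain j v where y: "y = j \<oplus> v \<otimes> f" "j \<in> I" "v \<in> U" by auto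
      have "x \<oplus> y = (i \<oplus> j) \<oplus> (u \<oplus> v) \<otimes> f" using x y uc ic fc by (simp add: l_distr a_ac)
      then show "x \<oplus> y \<in> ?T U" using x y ideal_add[OF I(1)] subsp_add[OF U] by blast
    qed
  qed
  have "codim (?T (carrier P)) + codim U \<le> codim (?T U)" if "subsp U" "M \<subseteq> U" for U
    using that
  proof (induction "codim U" arbitrary: U rule: less_induct)
    case less
    have fU: "fin_codim U" using fin_codim_mono[OF I(2)] M' less by auto
    show ?case
    proof (cases "U = carrier P")
      case True
      then show ?thesis by (simp add: codim_carrier)
    next
      case False
      then obtain b where b: "b \<in> carrier P" "b \<notin> U" using subsp_subset less by auto
      define V where "V = spn (insert b U)"
      have V: "subsp V" "U \<subset> V" "b \<in> V"
        using b subsp_subset[OF less.prems(1)] by (auto simp: V_def intro: spn_base)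
      have "codim V < codim U" using codim_strict[OF less.prems(1) fU V(2)] subsp_subset[OF V(1)] by simp
      then have IH: "codim (?T (carrier P)) + codim V \<le> codim (?T V)" using less V by auto
      \<comment> \<open>A relation b f = i + u f would put b - u into I : f = M, which lies in U,
        although b is outside U.\<close>
      have bn: "b \<otimes> f \<notin> ?T U"
      proof
        assume "b \<otimes> f \<in> ?T U"
        then obtain i u where x: "b \<otimes> f = i \<oplus> u \<otimes> f" "i \<in> I" "u \<in> U" by auto
        have uc: "u \<in> carrier P" "i \<in> carrier P" using x subsp_carrier[OF less.prems(1)] ideal_carrier[OF I(1)] by auto
        then have "(b \<ominus> u) \<otimes> f = i" using x b fc by (simp add: diff_mult add_diff_cancel)
        then have "b \<ominus> u \<in> colon I f" using x b uc by (simp add: colon_def)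
        then have "b \<ominus> u \<in> U" using colon_soc[OF I(1) M'(1) f] less by auto
        then show False using subsp_diff_iff[OF less.prems(1) b(1) uc(1)] x b by auto
      qed
      have "\<zero> \<oplus> b \<otimes> f \<in> ?T V" using ideal_zero[OF I(1)] V by blast
      then have "b \<otimes> f \<in> ?T V" using b fc by simp
      then have "?T U \<subset> ?T V" using bn V by blast
      then have "codim (?T V) < codim (?T U)"
        using codim_strict[OF subT[OF less.prems(1)] fin_codim_mono[OF I(2) Isub[OF less.prems(1)]]]
          subsp_subset[OF subT[OF V(1)]] by simp
      moreover have "codim U \<le> Suc (codim V)" unfolding V_def by (rule codim_insert[OF fU b(1)])
      ultimately show ?thesis using IH by linarith
    qed
  qed
  from this[OF subsp_ideal[OF maximal_ideal[OF M'(1)]] subset_refl]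
  have 1: "codim (adj I f) + codim M \<le> codim (?T M)" by (simp add: adj_def)
  have "codim (?T M) \<le> codim I"
    by (rule codim_mono[OF I(2) Isub]) (rule subsp_ideal[OF maximal_ideal[OF M'(1)]])
  with 1 show ?thesis by simp
qed

text \<open>Every nonzero element of a socle part generates that part, so each is at most
  one-dimensional over its residue field P/M. This form avoids residue fields and bases.\<close>

definition gorenstein :: "'p set \<Rightarrow> bool" where
  "gorenstein I \<longleftrightarrow> (\<forall>M\<in>max_over I. \<forall>f\<in>soc I M. \<forall>f'\<in>soc I M. f \<notin> I \<longrightarrow> f' \<in> adj I f)"

text \<open>For a subspace W, \<open>spn (I \<union> W)\<close> is the preimage in P of the image of
  W in P/I. The intended W is the filtration step just below the regularity index.\<close>

definition ideals_escape :: "'p set \<Rightarrow> 'p set \<Rightarrow> bool" where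
  "ideals_escape I W \<longleftrightarrow> (\<forall>J. ideal J P \<longrightarrow> I \<subset> J \<longrightarrow> \<not> J \<subseteq> spn (I \<union> W))"

end

section \<open>Primary components\<close>

context field_algebra
begin

lemma adj_iff:
  assumes "ideal I P" "f \<in> carrier P" "x \<in> carrier P"
  shows "x \<in> adj I f \<longleftrightarrow> (\<exists>a\<in>carrier P. x \<ominus> a \<otimes> f \<in> I)"
proof
  assume "x \<in> adj I f"
  then obtain i a where "i \<in> I" "a \<in> carrier P" "x = i \<oplus> a \<otimes> f" by (auto simp: adj_def)
  then show "\<exists>a\<in>carrier P. x \<ominus> a \<otimes> f \<in> I"
    using assms ideal_carrier[OF assms(1)] by (intro bexI[of _ a]) (auto simp: add_diff_cancel)
next
  assume "\<exists>a\<in>carrier P. x \<ominus> a \<otimes> f \<in> I"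
  then obtain a where a: "a \<in> carrier P" "x \<ominus> a \<otimes> f \<in> I" by auto
  have "(x \<ominus> a \<otimes> f) \<oplus> a \<otimes> f = x" using assms a by (simp add: diff_add_cancel)
  then show "x \<in> adj I f" using adjI[OF a(2,1), of f] by simp
qed

lemma max_over_exists:
  assumes I: "ideal I P" "fin_codim I" "I \<noteq> carrier P" obtains M where "M \<in> max_over I"
proof -
  have "I \<subset> carrier P" using I ideal_subset by auto
  then obtain J where J: "minimal_over I J" using minimal_over_exists[OF I(1,2) oneideal] by blast
  then obtain f where "f \<in> J" "f \<notin> I" by (auto simp: minimal_over_def)
  then show thesis using minimal_over_maximal(1)[OF I(1) J] that by blast
qed

section \<open>Powers modulo I and the component of I at a maximal ideal\<close>

lemma maximal_power:
  assumes "maximalideal M P" "f \<in> carrier P" "f [^] (k::nat) \<in> M" shows "f \<in> M"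
  using assms(3)
proof (induction k)
  case 0
  then show ?case using maximal_one[OF assms(1)] by simp
next
  case (Suc k)
  then show ?case using maximal_prime[OF assms(1), of "f [^] k" f] assms(2) by auto
qed

text \<open>The descending chain of ideals I + (f^k) stops because its codimensions are bounded by
  that of I. At a stop, f^k lies in I + (f^(k+1)), and a is the coefficient.\<close>

lemma power_stabilizes:
  assumes I: "ideal I P" "fin_codim I" and f: "f \<in> carrier P"
  obtains k :: nat and a where "a \<in> carrier P" "(\<one> \<ominus> a \<otimes> f) \<otimes> f [^] k \<in> I"
proof -
  let ?J = "\<lambda>k::nat. adj I (f [^] k)"
  have J: "ideal (?J k) P" "fin_codim (?J k)" "codim (?J k) \<le> codim I" for k
    using adj_ideal[OF I(1)] adj_superset[OF I(1)] fin_codim_mono[OF I(2)] codim_mono[OF I(2)] f by auto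
  have sub: "?J (Suc k) \<subseteq> ?J k" for k
  proof (rule adj_least[OF J(1)])
    show "I \<subseteq> ?J k" using adj_superset[OF I(1)] f by simp
    show "f [^] Suc k \<in> ?J k" using ideal_rmult[OF J(1) adj_member[OF I(1)]] f by simp
  qed
  obtain k where k: "codim (?J (Suc k)) \<le> codim (?J k)"
  proof (rule ccontr)
    assume "\<not> thesis"
    then have less: "codim (?J k) < codim (?J (Suc k))" for k using that not_le by blast
    have "k \<le> codim (?J k)" for k
    proof (induction k)
      case (Suc k)
      then show ?case using less[of k] by simp
    qed simp
    from this[of "Suc (codim I)"] show False using J(3)[of "Suc (codim I)"] by simp
  qed
  have "?J (Suc k) = ?J k"
  proof (rule ccontr)
    assume "?J (Suc k) \<noteq> ?J k"
    then have "?J (Suc k) \<subset> ?J k" using sub[of k] by auto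
    from codim_strict[OF subsp_ideal[OF J(1)] J(2) this ideal_subset[OF J(1)]] show False using k by simp
  qed
  then have "f [^] k \<in> ?J (Suc k)" using adj_member[OF I(1)] f by simp
  then obtain a where a: "a \<in> carrier P" "f [^] k \<ominus> a \<otimes> f [^] Suc k \<in> I"
    using adj_iff[OF I(1)] f by auto
  have "(\<one> \<ominus> a \<otimes> f) \<otimes> f [^] k = f [^] k \<ominus> a \<otimes> f [^] Suc k"
    using a f by (simp add: diff_mult m_assoc m_comm[of f])
  then have "(\<one> \<ominus> a \<otimes> f) \<otimes> f [^] k \<in> I" using a by simp
  then show thesis by (rule that[OF a(1)])
qed

text \<open>The contraction to P of the localization of I at M, that is, the kernel of the map from
  P to (P/I) localized at M.\<close>

definition pcomp :: "'p set \<Rightarrow> 'p set \<Rightarrow> 'p set" where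
  "pcomp I M = {f \<in> carrier P. \<exists>g\<in>carrier P. g \<notin> M \<and> f \<otimes> g \<in> I}"

lemma pcomp_ideal:
  assumes I: "ideal I P" and M: "maximalideal M P" shows "ideal (pcomp I M) P"
proof (rule idealI')
  show "\<zero> \<in> pcomp I M"
    using maximal_one[OF M] ideal_zero[OF I] unfolding pcomp_def by (auto intro!: bexI[of _ \<one>])
next
  fix x y assume "x \<in> pcomp I M" "y \<in> pcomp I M"
  then obtain g k where g: "x \<in> carrier P" "g \<in> carrier P" "g \<notin> M" "x \<otimes> g \<in> I"
    and k: "y \<in> carrier P" "k \<in> carrier P" "k \<notin> M" "y \<otimes> k \<in> I" by (auto simp: pcomp_def)
  have "(x \<oplus> y) \<otimes> (g \<otimes> k) = (x \<otimes> g) \<otimes> k \<oplus> (y \<otimes> k) \<otimes> g"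
    using g k by (simp add: l_distr m_assoc m_comm[of g k])
  also have "\<dots> \<in> I" by (rule ideal_add[OF I ideal_rmult[OF I g(4) k(2)] ideal_rmult[OF I k(4) g(2)]])
  finally have "(x \<oplus> y) \<otimes> (g \<otimes> k) \<in> I" .
  moreover have "g \<otimes> k \<notin> M" using maximal_prime[OF M] g k by blast
  ultimately show "x \<oplus> y \<in> pcomp I M" using g k by (auto simp: pcomp_def)
next
  fix a x assume a: "a \<in> carrier P" "x \<in> pcomp I M"
  then obtain g where g: "x \<in> carrier P" "g \<in> carrier P" "g \<notin> M" "x \<otimes> g \<in> I" by (auto simp: pcomp_def)
  then have "(a \<otimes> x) \<otimes> g \<in> I" using a ideal_lmult[OF I g(4) a(1)] by (simp add: m_assoc)
  then show "a \<otimes> x \<in> pcomp I M" using a g by (auto simp: pcomp_def)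
qed (auto simp: pcomp_def)

lemma pcomp_superset: "\<lbrakk>ideal I P; maximalideal M P\<rbrakk> \<Longrightarrow> I \<subseteq> pcomp I M"
  using maximal_one ideal_carrier unfolding pcomp_def by (force intro!: bexI[of _ \<one>])

lemma pcomp_subset_maximal: assumes "M \<in> max_over I" shows "pcomp I M \<subseteq> M"
proof
  fix x assume "x \<in> pcomp I M"
  then obtain g where "x \<in> carrier P" "g \<in> carrier P" "g \<notin> M" "x \<otimes> g \<in> I" by (auto simp: pcomp_def)
  then show "x \<in> M" using maximal_prime[of M x g] assms by (auto simp: max_over_def)
qed

lemma one_minus_notin:
  assumes "maximalideal M P" "f \<in> M" "a \<in> carrier P" shows "\<one> \<ominus> a \<otimes> f \<notin> M"
proof
  assume "\<one> \<ominus> a \<otimes> f \<in> M"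
  moreover have fc: "f \<in> carrier P" using maximal_subset[OF assms(1)] assms(2) by auto
  ultimately have "(\<one> \<ominus> a \<otimes> f) \<oplus> a \<otimes> f \<in> M"
    using ideal_add[OF maximal_ideal[OF assms(1)]] ideal_lmult[OF maximal_ideal[OF assms(1)] assms(2,3)] by blast
  then show False using maximal_one[OF assms(1)] assms(3) fc by (simp add: diff_add_cancel)
qed

text \<open>For f in M the factor 1 - a f of the stabilization relation is outside M, so that
  relation says that f^k lies in the component.\<close>

lemma radical_pcomp:
  assumes I: "ideal I P" "fin_codim I" and M: "M \<in> max_over I" shows "radical P (pcomp I M) = M"
proof
  have M': "maximalideal M P" using M by (simp add: max_over_def)
  show "radical P (pcomp I M) \<subseteq> M"
    using pcomp_subset_maximal[OF M] maximal_power[OF M'] unfolding radical_def by blast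
  show "M \<subseteq> radical P (pcomp I M)"
  proof
    fix f assume f: "f \<in> M"
    have fc: "f \<in> carrier P" using f maximal_subset[OF M'] by auto
    obtain k a where ka: "a \<in> carrier P" "(\<one> \<ominus> a \<otimes> f) \<otimes> f [^] (k::nat) \<in> I"
      using power_stabilizes[OF I fc] by blast
    have "f [^] k \<otimes> (\<one> \<ominus> a \<otimes> f) \<in> I" using ka fc by (simp add: m_comm[of "f [^] k"])
    moreover have "\<one> \<ominus> a \<otimes> f \<in> carrier P" using ka fc by simp
    ultimately have "f [^] k \<in> pcomp I M"
      using one_minus_notin[OF M' f ka(1)] fc unfolding pcomp_def by blast
    then show "f \<in> radical P (pcomp I M)" using fc unfolding radical_def by blast
  qed
qed

lemma pcomp_cancel:
  assumes "maximalideal M P" "x \<in> carrier P" "g \<in> carrier P" "g \<notin> M" "x \<otimes> g \<in> pcomp I M"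
  shows "x \<in> pcomp I M"
proof -
  obtain k where k: "k \<in> carrier P" "k \<notin> M" "(x \<otimes> g) \<otimes> k \<in> I" using assms(5) by (auto simp: pcomp_def)
  have "x \<otimes> (g \<otimes> k) \<in> I" using k assms by (simp add: m_assoc)
  moreover have "g \<otimes> k \<notin> M" using maximal_prime[OF assms(1,3) k(1)] assms k by auto
  ultimately show ?thesis using assms k by (auto simp: pcomp_def)
qed

text \<open>A maximal ideal that contains the component contains its radical M, and so equals
  M.\<close>

lemma pcomp_not_subset:
  assumes I: "ideal I P" "fin_codim I" and M: "M \<in> max_over I" "maximalideal N P" "M \<noteq> N"
  shows "\<not> pcomp I M \<subseteq> N"
proof
  assume sub: "pcomp I M \<subseteq> N"
  have "M \<subseteq> N"
  proof
    fix m assume "m \<in> M"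
    then have "m \<in> radical P (pcomp I M)" using radical_pcomp[OF I M(1)] by simp
    then show "m \<in> N" using sub maximal_power[OF M(2)] unfolding radical_def by blast
  qed
  then show False
    using maximal_eq[of M N] maximal_ideal[OF M(2)] maximal_one[OF M(2)] M by (auto simp: max_over_def)
qed

lemma pcomp_inj: assumes I: "ideal I P" "fin_codim I" shows "inj_on (pcomp I) (max_over I)"
  by (rule inj_onI) (metis radical_pcomp[OF I])

text \<open>If f lies in every component, then I : f contains, for each maximal M over I, an element
  outside M. Hence I : f is in no maximal ideal and must be all of P.\<close>

lemma pcomp_Inter:
  assumes I: "ideal I P" "fin_codim I" shows "carrier P \<inter> \<Inter>(pcomp I ` max_over I) = I"
proof
  show "I \<subseteq> carrier P \<inter> \<Inter>(pcomp I ` max_over I)"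
    using pcomp_superset[OF I(1)] ideal_carrier[OF I(1)] by (auto simp: max_over_def)
  show "carrier P \<inter> \<Inter>(pcomp I ` max_over I) \<subseteq> I"
  proof
    fix f assume f: "f \<in> carrier P \<inter> \<Inter>(pcomp I ` max_over I)"
    have fc: "f \<in> carrier P" using f by simp
    have sub: "I \<subseteq> colon I f" by (rule colon_superset[OF I(1) fc])
    have "colon I f = carrier P"
    proof (rule ccontr)
      assume "colon I f \<noteq> carrier P"
      then obtain M where M: "M \<in> max_over (colon I f)"
        using max_over_exists[OF colon_ideal[OF I(1) fc] fin_codim_mono[OF I(2) sub]] by blast
      then have "M \<in> max_over I" using sub by (auto simp: max_over_def)
      then obtain g where g: "g \<in> carrier P" "g \<notin> M" "f \<otimes> g \<in> I" using f by (auto simp: pcomp_def)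
      then have "g \<in> colon I f" using fc by (simp add: colon_def m_comm[of g])
      then show False using M g by (auto simp: max_over_def)
    qed
    then have "\<one> \<in> colon I f" by simp
    then show "f \<in> I" using fc by (simp add: colon_def)
  qed
qed

text \<open>The element e stands in for the idempotent of the local factor at M: it is invertible
  modulo M and zero in the other factors.\<close>

lemma avoid_other_pcomps:
  assumes I: "ideal I P" "fin_codim I" and M: "M \<in> max_over I"
  obtains e where "e \<in> carrier P" "e \<in> \<Inter>(pcomp I ` max_over I - {pcomp I M})" "e \<notin> M"
proof -
  have M': "maximalideal M P" using M by (simp add: max_over_def)
  have "\<exists>g\<in>carrier P. g \<in> \<Inter>(pcomp I ` max_over I - {pcomp I M}) \<and> g \<notin> M"
  proof (rule avoid_maximal[OF _ _ M'])
    show "finite (pcomp I ` max_over I - {pcomp I M})" using finite_max_over[OF I] by simp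
    fix N assume "N \<in> pcomp I ` max_over I - {pcomp I M}"
    then obtain M1 where M1: "M1 \<in> max_over I" "N = pcomp I M1" "M1 \<noteq> M" by auto
    then show "ideal N P" using pcomp_ideal[OF I(1)] by (simp add: max_over_def)
    show "\<not> N \<subseteq> M" using pcomp_not_subset[OF I M1(1) M' M1(3)] M1(2) by simp
  qed
  then show thesis using that by auto
qed

lemma minimal_primary_decomposition_pcomp:
  assumes I: "ideal I P" "fin_codim I"
  shows "minimal_primary_decomposition P I (pcomp I ` max_over I)"
  unfolding minimal_primary_decomposition_def
proof (intro conjI ballI)
  show "finite (pcomp I ` max_over I)" using finite_max_over[OF I] by simp
  show "carrier P \<inter> \<Inter>(pcomp I ` max_over I) = I" by (rule pcomp_Inter[OF I])
  show "inj_on (radical P) (pcomp I ` max_over I)"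
    by (rule inj_onI) (auto simp: radical_pcomp[OF I])
  fix Q assume "Q \<in> pcomp I ` max_over I"
  then obtain M where M: "M \<in> max_over I" "Q = pcomp I M" by auto
  then have M': "maximalideal M P" by (simp add: max_over_def)
  show "primary_ideal P Q"
    unfolding primary_ideal_def M(2) radical_pcomp[OF I M(1)]
  proof (intro conjI ballI impI)
    show "ideal (pcomp I M) P" by (rule pcomp_ideal[OF I(1) M'])
    show "pcomp I M \<noteq> carrier P" using pcomp_subset_maximal[OF M(1)] maximal_one[OF M'] by auto
    show "a \<in> pcomp I M \<or> b \<in> M" if "a \<in> carrier P" "b \<in> carrier P" "a \<otimes> b \<in> pcomp I M" for a b
      using pcomp_cancel[OF M'] that by blast
  qed
  obtain e where e: "e \<in> carrier P" "e \<in> \<Inter>(pcomp I ` max_over I - {pcomp I M})" "e \<notin> M"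
    using avoid_other_pcomps[OF I M(1)] .
  moreover have "I \<subseteq> M" using M(1) by (simp add: max_over_def)
  ultimately show "carrier P \<inter> \<Inter>(pcomp I ` max_over I - {Q}) \<noteq> I" unfolding M(2) by blast
qed

text \<open>For f in a maximal ideal over Q the product (1 - a f) f^k lies in Q, and 1 - a f is
  outside that ideal, so also outside the radical. Primariness leaves f^k in Q.\<close>

lemma primary_radical_maximal:
  assumes Q: "primary_ideal P Q" "fin_codim Q" shows "radical P Q \<in> max_over Q"
proof -
  have id: "ideal Q P" "Q \<noteq> carrier P" using Q by (auto simp: primary_ideal_def)
  obtain M where M: "M \<in> max_over Q" using max_over_exists[OF id(1) Q(2) id(2)] .
  then have M': "maximalideal M P" "Q \<subseteq> M" by (auto simp: max_over_def)
  have sub: "radical P Q \<subseteq> M"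
    using M'(2) maximal_power[OF M'(1)] unfolding radical_def by blast
  have "M \<subseteq> radical P Q"
  proof
    fix f assume f: "f \<in> M"
    have fc: "f \<in> carrier P" using f maximal_subset[OF M'(1)] by auto
    obtain k a where ka: "a \<in> carrier P" "(\<one> \<ominus> a \<otimes> f) \<otimes> f [^] (k::nat) \<in> Q"
      using power_stabilizes[OF id(1) Q(2) fc] by blast
    have "f [^] k \<otimes> (\<one> \<ominus> a \<otimes> f) \<in> Q" using ka fc by (simp add: m_comm[of "f [^] k"])
    moreover have "f [^] k \<in> carrier P" "\<one> \<ominus> a \<otimes> f \<in> carrier P" using ka fc by auto
    ultimately have "f [^] k \<in> Q \<or> \<one> \<ominus> a \<otimes> f \<in> radical P Q"
      using Q(1) by (auto simp: primary_ideal_def)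
    then have "f [^] k \<in> Q" using one_minus_notin[OF M'(1) f ka(1)] sub by auto
    then show "f \<in> radical P Q" using fc unfolding radical_def by blast
  qed
  then show ?thesis using sub M by simp
qed

text \<open>All radicals are maximal, so there are no embedded components and each component is
  determined by its radical through localization.\<close>

lemma minimal_primary_decomposition_unique:
  assumes I: "ideal I P" "fin_codim I" and QS: "minimal_primary_decomposition P I QS"
  shows "QS = pcomp I ` max_over I"
proof -
  have fin: "finite QS" and prim: "\<And>Q. Q \<in> QS \<Longrightarrow> primary_ideal P Q"
    and int: "carrier P \<inter> \<Inter>QS = I" and inj: "inj_on (radical P) QS"
    using QS by (auto simp: minimal_primary_decomposition_def)
  have id: "ideal Q P" "I \<subseteq> Q" if "Q \<in> QS" for Q using prim[OF that] int that by (auto simp: primary_ideal_def)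
  have rad: "radical P Q \<in> max_over Q" if "Q \<in> QS" for Q
    using primary_radical_maximal[OF prim[OF that] fin_codim_mono[OF I(2) id(2)[OF that]]] .
  then have radI: "radical P Q \<in> max_over I" if "Q \<in> QS" for Q
    using id(2)[OF that] that by (auto simp: max_over_def)
  have radm: "maximalideal (radical P Q) P" if "Q \<in> QS" for Q using rad[OF that] by (simp add: max_over_def)
  have in_max: "radical P Q \<subseteq> M" if "Q \<subseteq> M" "maximalideal M P" for Q M
    using that(1) maximal_power[OF that(2)] unfolding radical_def by blast
  \<comment> \<open>One inclusion is primariness. For the other, an element of Q is multiplied into
    I by some g that lies in all other components but outside the radical of Q.\<close>
  have eq: "Q = pcomp I (radical P Q)" if Q: "Q \<in> QS" for Q
  proof
    show "pcomp I (radical P Q) \<subseteq> Q"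
    proof
      fix f assume "f \<in> pcomp I (radical P Q)"
      then obtain g where "f \<in> carrier P" "g \<in> carrier P" "g \<notin> radical P Q" "f \<otimes> g \<in> Q"
        using id(2)[OF Q] by (auto simp: pcomp_def)
      then show "f \<in> Q" using prim[OF Q] by (auto simp: primary_ideal_def)
    qed
    show "Q \<subseteq> pcomp I (radical P Q)"
    proof
      fix f assume f: "f \<in> Q"
      have fc: "f \<in> carrier P" using f ideal_carrier[OF id(1)[OF Q]] by simp
      have "\<exists>g\<in>carrier P. g \<in> \<Inter>(QS - {Q}) \<and> g \<notin> radical P Q"
      proof (rule avoid_maximal[OF _ _ radm[OF Q]])
        show "finite (QS - {Q})" using fin by simp
        fix N assume N: "N \<in> QS - {Q}"
        then show "ideal N P" using id(1) by simp
        have "radical P N \<noteq> radical P Q" using inj Q N by (auto simp: inj_on_def)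
        then show "\<not> N \<subseteq> radical P Q"
          using in_max[OF _ radm[OF Q]] maximal_eq[OF radm[of N] maximal_ideal[OF radm[OF Q]]]
            maximal_one[OF radm[OF Q]] N by auto
      qed
      then obtain g where g: "g \<in> carrier P" "g \<in> \<Inter>(QS - {Q})" "g \<notin> radical P Q" by auto
      have "f \<otimes> g \<in> N" if "N \<in> QS" for N
        using that g f fc ideal_lmult[OF id(1)[OF that], of g f] ideal_rmult[OF id(1)[OF that], of f g] by blast
      then have "f \<otimes> g \<in> I" using int g fc by auto
      then show "f \<in> pcomp I (radical P Q)" using g fc by (auto simp: pcomp_def)
    qed
  qed
  show ?thesis
  proof
    show "QS \<subseteq> pcomp I ` max_over I" using eq radI by blast
    show "pcomp I ` max_over I \<subseteq> QS"
    proof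
      fix R assume "R \<in> pcomp I ` max_over I"
      then obtain M where M: "M \<in> max_over I" "R = pcomp I M" by auto
      then have M': "maximalideal M P" "I \<subseteq> M" by (auto simp: max_over_def)
      \<comment> \<open>Otherwise avoidance would give an element of the intersection, which is I,
        outside M.\<close>
      have "\<exists>Q\<in>QS. Q \<subseteq> M"
      proof (rule ccontr)
        assume "\<not> (\<exists>Q\<in>QS. Q \<subseteq> M)"
        then have "\<exists>g\<in>carrier P. g \<in> \<Inter>QS \<and> g \<notin> M"
          by (intro avoid_maximal[OF fin id(1) M'(1)]) auto
        then show False using int M'(2) by auto
      qed
      then obtain Q where Q: "Q \<in> QS" "Q \<subseteq> M" by auto
      have "M = radical P Q"
        using maximal_eq[OF radm[OF Q(1)] maximal_ideal[OF M'(1)] in_max[OF Q(2) M'(1)]] maximal_one[OF M'(1)] by auto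
      then show "R \<in> QS" using eq[OF Q(1)] Q M by simp
    qed
  qed
qed

lemma primary_components_eq:
  assumes "ideal I P" "fin_codim I" shows "primary_components P I = pcomp I ` max_over I"
  unfolding primary_components_def
  using minimal_primary_decomposition_pcomp[OF assms] minimal_primary_decomposition_unique[OF assms]
  by (rule the_equality)

lemma max_over_pcomp:
  assumes I: "ideal I P" "fin_codim I" and M: "M \<in> max_over I" shows "max_over (pcomp I M) = {M}"
proof -
  have "N = M" if "N \<in> max_over (pcomp I M)" for N
    using pcomp_not_subset[OF I M, of N] that by (auto simp: max_over_def)
  then show ?thesis using pcomp_subset_maximal[OF M] M by (auto simp: max_over_def)
qed

section \<open>Divisors of I, socle elements, and passage to the local components\<close>

lemma divisor_strict:
  assumes I: "ideal I P" "fin_codim I" and M: "M \<in> max_over I"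
    and Q': "ideal Q' P" "pcomp I M \<subset> Q'"
    and J: "J = Q' \<inter> \<Inter>(pcomp I ` max_over I - {pcomp I M})"
  shows "ideal J P" "I \<subset> J"
proof -
  have M': "maximalideal M P" using M by (simp add: max_over_def)
  have others: "ideal N P" if "N \<in> pcomp I ` max_over I - {pcomp I M}" for N
    using that pcomp_ideal[OF I(1)] by (auto simp: max_over_def)
  have "J = Q' \<inter> (carrier P \<inter> \<Inter>(pcomp I ` max_over I - {pcomp I M}))"
    using J ideal_carrier[OF Q'(1)] by auto
  moreover have "ideal (carrier P \<inter> \<Inter>(pcomp I ` max_over I - {pcomp I M})) P"
    by (rule ideal_Inter[OF others])
  ultimately show "ideal J P" using ideal_Int[OF Q'(1)] by simp
  obtain e where e: "e \<in> carrier P" "e \<in> \<Inter>(pcomp I ` max_over I - {pcomp I M})" "e \<notin> M"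
    using avoid_other_pcomps[OF I M] .
  obtain f where f: "f \<in> Q'" "f \<notin> pcomp I M" using Q' by auto
  have fc: "f \<in> carrier P" using f ideal_carrier[OF Q'(1)] by simp
  have "f \<otimes> e \<in> J"
    using e f fc ideal_rmult[OF Q'(1) f(1) e(1)] ideal_lmult[OF others _ fc] unfolding J by blast
  moreover have "f \<otimes> e \<notin> I"
    using pcomp_cancel[OF M' fc e(1,3)] pcomp_superset[OF I(1) M'] f(2) by blast
  moreover have "I \<subseteq> J"
    using Q'(2) pcomp_superset[OF I(1)] M' unfolding J by (auto simp: max_over_def)
  ultimately show "I \<subset> J" by blast
qed

text \<open>An element of M outside N multiplies f into I, so f vanishes in the localization at
  N.\<close>

lemma soc_in_other_pcomps:
  assumes I: "ideal I P" and M: "M \<in> max_over I" "N \<in> max_over I" "N \<noteq> M" and f: "f \<in> soc I M"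
  shows "f \<in> pcomp I N"
proof -
  have M': "maximalideal M P" "maximalideal N P" using M by (auto simp: max_over_def)
  obtain g where g: "g \<in> M" "g \<notin> N" using maximal_distinct[OF M'(2,1)] M by auto
  have gc: "g \<in> carrier P" using g maximal_subset[OF M'(1)] by auto
  have fc: "f \<in> carrier P" and "g \<otimes> f \<in> I" using f g by (auto simp: soc_def)
  then have "f \<otimes> g \<in> I" using m_comm[OF fc gc] by simp
  then show ?thesis using fc g gc by (auto simp: pcomp_def)
qed

lemma soc_Int_pcomp:
  assumes I: "ideal I P" "fin_codim I" and M: "M \<in> max_over I"
    and f: "f \<in> carrier P" "\<And>N. \<lbrakk>N \<in> max_over I; N \<noteq> M\<rbrakk> \<Longrightarrow> f \<in> pcomp I N" "f \<in> pcomp I M"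
  shows "f \<in> I"
  using pcomp_Inter[OF I] f by blast

text \<open>I + (f) is realized as a divisor by enlarging only the component at M: f already lies in
  all other components, so adjoining it there changes nothing.\<close>

lemma adj_soc_divisor:
  assumes I: "ideal I P" "fin_codim I" and M: "M \<in> max_over I" and f: "f \<in> soc I M" "f \<notin> I"
  shows "pcomp I M \<subset> adj (pcomp I M) f"
    and "adj I f = adj (pcomp I M) f \<inter> \<Inter>(pcomp I ` max_over I - {pcomp I M})"
proof -
  have M': "maximalideal M P" using M by (simp add: max_over_def)
  have fc: "f \<in> carrier P" using f by (simp add: soc_def)
  note Q = pcomp_ideal[OF I(1) M']
  have fN: "f \<in> pcomp I N" if "N \<in> max_over I" "N \<noteq> M" for N
    using soc_in_other_pcomps[OF I(1) M that f(1)] .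
  have fQ: "f \<notin> pcomp I M" using soc_Int_pcomp[OF I M fc fN] f(2) by blast
  show "pcomp I M \<subset> adj (pcomp I M) f" by (rule adj_psubset[OF Q fc fQ])
  show "adj I f = adj (pcomp I M) f \<inter> \<Inter>(pcomp I ` max_over I - {pcomp I M})"
  proof
    have "adj I f \<subseteq> adj (pcomp I M) f"
      using pcomp_superset[OF I(1) M'] by (auto simp: adj_def)
    moreover have "adj I f \<subseteq> N" if N: "N \<in> pcomp I ` max_over I - {pcomp I M}" for N
    proof -
      obtain M1 where M1: "M1 \<in> max_over I" "N = pcomp I M1" "M1 \<noteq> M" using N by auto
      then have "maximalideal M1 P" by (simp add: max_over_def)
      then show ?thesis
        using adj_least[OF pcomp_ideal[OF I(1)] pcomp_superset[OF I(1)] fN[OF M1(1,3)]] M1(2) by simp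
    qed
    ultimately show "adj I f \<subseteq> adj (pcomp I M) f \<inter> \<Inter>(pcomp I ` max_over I - {pcomp I M})" by blast
    show "adj (pcomp I M) f \<inter> \<Inter>(pcomp I ` max_over I - {pcomp I M}) \<subseteq> adj I f"
    proof
      fix x assume x: "x \<in> adj (pcomp I M) f \<inter> \<Inter>(pcomp I ` max_over I - {pcomp I M})"
      then obtain q a where q: "q \<in> pcomp I M" "a \<in> carrier P" "x = q \<oplus> a \<otimes> f" by (auto simp: adj_def)
      have qc: "q \<in> carrier P" using q ideal_carrier[OF Q] by simp
      have xc: "x \<in> carrier P" using q qc fc by simp
      have qx: "x \<ominus> a \<otimes> f = q" using q qc fc by (simp add: add_diff_cancel)
      \<comment> \<open>Both x and f lie in the component at N, hence so does q = x - a f. With q in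
        the component at M this gives q in I.\<close>
      have "q \<in> pcomp I N" if N: "N \<in> max_over I" "N \<noteq> M" for N
      proof -
        have "pcomp I N \<noteq> pcomp I M" using pcomp_inj[OF I] N M by (auto simp: inj_on_def)
        then have "x \<in> pcomp I N" using x N by auto
        moreover have "maximalideal N P" using N by (simp add: max_over_def)
        ultimately show ?thesis
          using ideal_diff[OF pcomp_ideal[OF I(1)]] ideal_lmult[OF pcomp_ideal[OF I(1)] fN[OF N] q(2)] qx by metis
      qed
      then have "q \<in> I" using soc_Int_pcomp[OF I M qc] q(1) by blast
      then show "x \<in> adj I f" using q by (simp add: adjI)
    qed
  qed
qed

definition simple_socle :: "'p set \<Rightarrow> 'p set \<Rightarrow> bool" where
  "simple_socle Q M \<longleftrightarrow> (\<forall>f\<in>soc Q M. \<forall>f'\<in>soc Q M. f \<notin> Q \<longrightarrow> f' \<in> adj Q f)"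

text \<open>The socle of P/I at M and the socle of the local factor at M agree: the former maps into
  the latter, and multiplication by the idempotent-like e leads back without killing anything
  nonzero.\<close>

lemma gorenstein_iff_pcomp:
  assumes I: "ideal I P" "fin_codim I"
  shows "gorenstein I \<longleftrightarrow> (\<forall>M\<in>max_over I. simple_socle (pcomp I M) M)"
proof -
  have "simple_socle I M \<longleftrightarrow> simple_socle (pcomp I M) M" if M: "M \<in> max_over I" for M
  proof -
    have M': "maximalideal M P" using M by (simp add: max_over_def)
    note Q = pcomp_ideal[OF I(1) M'] and IQ = pcomp_superset[OF I(1) M']
    obtain e where e: "e \<in> carrier P" "e \<in> \<Inter>(pcomp I ` max_over I - {pcomp I M})" "e \<notin> M"
      using avoid_other_pcomps[OF I M] .
    \<comment> \<open>The factor x puts the product into the component at M, and e puts it into all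
      others.\<close>
    have eI: "x \<otimes> e \<in> I" if x: "x \<in> pcomp I M" for x
    proof (rule soc_Int_pcomp[OF I M])
      have xc: "x \<in> carrier P" using x ideal_carrier[OF Q] by simp
      then show "x \<otimes> e \<in> carrier P" using e by simp
      show "x \<otimes> e \<in> pcomp I M" using ideal_rmult[OF Q x e(1)] .
      fix N assume N: "N \<in> max_over I" "N \<noteq> M"
      then have "pcomp I N \<noteq> pcomp I M" using pcomp_inj[OF I] M by (auto simp: inj_on_def)
      then have "e \<in> pcomp I N" using e N by auto
      then show "x \<otimes> e \<in> pcomp I N"
        using ideal_lmult[OF pcomp_ideal[OF I(1)]] N xc by (auto simp: max_over_def)
    qed
    show ?thesis
    proof
      assume S: "simple_socle I M"
      show "simple_socle (pcomp I M) M"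
        unfolding simple_socle_def
      proof (intro ballI impI)
        fix f f' assume f: "f \<in> soc (pcomp I M) M" "f' \<in> soc (pcomp I M) M" "f \<notin> pcomp I M"
        have fc: "f \<in> carrier P" "f' \<in> carrier P" using f by (auto simp: soc_def)
        have se: "y \<otimes> e \<in> soc I M" if y: "y \<in> soc (pcomp I M) M" for y
        proof -
          have yc: "y \<in> carrier P" using y by (simp add: soc_def)
          have "m \<otimes> (y \<otimes> e) \<in> I" if m: "m \<in> M" for m
            using eI[of "m \<otimes> y"] y m yc e maximal_subset[OF M'] by (auto simp: soc_def m_assoc)
          then show ?thesis using yc e by (simp add: soc_def)
        qed
        have "f \<otimes> e \<notin> I" using pcomp_cancel[OF M' fc(1) e(1,3)] IQ f(3) by blast
        then have "f' \<otimes> e \<in> adj I (f \<otimes> e)" using S se f by (simp add: simple_socle_def)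
        then obtain a where a: "a \<in> carrier P" "f' \<otimes> e \<ominus> a \<otimes> (f \<otimes> e) \<in> I"
          using adj_iff[OF I(1)] fc e by auto
        have "(f' \<ominus> a \<otimes> f) \<otimes> e = f' \<otimes> e \<ominus> a \<otimes> (f \<otimes> e)" using a fc e by (simp add: diff_mult m_assoc)
        then have "f' \<ominus> a \<otimes> f \<in> pcomp I M" using pcomp_cancel[OF M' _ e(1,3)] a fc IQ by auto
        then show "f' \<in> adj (pcomp I M) f" using adj_iff[OF Q fc] a by auto
      qed
    next
      assume S: "simple_socle (pcomp I M) M"
      show "simple_socle I M"
        unfolding simple_socle_def
      proof (intro ballI impI)
        fix f f' assume f: "f \<in> soc I M" "f' \<in> soc I M" "f \<notin> I"
        have fc: "f \<in> carrier P" "f' \<in> carrier P" using f by (auto simp: soc_def)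
        have sQ: "soc I M \<subseteq> soc (pcomp I M) M" using IQ by (auto simp: soc_def)
        have "f \<notin> pcomp I M"
          using soc_Int_pcomp[OF I M fc(1)] soc_in_other_pcomps[OF I(1) M _ _ f(1)] f(3) by blast
        then have "f' \<in> adj (pcomp I M) f" using S f sQ by (auto simp: simple_socle_def)
        then obtain a where a: "a \<in> carrier P" "f' \<ominus> a \<otimes> f \<in> pcomp I M"
          using adj_iff[OF Q fc] by auto
        have "f' \<ominus> a \<otimes> f \<in> I"
        proof (rule soc_Int_pcomp[OF I M _ _ a(2)])
          show "f' \<ominus> a \<otimes> f \<in> carrier P" using a fc by simp
          fix N assume N: "N \<in> max_over I" "N \<noteq> M"
          then have "ideal (pcomp I N) P" using pcomp_ideal[OF I(1)] by (auto simp: max_over_def)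
          then show "f' \<ominus> a \<otimes> f \<in> pcomp I N"
            using soc_in_other_pcomps[OF I(1) M N] f a by (auto intro: ideal_diff ideal_lmult)
        qed
        then show "f' \<in> adj I f" using adj_iff[OF I(1) fc] a by auto
      qed
    qed
  qed
  then show ?thesis by (auto simp: gorenstein_def simple_socle_def)
qed

text \<open>A minimal ideal over I consists of elements killed by some maximal ideal over I, and
  only M is available. Hence \<open>simple_socle\<close> means dimension exactly one in the local
  case.\<close>

lemma soc_strict:
  assumes I: "ideal I P" "fin_codim I" and M: "max_over I = {M}" shows "\<exists>f\<in>soc I M. f \<notin> I"
proof -
  have "I \<noteq> carrier P" using M maximal_one by (auto simp: max_over_def)
  then have "I \<subset> carrier P" using ideal_subset[OF I(1)] by auto
  then obtain J where J: "minimal_over I J" using minimal_over_exists[OF I oneideal] by blast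
  then obtain f where f: "f \<in> J" "f \<notin> I" by (auto simp: minimal_over_def)
  have "colon I f = M" using minimal_over_maximal(1)[OF I(1) J f] M by simp
  then show ?thesis using minimal_over_maximal(2)[OF I(1) J f] f by auto
qed

end

section \<open>Quotient algebras\<close>

text \<open>Records A that behave as P/Q along \<sigma>. Only the values on images are prescribed,
  so that quotients of P, quotients of quotients and module records are treated alike; the ring laws
  of A are then consequences.\<close>

locale quotient_map = cring P for P :: "('a, 'm) ring_scheme" (structure) +
  fixes A :: "('r, 'n) ring_scheme" and \<sigma> :: "'a \<Rightarrow> 'r" and Q :: "'a set"
  assumes Q_ideal: "ideal Q P"
    and image: "carrier A = \<sigma> ` carrier P"
    and eq_iff: "\<lbrakk>f \<in> carrier P; g \<in> carrier P\<rbrakk> \<Longrightarrow> \<sigma> f = \<sigma> g \<longleftrightarrow> f \<ominus> g \<in> Q"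
    and \<sigma>_add: "\<lbrakk>f \<in> carrier P; g \<in> carrier P\<rbrakk> \<Longrightarrow> \<sigma> f \<oplus>\<^bsub>A\<^esub> \<sigma> g = \<sigma> (f \<oplus> g)"
    and \<sigma>_mult: "\<lbrakk>f \<in> carrier P; g \<in> carrier P\<rbrakk> \<Longrightarrow> \<sigma> f \<otimes>\<^bsub>A\<^esub> \<sigma> g = \<sigma> (f \<otimes> g)"
    and \<sigma>_zero: "\<zero>\<^bsub>A\<^esub> = \<sigma> \<zero>"
    and \<sigma>_one: "\<one>\<^bsub>A\<^esub> = \<sigma> \<one>"
begin

lemma \<sigma>_closed [simp]: "f \<in> carrier P \<Longrightarrow> \<sigma> f \<in> carrier A"
  using image by auto

lemma A_cring: "cring A"
proof (rule cringI)
  show "abelian_group A"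
  proof (rule abelian_groupI)
    fix x assume "x \<in> carrier A"
    then obtain f where f: "f \<in> carrier P" "x = \<sigma> f" using image by auto
    then have "\<sigma> (\<ominus> f) \<oplus>\<^bsub>A\<^esub> x = \<zero>\<^bsub>A\<^esub>" by (simp add: \<sigma>_add \<sigma>_zero l_neg)
    then show "\<exists>y\<in>carrier A. y \<oplus>\<^bsub>A\<^esub> x = \<zero>\<^bsub>A\<^esub>" using f by (intro bexI[of _ "\<sigma> (\<ominus> f)"]) auto
  qed (auto simp: image \<sigma>_add \<sigma>_zero a_ac)
  show "Group.comm_monoid A"
    by (rule comm_monoidI) (auto simp: image \<sigma>_mult \<sigma>_one m_ac)
qed (auto simp: image \<sigma>_add \<sigma>_mult l_distr)

sublocale A: cring A by (rule A_cring)

lemma \<sigma>_uminus: "f \<in> carrier P \<Longrightarrow> \<ominus>\<^bsub>A\<^esub> \<sigma> f = \<sigma> (\<ominus> f)"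
  by (rule A.minus_equality) (auto simp: \<sigma>_add \<sigma>_zero l_neg)

lemma \<sigma>_diff: "\<lbrakk>f \<in> carrier P; g \<in> carrier P\<rbrakk> \<Longrightarrow> \<sigma> f \<ominus>\<^bsub>A\<^esub> \<sigma> g = \<sigma> (f \<ominus> g)"
  by (simp add: a_minus_def \<sigma>_uminus \<sigma>_add)

lemma eq_zero_iff: "f \<in> carrier P \<Longrightarrow> \<sigma> f = \<zero>\<^bsub>A\<^esub> \<longleftrightarrow> f \<in> Q"
  using eq_iff[of f \<zero>] by (simp add: \<sigma>_zero minus_eq)

lemma image_mem_iff:
  assumes "ideal J P" "Q \<subseteq> J" "f \<in> carrier P" shows "\<sigma> f \<in> \<sigma> ` J \<longleftrightarrow> f \<in> J"
proof
  interpret J: ideal J P by fact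
  assume "\<sigma> f \<in> \<sigma> ` J"
  then obtain j where j: "j \<in> J" "\<sigma> f = \<sigma> j" by auto
  have jc: "j \<in> carrier P" using j J.a_subset by auto
  then have "f \<ominus> j \<in> J" using eq_iff[OF assms(3) jc] j assms by auto
  then have "(f \<ominus> j) \<oplus> j \<in> J" using j by simp
  moreover have "(f \<ominus> j) \<oplus> j = f" using assms jc by (simp add: a_minus_def a_assoc l_neg)
  ultimately show "f \<in> J" by simp
qed auto

lemma preimage_ideal:
  assumes "ideal N A" shows "ideal {f \<in> carrier P. \<sigma> f \<in> N} P" "Q \<subseteq> {f \<in> carrier P. \<sigma> f \<in> N}"
proof -
  interpret N: ideal N A by fact
  interpret Q: ideal Q P by (rule Q_ideal)
  show "Q \<subseteq> {f \<in> carrier P. \<sigma> f \<in> N}"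
  proof
    fix q assume "q \<in> Q"
    then have "q \<in> carrier P" "\<sigma> q = \<zero>\<^bsub>A\<^esub>" using Q.a_subset eq_zero_iff by auto
    then show "q \<in> {f \<in> carrier P. \<sigma> f \<in> N}" by simp
  qed
  show "ideal {f \<in> carrier P. \<sigma> f \<in> N} P"
  proof (rule idealI[OF ring_axioms])
    show "subgroup {f \<in> carrier P. \<sigma> f \<in> N} (add_monoid P)"
    proof (rule add.subgroupI)
      have "\<zero> \<in> {f \<in> carrier P. \<sigma> f \<in> N}" using N.zero_closed by (simp add: \<sigma>_zero)
      then show "{f \<in> carrier P. \<sigma> f \<in> N} \<noteq> {}" by auto
      fix a assume a: "a \<in> {f \<in> carrier P. \<sigma> f \<in> N}"
      then have "\<ominus>\<^bsub>A\<^esub> \<sigma> a \<in> N" by simp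
      then show "\<ominus> a \<in> {f \<in> carrier P. \<sigma> f \<in> N}" using a by (simp add: \<sigma>_uminus)
      fix b assume b: "b \<in> {f \<in> carrier P. \<sigma> f \<in> N}"
      then have "\<sigma> a \<oplus>\<^bsub>A\<^esub> \<sigma> b \<in> N" using a by simp
      then show "a \<oplus> b \<in> {f \<in> carrier P. \<sigma> f \<in> N}" using a b by (simp add: \<sigma>_add)
    qed auto
    fix a x assume a: "a \<in> {f \<in> carrier P. \<sigma> f \<in> N}" "x \<in> carrier P"
    then have "\<sigma> x \<otimes>\<^bsub>A\<^esub> \<sigma> a \<in> N" using N.I_l_closed by simp
    then show "x \<otimes> a \<in> {f \<in> carrier P. \<sigma> f \<in> N}" "a \<otimes> x \<in> {f \<in> carrier P. \<sigma> f \<in> N}"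
      using a by (auto simp: \<sigma>_mult m_comm)
  qed
qed

lemma image_ideal:
  assumes "ideal J P" shows "ideal (\<sigma> ` J) A"
proof -
  interpret J: ideal J P by fact
  have Jc: "j \<in> carrier P" if "j \<in> J" for j using that J.a_subset by auto
  show ?thesis
  proof (rule idealI[OF A.ring_axioms])
    show "subgroup (\<sigma> ` J) (add_monoid A)"
    proof (rule A.add.subgroupI)
      show "\<sigma> ` J \<subseteq> carrier A" using Jc by auto
      show "\<sigma> ` J \<noteq> {}" using J.zero_closed by blast
      fix x assume "x \<in> \<sigma> ` J"
      then obtain f where f: "f \<in> J" "x = \<sigma> f" by auto
      then show "\<ominus>\<^bsub>A\<^esub> x \<in> \<sigma> ` J" using Jc by (simp add: \<sigma>_uminus)
      fix y assume "y \<in> \<sigma> ` J"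
      then obtain g where g: "g \<in> J" "y = \<sigma> g" by auto
      then show "x \<oplus>\<^bsub>A\<^esub> y \<in> \<sigma> ` J" using f Jc by (simp add: \<sigma>_add)
    qed
    fix x a assume "x \<in> \<sigma> ` J" "a \<in> carrier A"
    then obtain f b where f: "f \<in> J" "x = \<sigma> f" "b \<in> carrier P" "a = \<sigma> b" using image by auto
    then show "a \<otimes>\<^bsub>A\<^esub> x \<in> \<sigma> ` J" "x \<otimes>\<^bsub>A\<^esub> a \<in> \<sigma> ` J"
      using Jc J.I_l_closed[of f b] J.I_r_closed[of f b] by (auto simp: \<sigma>_mult)
  qed
qed

lemma image_preimage: "N \<subseteq> carrier A \<Longrightarrow> \<sigma> ` {f \<in> carrier P. \<sigma> f \<in> N} = N"
  using image by auto

text \<open>Presents an iterated quotient as a single quotient of P. The local factors of R are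
  quotients of this iterated kind.\<close>

lemma quotient_compose:
  assumes N: "ideal N A"
  shows "quotient_map P (A Quot N) (\<lambda>f. N +>\<^bsub>A\<^esub> \<sigma> f) {f \<in> carrier P. \<sigma> f \<in> N}"
proof (intro quotient_map.intro cring_axioms quotient_map_axioms.intro)
  interpret N: ideal N A by fact
  note hom = N.rcos_ring_hom
  show "ideal {f \<in> carrier P. \<sigma> f \<in> N} P" by (rule preimage_ideal(1)[OF N])
  show "carrier (A Quot N) = (\<lambda>f. N +>\<^bsub>A\<^esub> \<sigma> f) ` carrier P"
    by (auto simp: FactRing_def A_RCOSETS_def' image)
  show "\<zero>\<^bsub>A Quot N\<^esub> = N +>\<^bsub>A\<^esub> \<sigma> \<zero>"
    using A.quotient_eq_iff_same_a_r_cos[OF N, of "\<zero>\<^bsub>A\<^esub>" "\<zero>\<^bsub>A\<^esub>"]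
      ring_hom_zero[OF hom A.ring_axioms N.quotient_is_ring] by (simp add: \<sigma>_zero)
  show "\<one>\<^bsub>A Quot N\<^esub> = N +>\<^bsub>A\<^esub> \<sigma> \<one>" using ring_hom_one[OF hom] by (simp add: \<sigma>_one)
  fix f g assume fg: "f \<in> carrier P" "g \<in> carrier P"
  show "(N +>\<^bsub>A\<^esub> \<sigma> f = N +>\<^bsub>A\<^esub> \<sigma> g) = (f \<ominus> g \<in> {f \<in> carrier P. \<sigma> f \<in> N})"
    using A.quotient_eq_iff_same_a_r_cos[OF N, of "\<sigma> f" "\<sigma> g"] fg by (simp add: \<sigma>_diff)
  show "(N +>\<^bsub>A\<^esub> \<sigma> f) \<oplus>\<^bsub>A Quot N\<^esub> (N +>\<^bsub>A\<^esub> \<sigma> g) = N +>\<^bsub>A\<^esub> \<sigma> (f \<oplus> g)"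
    using ring_hom_add[OF hom, of "\<sigma> f" "\<sigma> g"] fg by (simp add: \<sigma>_add)
  show "(N +>\<^bsub>A\<^esub> \<sigma> f) \<otimes>\<^bsub>A Quot N\<^esub> (N +>\<^bsub>A\<^esub> \<sigma> g) = N +>\<^bsub>A\<^esub> \<sigma> (f \<otimes> g)"
    using ring_hom_mult[OF hom, of "\<sigma> f" "\<sigma> g"] fg by (simp add: \<sigma>_mult)
qed

end

lemma (in cring) quotient_map_Quot:
  assumes "ideal I R" shows "quotient_map R (R Quot I) (\<lambda>f. I +>\<^bsub>R\<^esub> f) I"
proof -
  interpret I: ideal I R by fact
  have "x \<ominus> y \<in> {\<zero>} \<longleftrightarrow> x = y" if "x \<in> carrier R" "y \<in> carrier R" for x y
    using that by simp
  \<comment> \<open>The ring is its own quotient by the zero ideal, so the case of one quotient is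
    an instance of the iterated case.\<close>
  then interpret id: quotient_map R R "\<lambda>f. f" "{\<zero>}"
    by (intro quotient_map.intro cring_axioms quotient_map_axioms.intro) (auto intro!: zeroideal)
  have "{f \<in> carrier R. f \<in> I} = I" using I.a_subset by auto
  then show ?thesis using id.quotient_compose[OF assms] by simp
qed

context field_algebra
begin

text \<open>The counterpart of \<open>quot_alg\<close> for an abstract algebra P. It links
  codimension to the dimension of vector spaces.\<close>

definition quot_mod :: "'p set \<Rightarrow> ('k, 'p set) module" where
  "quot_mod I = \<lparr>carrier = carrier (P Quot I), monoid.mult = monoid.mult (P Quot I), one = one (P Quot I),
     zero = zero (P Quot I), add = add (P Quot I),
     smult = (\<lambda>k x. (I +> c k) \<otimes>\<^bsub>P Quot I\<^esub> x)\<rparr>"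

lemma quotient_map_mod:
  assumes "ideal I P" shows "quotient_map P (quot_mod I) (\<lambda>f. I +> f) I"
proof -
  interpret q: quotient_map P "P Quot I" "\<lambda>f. I +> f" I by (rule quotient_map_Quot[OF assms])
  show ?thesis
    by (intro quotient_map.intro cring_axioms quotient_map_axioms.intro)
      (use q.Q_ideal q.image q.eq_iff q.\<sigma>_add q.\<sigma>_mult q.\<sigma>_zero q.\<sigma>_one in \<open>auto simp: quot_mod_def\<close>)
qed

lemma quot_mod_smult:
  assumes "ideal I P" "k \<in> carrier K" "f \<in> carrier P"
  shows "k \<odot>\<^bsub>quot_mod I\<^esub> (I +> f) = I +> (c k \<otimes> f)"
proof -
  interpret q: quotient_map P "P Quot I" "\<lambda>f. I +> f" I by (rule quotient_map_Quot[OF assms(1)])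
  show ?thesis using assms by (simp add: quot_mod_def q.\<sigma>_mult)
qed

lemma in_spn_Un_iff:
  assumes I: "ideal I P" and U: "subsp U" and f: "f \<in> carrier P"
  shows "f \<in> spn (I \<union> U) \<longleftrightarrow> (\<exists>u\<in>U. f \<ominus> u \<in> I)"
proof
  let ?T = "{f \<in> carrier P. \<exists>u\<in>U. f \<ominus> u \<in> I}"
  have "subsp ?T"
    unfolding subsp_def
  proof (intro conjI ballI)
    show "\<zero> \<in> ?T" using subsp_zero[OF U] ideal_zero[OF I] by (auto intro!: bexI[of _ \<zero>] simp: minus_eq)
    fix x assume "x \<in> ?T"
    then obtain u where u: "x \<in> carrier P" "u \<in> U" "x \<ominus> u \<in> I" by auto
    have uc: "u \<in> carrier P" using subsp_carrier[OF U u(2)] .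
    { fix y assume "y \<in> ?T"
      then obtain v where v: "y \<in> carrier P" "v \<in> U" "y \<ominus> v \<in> I" by auto
      have "(x \<oplus> y) \<ominus> (u \<oplus> v) = (x \<ominus> u) \<oplus> (y \<ominus> v)"
        using u v uc subsp_carrier[OF U v(2)] by (simp add: add_diff_add)
      then have "(x \<oplus> y) \<ominus> (u \<oplus> v) \<in> I" using ideal_add[OF I u(3) v(3)] by simp
      then show "x \<oplus> y \<in> ?T" using u v subsp_add[OF U u(2) v(2)] by auto }
    fix k assume k: "k \<in> carrier K"
    have "c k \<otimes> x \<ominus> c k \<otimes> u = c k \<otimes> (x \<ominus> u)" using u uc k by (simp add: mult_diff)
    then have "c k \<otimes> x \<ominus> c k \<otimes> u \<in> I" using ideal_lmult[OF I u(3)] k by simp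
    then show "c k \<otimes> x \<in> ?T" using u k subsp_smult[OF U k u(2)] by auto
  qed auto
  moreover have "(I \<union> U) \<inter> carrier P \<subseteq> ?T"
  proof
    fix x assume x: "x \<in> (I \<union> U) \<inter> carrier P"
    then show "x \<in> ?T" using subsp_zero[OF U] ideal_zero[OF I]
      by (cases "x \<in> U") (auto intro: bexI[of _ x] bexI[of _ \<zero>] simp: minus_eq r_neg)
  qed
  ultimately have "spn (I \<union> U) \<subseteq> ?T" by (rule spn_least)
  then show "f \<in> spn (I \<union> U) \<Longrightarrow> \<exists>u\<in>U. f \<ominus> u \<in> I" by blast
next
  assume "\<exists>u\<in>U. f \<ominus> u \<in> I"
  then obtain u where u: "u \<in> U" "f \<ominus> u \<in> I" by auto
  have uc: "u \<in> carrier P" using subsp_carrier[OF U u(1)] .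
  have "(f \<ominus> u) \<oplus> u \<in> spn (I \<union> U)"
    using u uc f by (intro spn_add) (auto intro: spn_base)
  then show "f \<in> spn (I \<union> U)" using uc f by (simp add: diff_add_cancel)
qed

lemma coset_mem_image_iff:
  assumes I: "ideal I P" and U: "subsp U" and f: "f \<in> carrier P"
  shows "I +> f \<in> (\<lambda>f. I +> f) ` U \<longleftrightarrow> f \<in> spn (I \<union> U)"
proof -
  interpret q: quotient_map P "quot_mod I" "\<lambda>f. I +> f" I by (rule quotient_map_mod[OF I])
  show ?thesis using q.eq_iff[OF f] subsp_carrier[OF U] in_spn_Un_iff[OF I U f] by (auto simp: image_iff)
qed

lemma image_eq_quot_mod_iff:
  assumes I: "ideal I P" and U: "subsp U"
  shows "(\<lambda>f. I +> f) ` U = carrier (quot_mod I) \<longleftrightarrow> spn (I \<union> U) = carrier P"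
proof -
  interpret q: quotient_map P "quot_mod I" "\<lambda>f. I +> f" I by (rule quotient_map_mod[OF I])
  have 1: "(\<lambda>f. I +> f) ` U \<subseteq> carrier (quot_mod I)" using subsp_carrier[OF U] by auto
  have 2: "spn (I \<union> U) \<subseteq> carrier P" using spn_closed by auto
  show ?thesis
  proof
    assume eq: "(\<lambda>f. I +> f) ` U = carrier (quot_mod I)"
    have "f \<in> spn (I \<union> U)" if f: "f \<in> carrier P" for f
      unfolding coset_mem_image_iff[OF I U f, symmetric] eq using f by (rule q.\<sigma>_closed)
    then show "spn (I \<union> U) = carrier P" using 2 by blast
  next
    assume eq: "spn (I \<union> U) = carrier P"
    have "I +> f \<in> (\<lambda>f. I +> f) ` U" if f: "f \<in> carrier P" for f
      unfolding coset_mem_image_iff[OF I U f] eq by (rule f)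
    then show "(\<lambda>f. I +> f) ` U = carrier (quot_mod I)" using 1 unfolding q.image by blast
  qed
qed

lemma quot_mod_vectorspace:
  assumes I: "ideal I P" and U: "subsp U"
  shows "vectorspace K (quot_mod I\<lparr>carrier := (\<lambda>f. I +> f) ` U\<rparr>)"
proof -
  interpret q: quotient_map P "quot_mod I" "\<lambda>f. I +> f" I by (rule quotient_map_mod[OF I])
  have Uc: "u \<in> carrier P" if "u \<in> U" for u using subsp_carrier[OF U that] .
  note sm = quot_mod_smult[OF I]
  show ?thesis
  proof (rule vs_criteria[OF K.field_axioms])
    show "\<zero>\<^bsub>quot_mod I\<lparr>carrier := (\<lambda>f. I +> f) ` U\<rparr>\<^esub> \<in> carrier (quot_mod I\<lparr>carrier := (\<lambda>f. I +> f) ` U\<rparr>)"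
      using subsp_zero[OF U] by (simp add: q.\<sigma>_zero)
    show "\<forall>v\<in>carrier (quot_mod I\<lparr>carrier := (\<lambda>f. I +> f) ` U\<rparr>).
      \<exists>neg_v\<in>carrier (quot_mod I\<lparr>carrier := (\<lambda>f. I +> f) ` U\<rparr>).
        v \<oplus>\<^bsub>quot_mod I\<lparr>carrier := (\<lambda>f. I +> f) ` U\<rparr>\<^esub> neg_v = \<zero>\<^bsub>quot_mod I\<lparr>carrier := (\<lambda>f. I +> f) ` U\<rparr>\<^esub>"
      using subsp_uminus[OF U] Uc by (auto simp: q.\<sigma>_add q.\<sigma>_zero r_neg intro!: bexI[of _ "\<ominus> _"])
  qed (use subsp_add[OF U] subsp_smult[OF U] Uc in
      \<open>auto simp: q.\<sigma>_add q.\<sigma>_zero sm a_ac r_distr l_distr c_add c_mult m_assoc\<close>)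
qed

lemma quot_mod_carrier: "ideal I P \<Longrightarrow> quot_mod I\<lparr>carrier := (\<lambda>f. I +> f) ` carrier P\<rparr> = quot_mod I"
  using quotient_map.image[OF quotient_map_mod] by (simp add: quot_mod_def)

lemma quot_mod_vectorspace': "ideal I P \<Longrightarrow> vectorspace K (quot_mod I)"
proof -
  assume I: "ideal I P"
  show ?thesis using quot_mod_vectorspace[OF I subsp_carrier_P] quot_mod_carrier[OF I] by simp
qed

text \<open>Choose a finite subset B of U for which I and B span a subspace of least codimension. An
  element of U outside this span would lower the codimension further.\<close>

lemma finite_spanning_subset:
  assumes I: "ideal I P" "fin_codim I" and U: "U \<subseteq> carrier P"
  obtains B where "finite B" "B \<subseteq> U" "U \<subseteq> spn (I \<union> B)"
proof -
  let ?Q = "\<lambda>B. finite B \<and> B \<subseteq> U"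
  obtain B where B: "?Q B" and min: "\<And>y. ?Q y \<Longrightarrow> codim (spn (I \<union> B)) \<le> codim (spn (I \<union> y))"
    using ex_has_least_nat[of ?Q "{}" "\<lambda>B. codim (spn (I \<union> B))"] by auto
  have "u \<in> spn (I \<union> B)" if u: "u \<in> U" for u
  proof (rule ccontr)
    assume n: "u \<notin> spn (I \<union> B)"
    have "u \<in> spn (I \<union> insert u B)" using u U by (intro spn_base) auto
    moreover have "spn (I \<union> B) \<subseteq> spn (I \<union> insert u B)" by (rule spn_mono) auto
    ultimately have "spn (I \<union> B) \<subset> spn (I \<union> insert u B)" using n by auto
    moreover have "fin_codim (spn (I \<union> B))"
      by (rule fin_codim_mono[OF I(2)]) (use ideal_carrier[OF I(1)] in \<open>auto intro: spn_base\<close>)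
    ultimately have "codim (spn (I \<union> insert u B)) < codim (spn (I \<union> B))"
      using codim_strict[OF subsp_spn] subsp_subset[OF subsp_spn] by blast
    then show False using min[of "insert u B"] B u by auto
  qed
  then show thesis using that B by blast
qed

lemma fin_dim_image:
  assumes I: "ideal I P" "fin_codim I" and U: "subsp U"
  shows "vectorspace.fin_dim K (quot_mod I\<lparr>carrier := (\<lambda>f. I +> f) ` U\<rparr>)"
proof -
  interpret q: quotient_map P "quot_mod I" "\<lambda>f. I +> f" I by (rule quotient_map_mod[OF I(1)])
  interpret V: vectorspace K "quot_mod I\<lparr>carrier := (\<lambda>f. I +> f) ` U\<rparr>"
    by (rule quot_mod_vectorspace[OF I(1) U])
  obtain B where B: "finite B" "B \<subseteq> U" "U \<subseteq> spn (I \<union> B)"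
    using finite_spanning_subset[OF I subsp_subset[OF U]] .
  have Uc: "u \<in> carrier P" if "u \<in> U" for u using subsp_carrier[OF U that] .
  let ?A = "(\<lambda>f. I +> f) ` B"
  have A: "?A \<subseteq> carrier (quot_mod I\<lparr>carrier := (\<lambda>f. I +> f) ` U\<rparr>)" using B by auto
  note sub = V.span_is_submodule[OF A]
  \<comment> \<open>The preimage of the span in the quotient is a subspace of P containing I and B,
    hence \<open>spn (I \<union> B)\<close>. This compares the two notions of span.\<close>
  let ?T = "{f \<in> carrier P. I +> f \<in> V.span ?A}"
  have "subsp ?T"
    unfolding subsp_def
  proof (intro conjI ballI)
    show "\<zero> \<in> ?T" using LinearCombinations.submodule.zero_closed[OF sub] by (simp add: q.\<sigma>_zero)
    fix x assume x: "x \<in> ?T"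
    show "x \<oplus> y \<in> ?T" if y: "y \<in> ?T" for y
      using LinearCombinations.submodule.m_closed[OF sub, of "I +> x" "I +> y"] x y by (simp add: q.\<sigma>_add)
    show "c k \<otimes> x \<in> ?T" if k: "k \<in> carrier K" for k
      using LinearCombinations.submodule.smult_closed[OF sub k, of "I +> x"] x k by (simp add: quot_mod_smult[OF I(1)])
  qed auto
  moreover have "(I \<union> B) \<inter> carrier P \<subseteq> ?T"
  proof
    fix x assume x: "x \<in> (I \<union> B) \<inter> carrier P"
    show "x \<in> ?T"
    proof (cases "x \<in> B")
      case True
      then show ?thesis using V.in_own_span[OF A] x by auto
    next
      case False
      then have "I +> x = \<zero>\<^bsub>quot_mod I\<^esub>" using x q.eq_zero_iff by simp
      then show ?thesis using x LinearCombinations.submodule.zero_closed[OF sub] by simp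
    qed
  qed
  ultimately have "spn (I \<union> B) \<subseteq> ?T" by (rule spn_least)
  then have "(\<lambda>f. I +> f) ` U \<subseteq> V.span ?A" using B(3) by auto
  then have "V.span ?A = carrier (quot_mod I\<lparr>carrier := (\<lambda>f. I +> f) ` U\<rparr>)"
    using V.span_is_subset2[OF A] by auto
  then show "V.fin_dim" unfolding V.fin_dim_def using B(1) A by (meson finite_imageI)
qed

lemma fin_dim_iff:
  assumes I: "ideal I P"
  shows "vectorspace.fin_dim K (quot_mod I) \<longleftrightarrow> fin_codim I"
proof -
  interpret q: quotient_map P "quot_mod I" "\<lambda>f. I +> f" I by (rule quotient_map_mod[OF I])
  interpret V: vectorspace K "quot_mod I" by (rule quot_mod_vectorspace'[OF I])
  show ?thesis
  proof
    assume "V.fin_dim"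
    then obtain A where A: "finite A" "A \<subseteq> carrier (quot_mod I)" "V.span A = carrier (quot_mod I)"
      unfolding V.fin_dim_def by auto
    then obtain B where B: "B \<subseteq> carrier P" "finite B" "A = (\<lambda>f. I +> f) ` B"
      using finite_subset_image[OF A(1)] q.image by metis
    let ?N = "(\<lambda>f. I +> f) ` spn B"
    have "LinearCombinations.submodule K ?N (quot_mod I)"
      unfolding LinearCombinations.submodule_def
      using spn_closed spn.intros by (auto simp: V.module_axioms q.\<sigma>_zero q.\<sigma>_add quot_mod_smult[OF I])
    moreover have "A \<subseteq> ?N" using B spn_superset[OF B(1)] by auto
    ultimately have "V.span A \<subseteq> ?N" by (intro V.span_is_subset)
    then have "?N = carrier (quot_mod I)" using A(3) spn_closed by auto
    then have "spn (I \<union> spn B) = carrier P" using image_eq_quot_mod_iff[OF I subsp_spn] by simp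
    moreover have "spn (I \<union> spn B) \<subseteq> spn (I \<union> B)"
      by (rule spn_least) (use ideal_carrier[OF I] spn_mono[of B "I \<union> B"] in \<open>auto intro: spn_base\<close>)
    ultimately have "spn (I \<union> B) = carrier P" using spn_closed by auto
    then show "fin_codim I" using B unfolding fin_codim_def by auto
  next
    assume "fin_codim I"
    then show "V.fin_dim" using fin_dim_image[OF I _ subsp_carrier_P] quot_mod_carrier[OF I] by simp
  qed
qed

text \<open>A basis of a subspace is independent in the whole space; if it has as many elements as
  the dimension of the space, it spans. This is how the values of the Hilbert function are turned
  into equalities of subspaces.\<close>

lemma dim_image_eq_iff:
  assumes I: "ideal I P" "fin_codim I" and U: "subsp U"
  shows "vectorspace.dim K (quot_mod I\<lparr>carrier := (\<lambda>f. I +> f) ` U\<rparr>) = vectorspace.dim K (quot_mod I)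
    \<longleftrightarrow> spn (I \<union> U) = carrier P"
proof
  interpret q: quotient_map P "quot_mod I" "\<lambda>f. I +> f" I by (rule quotient_map_mod[OF I(1)])
  interpret V: vectorspace K "quot_mod I" by (rule quot_mod_vectorspace'[OF I(1)])
  let ?U = "(\<lambda>f. I +> f) ` U"
  interpret W: vectorspace K "quot_mod I\<lparr>carrier := ?U\<rparr>" by (rule quot_mod_vectorspace[OF I(1) U])
  {
    assume "spn (I \<union> U) = carrier P"
    then have "?U = carrier (quot_mod I)" using image_eq_quot_mod_iff[OF I(1) U] by simp
    then show "W.dim = V.dim" by (simp add: quot_mod_def)
  next
    assume eq: "W.dim = V.dim"
    have Uc: "u \<in> carrier P" if "u \<in> U" for u using subsp_carrier[OF U that] .
    have fin: "V.fin_dim" using fin_dim_iff[OF I(1)] I(2) by simp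
    have sub: "LinearCombinations.submodule K ?U (quot_mod I)"
      unfolding LinearCombinations.submodule_def
      using subsp_zero[OF U] subsp_add[OF U] subsp_smult[OF U] Uc
      by (auto simp: V.module_axioms q.\<sigma>_zero q.\<sigma>_add quot_mod_smult[OF I(1)])
    have "W.fin_dim" by (rule fin_dim_image[OF I U])
    then obtain B where B: "finite B" "W.basis B" using W.finite_basis_exists by blast
    have cB: "card B = V.dim" using W.dim_basis[OF B] eq by simp
    have BU: "B \<subseteq> ?U" "\<not> W.lin_dep B" "W.span B = ?U" using B(2) by (auto simp: W.basis_def)
    have "\<not> V.lin_dep B" "V.span B = ?U" using V.span_li_not_depend[OF BU(1) sub] BU by auto
    moreover have "B \<subseteq> carrier (quot_mod I)" using BU(1) Uc by auto
    ultimately have "V.basis B" using V.dim_li_is_basis[OF fin B(1)] cB by simp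
    then have "?U = carrier (quot_mod I)" using \<open>V.span B = ?U\<close> by (simp add: V.basis_def)
    then show "spn (I \<union> U) = carrier P" using image_eq_quot_mod_iff[OF I(1) U] by simp
  }
qed

end

section \<open>Gorenstein local quotients\<close>

text \<open>Elements of N kill x, so multiplication onto x is constant on a coset and
  \<open>the_elem\<close> is applied to a singleton.\<close>

lemma (in quotient_map) coset_smult:
  assumes M: "ideal N A" and x: "x \<in> carrier A" "\<And>y. y \<in> N \<Longrightarrow> y \<otimes>\<^bsub>A\<^esub> x = \<zero>\<^bsub>A\<^esub>" and a: "a \<in> carrier A"
  shows "the_elem ((\<lambda>b. b \<otimes>\<^bsub>A\<^esub> x) ` (N +>\<^bsub>A\<^esub> a)) = a \<otimes>\<^bsub>A\<^esub> x"
proof -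
  interpret N: ideal N A by fact
  have "(\<lambda>b. b \<otimes>\<^bsub>A\<^esub> x) ` (N +>\<^bsub>A\<^esub> a) = {a \<otimes>\<^bsub>A\<^esub> x}"
  proof
    show "(\<lambda>b. b \<otimes>\<^bsub>A\<^esub> x) ` (N +>\<^bsub>A\<^esub> a) \<subseteq> {a \<otimes>\<^bsub>A\<^esub> x}"
    proof
      fix z assume "z \<in> (\<lambda>b. b \<otimes>\<^bsub>A\<^esub> x) ` (N +>\<^bsub>A\<^esub> a)"
      then obtain m where m: "m \<in> N" "z = (m \<oplus>\<^bsub>A\<^esub> a) \<otimes>\<^bsub>A\<^esub> x" by (auto simp: a_r_coset_def')
      then show "z \<in> {a \<otimes>\<^bsub>A\<^esub> x}" using x a N.a_subset by (auto simp: A.l_distr)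
    qed
    have "a \<in> N +>\<^bsub>A\<^esub> a" using N.a_rcos_self[OF a] .
    then show "{a \<otimes>\<^bsub>A\<^esub> x} \<subseteq> (\<lambda>b. b \<otimes>\<^bsub>A\<^esub> x) ` (N +>\<^bsub>A\<^esub> a)" by auto
  qed
  then show ?thesis by simp
qed

context field_algebra
begin

text \<open>The map g \<mapsto> g f from P/M to (I + P f)/I is bijective, as I : f = M. So I + (f)
  meets the dimension condition of a minimal divisor.\<close>

lemma dim_adj_soc:
  assumes I: "ideal I P" "fin_codim I" and M: "M \<in> max_over I" and f: "f \<in> soc I M" "f \<notin> I"
  shows "vectorspace.dim K (quot_mod I\<lparr>carrier := (\<lambda>g. I +> g) ` adj I f\<rparr>) = vectorspace.dim K (quot_mod M)"
proof -
  have M': "maximalideal M P" "I \<subseteq> M" using M by (auto simp: max_over_def)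
  have fc: "f \<in> carrier P" using f by (simp add: soc_def)
  note Mid = maximal_ideal[OF M'(1)] and J = adj_ideal[OF I(1) fc]
  interpret q: quotient_map P "quot_mod I" "\<lambda>f. I +> f" I by (rule quotient_map_mod[OF I(1)])
  interpret m: quotient_map P "quot_mod M" "\<lambda>f. M +> f" M by (rule quotient_map_mod[OF Mid])
  let ?J = "(\<lambda>g. I +> g) ` adj I f"
  interpret V: vectorspace K "quot_mod M" by (rule quot_mod_vectorspace'[OF Mid])
  interpret W: vectorspace K "quot_mod I\<lparr>carrier := ?J\<rparr>" by (rule quot_mod_vectorspace[OF I(1) subsp_ideal[OF J]])
  have Mcolon: "g \<in> M \<longleftrightarrow> g \<otimes> f \<in> I" if "g \<in> carrier P" for g
    using colon_soc[OF I(1) M'(1) f] that by (auto simp: colon_def)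
  have eq: "M +> g = M +> g' \<longleftrightarrow> I +> (g \<otimes> f) = I +> (g' \<otimes> f)" if "g \<in> carrier P" "g' \<in> carrier P" for g g'
    using m.eq_iff[OF that] q.eq_iff[of "g \<otimes> f" "g' \<otimes> f"] Mcolon[of "g \<ominus> g'"] that fc by (simp add: diff_mult)
  \<comment> \<open>Multiplication by f on a chosen representative; the equivalence
    \<open>eq\<close> gives both independence of the choice and injectivity.\<close>
  define T where "T Z = I +> ((SOME g. g \<in> carrier P \<and> M +> g = Z) \<otimes> f)" for Z
  have T: "T (M +> g) = I +> (g \<otimes> f)" if "g \<in> carrier P" for g
  proof -
    have "(SOME g'. g' \<in> carrier P \<and> M +> g' = M +> g) \<in> carrier P \<and> M +> (SOME g'. g' \<in> carrier P \<and> M +> g' = M +> g) = M +> g"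
      by (rule someI_ex) (use that in auto)
    then show ?thesis unfolding T_def using eq[OF _ that] by blast
  qed
  have TJ: "g \<otimes> f \<in> adj I f" if "g \<in> carrier P" for g
    using ideal_lmult[OF J adj_member[OF I(1) fc] that] .
  have im: "T ` carrier (quot_mod M) = ?J"
  proof
    show "T ` carrier (quot_mod M) \<subseteq> ?J" using T TJ by (auto simp: m.image)
    show "?J \<subseteq> T ` carrier (quot_mod M)"
    proof
      fix y assume "y \<in> ?J"
      then obtain x where x: "x \<in> adj I f" "y = I +> x" by auto
      have xc: "x \<in> carrier P" using ideal_carrier[OF J x(1)] .
      obtain a where a: "a \<in> carrier P" "x \<ominus> a \<otimes> f \<in> I" using adj_iff[OF I(1) fc xc] x by auto
      have "I +> x = I +> (a \<otimes> f)" using q.eq_iff[of x "a \<otimes> f"] a xc fc by simp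
      then show "y \<in> T ` carrier (quot_mod M)" using x T[OF a(1)] a(1) by (auto simp: m.image)
    qed
  qed
  have "T \<in> LinearCombinations.module_hom K (quot_mod M) (quot_mod I\<lparr>carrier := ?J\<rparr>)"
    unfolding LinearCombinations.module_hom_def
  proof (intro CollectI conjI allI impI)
    show "T \<in> carrier (quot_mod M) \<rightarrow> carrier (quot_mod I\<lparr>carrier := ?J\<rparr>)" using im by auto
    fix x y assume "x \<in> carrier (quot_mod M) \<and> y \<in> carrier (quot_mod M)"
    then obtain g g' where g: "g \<in> carrier P" "g' \<in> carrier P" "x = M +> g" "y = M +> g'" by (auto simp: m.image)
    show "T (x \<oplus>\<^bsub>quot_mod M\<^esub> y) = T x \<oplus>\<^bsub>quot_mod I\<lparr>carrier := ?J\<rparr>\<^esub> T y"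
      using g fc by (simp add: m.\<sigma>_add T q.\<sigma>_add l_distr)
  next
    fix k x assume "k \<in> carrier K \<and> x \<in> carrier (quot_mod M)"
    then obtain g where g: "k \<in> carrier K" "g \<in> carrier P" "x = M +> g" by (auto simp: m.image)
    show "T (k \<odot>\<^bsub>quot_mod M\<^esub> x) = k \<odot>\<^bsub>quot_mod I\<lparr>carrier := ?J\<rparr>\<^esub> T x"
      using g fc by (simp add: quot_mod_smult[OF Mid] T quot_mod_smult[OF I(1)] m_assoc)
  qed
  then interpret T: linear_map K "quot_mod M" "quot_mod I\<lparr>carrier := ?J\<rparr>" T
    by (intro linear_map.intro V.vectorspace_axioms W.vectorspace_axioms mod_hom.intro mod_hom_axioms.intro
        V.module_axioms W.module_axioms)
  have "inj_on T (carrier (quot_mod M))"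
  proof (rule inj_onI)
    fix x y assume xy: "x \<in> carrier (quot_mod M)" "y \<in> carrier (quot_mod M)" "T x = T y"
    then obtain g g' where g: "g \<in> carrier P" "g' \<in> carrier P" "x = M +> g" "y = M +> g'" unfolding m.image by blast
    then show "x = y" using xy(3) T[OF g(1)] T[OF g(2)] eq[OF g(1,2)] by metis
  qed
  moreover have "V.fin_dim" using fin_dim_iff[OF Mid] fin_codim_mono[OF I(2) M'(2)] by simp
  ultimately have "V.dim = W.dim" using im by (intro T.dim_eq) auto
  then show ?thesis by simp
qed

section \<open>Quotients by an ideal Q with a single maximal ideal M over it\<close>

context
  fixes A :: "('r, 'n) ring_scheme" and \<sigma> :: "'p \<Rightarrow> 'r" and Q M :: "'p set"
  assumes qm: "quotient_map P A \<sigma> Q" and fin: "fin_codim Q" and loc: "max_over Q = {M}"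
begin

interpretation q: quotient_map P A \<sigma> Q by (rule qm)

lemma local_max: "maximalideal M P" "Q \<subseteq> M"
  using loc by (auto simp: max_over_def)

text \<open>The preimage of a maximal ideal is proper and contains Q, so it lies in some maximal
  ideal over Q, and the only one is M.\<close>

lemma maximal_quotient_iff: "maximalideal N A \<longleftrightarrow> N = \<sigma> ` M"
proof -
  note id = maximal_ideal[OF local_max(1)]
  have max: "maximalideal (\<sigma> ` M) A"
  proof (rule maximalidealI[OF q.image_ideal[OF id]])
    show "carrier A \<noteq> \<sigma> ` M"
      using q.image_mem_iff[OF id local_max(2) one_closed] maximal_one[OF local_max(1)] q.\<sigma>_closed[OF one_closed] by auto
    fix J assume J: "ideal J A" "\<sigma> ` M \<subseteq> J" "J \<subseteq> carrier A"
    let ?J = "{f \<in> carrier P. \<sigma> f \<in> J}"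
    have "M \<subseteq> ?J" using J(2) ideal_carrier[OF id] by auto
    then have "?J = M \<or> ?J = carrier P" using maximal_eq[OF local_max(1) q.preimage_ideal(1)[OF J(1)]] by blast
    then have "\<sigma> ` ?J = \<sigma> ` M \<or> \<sigma> ` ?J = \<sigma> ` carrier P" by auto
    then show "J = \<sigma> ` M \<or> J = carrier A" unfolding q.image_preimage[OF J(3)] q.image .
  qed
  moreover have "N = \<sigma> ` M" if N: "maximalideal N A"
  proof -
    interpret N: maximalideal N A by (rule N)
    let ?J = "{f \<in> carrier P. \<sigma> f \<in> N}"
    note J = q.preimage_ideal[OF N.is_ideal]
    have sub: "N \<subseteq> carrier A" using N.a_subset .
    have "?J \<noteq> carrier P"
    proof
      assume "?J = carrier P"
      then have "N = carrier A" using q.image_preimage[OF sub] q.image by simp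
      then show False using N.I_notcarr by simp
    qed
    then obtain M' where "M' \<in> max_over ?J" using max_over_exists[OF J(1) fin_codim_mono[OF fin J(2)]] by blast
    then have "M' \<in> max_over Q" "?J \<subseteq> M'" using J(2) by (auto simp: max_over_def)
    then have "?J \<subseteq> M" using loc by auto
    then have "N \<subseteq> \<sigma> ` M" using q.image_preimage[OF sub] by blast
    then show ?thesis
      using N.I_maximal[OF q.image_ideal[OF id]] max maximalideal.I_notcarr[OF max] ideal_carrier[OF id] by fastforce
  qed
  ultimately show ?thesis by blast
qed

lemma local_cring_quotient: "local_cring A" "max_ideal A = \<sigma> ` M"
  using q.A_cring by (auto simp: local_cring_def max_ideal_def maximal_quotient_iff)

lemma socle_quotient: "socle A = \<sigma> ` soc Q M"
proof
  have Mc: "m \<in> carrier P" if "m \<in> M" for m using that maximal_subset[OF local_max(1)] by auto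
  show "socle A \<subseteq> \<sigma> ` soc Q M"
  proof
    fix x assume x: "x \<in> socle A"
    then obtain f where f: "f \<in> carrier P" "x = \<sigma> f" using q.image by (auto simp: socle_def)
    have "m \<otimes> f \<in> Q" if m: "m \<in> M" for m
    proof -
      have "\<sigma> m \<otimes>\<^bsub>A\<^esub> x = \<zero>\<^bsub>A\<^esub>" using x m by (simp add: socle_def local_cring_quotient)
      then show ?thesis using f m Mc q.eq_zero_iff by (simp add: q.\<sigma>_mult)
    qed
    then show "x \<in> \<sigma> ` soc Q M" using f by (auto simp: soc_def)
  qed
  show "\<sigma> ` soc Q M \<subseteq> socle A"
    using Mc q.eq_zero_iff by (auto simp: socle_def soc_def local_cring_quotient q.\<sigma>_mult)
qed

lemma socle_space_smult:
  assumes "a \<in> carrier P" "f \<in> soc Q M"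
  shows "(\<sigma> ` M +>\<^bsub>A\<^esub> \<sigma> a) \<odot>\<^bsub>socle_space A\<^esub> \<sigma> f = \<sigma> (a \<otimes> f)"
proof -
  have fc: "f \<in> carrier P" using assms by (simp add: soc_def)
  have "\<sigma> f \<in> socle A" using assms by (simp add: socle_quotient)
  then have "the_elem ((\<lambda>b. b \<otimes>\<^bsub>A\<^esub> \<sigma> f) ` (\<sigma> ` M +>\<^bsub>A\<^esub> \<sigma> a)) = \<sigma> a \<otimes>\<^bsub>A\<^esub> \<sigma> f"
    using assms fc
    by (intro q.coset_smult[OF q.image_ideal[OF maximal_ideal[OF local_max(1)]]])
      (auto simp: socle_def local_cring_quotient)
  then show ?thesis using assms fc by (simp add: socle_space_def q.\<sigma>_mult)
qed

lemma residue_map: "quotient_map P (A Quot \<sigma> ` M) (\<lambda>f. \<sigma> ` M +>\<^bsub>A\<^esub> \<sigma> f) M"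
proof -
  note id = maximal_ideal[OF local_max(1)]
  have "{f \<in> carrier P. \<sigma> f \<in> \<sigma> ` M} = M"
    using q.image_mem_iff[OF id local_max(2)] ideal_carrier[OF id] by blast
  then show ?thesis using q.quotient_compose[OF q.image_ideal[OF id]] by simp
qed

lemma residue_field: "field (A Quot \<sigma> ` M)"
  using maximalideal.quotient_is_field[OF _ q.A_cring] maximal_quotient_iff by blast

lemma soc_Q_ideal: "ideal (soc Q M) P"
  by (rule soc_ideal[OF q.Q_ideal maximal_subset[OF local_max(1)]])

lemma socle_vectorspace: "vectorspace (A Quot \<sigma> ` M) (socle_space A)"
proof -
  interpret m: quotient_map P "A Quot \<sigma> ` M" "\<lambda>f. \<sigma> ` M +>\<^bsub>A\<^esub> \<sigma> f" M by (rule residue_map)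
  note S = soc_Q_ideal
  have Sc: "f \<in> carrier P" if "f \<in> soc Q M" for f using that by (simp add: soc_def)
  have ops: "carrier (socle_space A) = \<sigma> ` soc Q M" "\<zero>\<^bsub>socle_space A\<^esub> = \<sigma> \<zero>"
    "x \<oplus>\<^bsub>socle_space A\<^esub> y = x \<oplus>\<^bsub>A\<^esub> y" for x y
    by (simp_all add: socle_space_def socle_quotient q.\<sigma>_zero)
  have uminus: "\<ominus> f \<in> soc Q M" if "f \<in> soc Q M" for f using subsp_uminus[OF subsp_ideal[OF S] that] .
  show ?thesis
  proof (rule vs_criteria[OF residue_field])
    show "\<forall>v\<in>carrier (socle_space A). \<exists>w\<in>carrier (socle_space A). v \<oplus>\<^bsub>socle_space A\<^esub> w = \<zero>\<^bsub>socle_space A\<^esub>"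
    proof
      fix v assume "v \<in> carrier (socle_space A)"
      then obtain f where f: "f \<in> soc Q M" "v = \<sigma> f" by (auto simp: ops)
      then have "v \<oplus>\<^bsub>socle_space A\<^esub> \<sigma> (\<ominus> f) = \<zero>\<^bsub>socle_space A\<^esub>" using Sc by (simp add: ops q.\<sigma>_add r_neg)
      then show "\<exists>w\<in>carrier (socle_space A). v \<oplus>\<^bsub>socle_space A\<^esub> w = \<zero>\<^bsub>socle_space A\<^esub>"
        using uminus[OF f(1)] by (auto simp: ops)
    qed
  qed (use Sc ideal_add[OF S] ideal_lmult[OF S] ideal_zero[OF S] in
      \<open>auto simp: ops q.\<sigma>_add m.image m.\<sigma>_add m.\<sigma>_mult m.\<sigma>_one socle_space_smult a_ac r_distr l_distr m_assoc\<close>)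
qed

text \<open>The span of one socle element over the residue field is its set of P-multiples. So
  dimension one means that some nonzero element generates, and then each nonzero element
  does.\<close>

lemma gorenstein_local_iff: "gorenstein_local A \<longleftrightarrow> simple_socle Q M"
proof -
  let ?F = "A Quot \<sigma> ` M" let ?S = "socle_space A"
  interpret m: quotient_map P ?F "\<lambda>f. \<sigma> ` M +>\<^bsub>A\<^esub> \<sigma> f" M by (rule residue_map)
  interpret V: vectorspace ?F ?S by (rule socle_vectorspace)
  note S = soc_Q_ideal
  have Sc: "f \<in> carrier P" if "f \<in> soc Q M" for f using that by (simp add: soc_def)
  have carr: "carrier ?S = \<sigma> ` soc Q M" by (simp add: socle_space_def socle_quotient)
  have zero: "\<zero>\<^bsub>?S\<^esub> = \<zero>\<^bsub>A\<^esub>" by (simp add: socle_space_def)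
  have iff: "gorenstein_local A \<longleftrightarrow> V.fin_dim \<and> V.dim = 1"
    by (simp add: gorenstein_local_def local_cring_quotient)
  have span: "V.span {\<sigma> f} = {\<sigma> (a \<otimes> f) | a. a \<in> carrier P}" (is "_ = ?R") if f: "f \<in> soc Q M" for f
  proof
    have fS: "{\<sigma> f} \<subseteq> carrier ?S" using f carr by auto
    note sub = V.span_is_submodule[OF fS]
    have "\<sigma> (a \<otimes> f) \<in> V.span {\<sigma> f}" if a: "a \<in> carrier P" for a
      using LinearCombinations.submodule.smult_closed[OF sub, of "\<sigma> ` M +>\<^bsub>A\<^esub> \<sigma> a" "\<sigma> f"]
        V.in_own_span[OF fS] socle_space_smult[OF a f] m.\<sigma>_closed[OF a] by simp
    then show "?R \<subseteq> V.span {\<sigma> f}" by auto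
    have "LinearCombinations.submodule ?F ?R ?S"
      unfolding LinearCombinations.submodule_def
    proof (intro conjI allI impI)
      show "?R \<subseteq> carrier ?S" using ideal_lmult[OF S f] by (auto simp: carr)
      have "\<zero>\<^bsub>?S\<^esub> = \<sigma> (\<zero> \<otimes> f)" using Sc[OF f] by (simp add: zero q.\<sigma>_zero)
      then show "\<zero>\<^bsub>?S\<^esub> \<in> ?R" by blast
      fix v w assume "v \<in> ?R" "w \<in> ?R"
      then obtain a b where ab: "a \<in> carrier P" "b \<in> carrier P" "v = \<sigma> (a \<otimes> f)" "w = \<sigma> (b \<otimes> f)" by auto
      then have "v \<oplus>\<^bsub>?S\<^esub> w = \<sigma> ((a \<oplus> b) \<otimes> f)" using Sc[OF f] by (simp add: socle_space_def q.\<sigma>_add l_distr)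
      then show "v \<oplus>\<^bsub>?S\<^esub> w \<in> ?R" using ab by blast
    next
      fix k v assume "k \<in> carrier ?F" "v \<in> ?R"
      then obtain a b where ab: "a \<in> carrier P" "b \<in> carrier P" "v = \<sigma> (a \<otimes> f)" "k = \<sigma> ` M +>\<^bsub>A\<^esub> \<sigma> b"
        by (auto simp: m.image)
      then have "k \<odot>\<^bsub>?S\<^esub> v = \<sigma> ((b \<otimes> a) \<otimes> f)"
        using Sc[OF f] socle_space_smult[OF ab(2) ideal_lmult[OF S f ab(1)]] by (simp add: m_assoc)
      then show "k \<odot>\<^bsub>?S\<^esub> v \<in> ?R" using ab by blast
    qed (rule V.module_axioms)
    moreover have "\<sigma> f \<in> ?R"
    proof -
      have "\<sigma> f = \<sigma> (\<one> \<otimes> f)" using Sc[OF f] by simp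
      then show ?thesis by blast
    qed
    ultimately show "V.span {\<sigma> f} \<subseteq> ?R" by (intro V.span_is_subset) auto
  qed
  have adj: "f' \<in> adj Q f \<longleftrightarrow> \<sigma> f' \<in> V.span {\<sigma> f}" if f: "f \<in> soc Q M" "f' \<in> carrier P" for f f'
  proof -
    have "\<sigma> f' \<in> V.span {\<sigma> f} \<longleftrightarrow> (\<exists>a\<in>carrier P. \<sigma> f' = \<sigma> (a \<otimes> f))" unfolding span[OF f(1)] by blast
    also have "\<dots> \<longleftrightarrow> (\<exists>a\<in>carrier P. f' \<ominus> a \<otimes> f \<in> Q)" using q.eq_iff[OF f(2)] Sc[OF f(1)] by simp
    finally show ?thesis using adj_iff[OF q.Q_ideal Sc[OF f(1)] f(2)] by simp
  qed
  obtain f0 where f0: "f0 \<in> soc Q M" "f0 \<notin> Q" using soc_strict[OF q.Q_ideal fin loc] by blast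
  show ?thesis
  proof
    assume "gorenstein_local A"
    then have "V.fin_dim" "V.dim = 1" using iff by auto
    then obtain B where B: "finite B" "V.basis B" using V.finite_basis_exists by blast
    then have "card B = 1" using V.dim_basis \<open>V.dim = 1\<close> by simp
    then obtain v where v: "B = {v}" by (meson card_1_singletonE)
    then have vs: "V.span {v} = carrier ?S" "v \<in> carrier ?S" using B by (auto simp: V.basis_def)
    then obtain g where g: "g \<in> soc Q M" "v = \<sigma> g" by (auto simp: carr)
    show "simple_socle Q M"
      unfolding simple_socle_def
    proof (intro ballI impI)
      fix f f' assume f: "f \<in> soc Q M" "f' \<in> soc Q M" "f \<notin> Q"
      \<comment> \<open>If g is the basis vector, \<open>adj Q g\<close> is minimal over Q. Any
        other socle element outside Q therefore generates the same ideal.\<close>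
      have min: "minimal_over Q (adj Q g)"
      proof (rule adj_soc_minimal[OF q.Q_ideal local_max(1) g(1)])
        show "g \<notin> Q"
        proof
          assume "g \<in> Q"
          then have "adj Q g \<subseteq> Q" by (intro adj_least[OF q.Q_ideal]) auto
          moreover have "f0 \<in> adj Q g" using adj[OF g(1)] Sc[OF f0(1)] vs g f0 by (auto simp: carr)
          ultimately show False using f0(2) by auto
        qed
      qed
      have "f \<in> adj Q g" "f' \<in> adj Q g" using adj[OF g(1)] Sc f vs g by (auto simp: carr)
      then show "f' \<in> adj Q f" using minimal_over_adj[OF q.Q_ideal min _ f(3)] by auto
    qed
  next
    assume sim: "simple_socle Q M"
    have "carrier ?S \<subseteq> V.span {\<sigma> f0}" using sim f0 adj[OF f0(1)] Sc by (auto simp: carr simple_socle_def)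
    moreover have f0S: "{\<sigma> f0} \<subseteq> carrier ?S" using f0 carr by auto
    ultimately have sp: "V.span {\<sigma> f0} = carrier ?S" using V.span_is_subset2 by blast
    have "\<sigma> f0 \<noteq> \<zero>\<^bsub>?S\<^esub>" using q.eq_zero_iff[OF Sc[OF f0(1)]] f0(2) zero by simp
    then have "V.dim = 1" using V.dim1I[OF sp] f0S by simp
    moreover have "V.fin_dim" unfolding V.fin_dim_def using sp f0S by (intro exI[of _ "{\<sigma> f0}"]) simp
    ultimately show "gorenstein_local A" using iff by simp
  qed
qed

end

end

section \<open>Extension of the base field\<close>

text \<open>An axiomatic form of Q = P \<otimes> L. The image of P spans Q over L, and every K-form
  on P extends to an L-form on Q; the latter expresses that K-independent elements stay independent
  over L.\<close>

locale base_change = A: field_algebra K P c + field_algebra L Q d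
  for K :: "('k, 'm) ring_scheme" and P :: "('p, 'q) ring_scheme" and c :: "'k \<Rightarrow> 'p"
    and L :: "('l, 'n) ring_scheme" and Q :: "('r, 's) ring_scheme" (structure) and d :: "'l \<Rightarrow> 'r" +
  fixes h :: "'k \<Rightarrow> 'l" and \<eta> :: "'p \<Rightarrow> 'r"
  assumes h_hom: "h \<in> ring_hom K L"
    and \<eta>_hom: "\<eta> \<in> ring_hom P Q"
    and \<eta>_scalar: "k \<in> carrier K \<Longrightarrow> \<eta> (c k) = d (h k)"
    and \<eta>_spans: "spn (\<eta> ` carrier P) = carrier Q"
    and form_extends: "A.form \<Psi> \<Longrightarrow> \<exists>\<Phi>. form \<Phi> \<and> (\<forall>f\<in>carrier P. \<Phi> (\<eta> f) = h (\<Psi> f))"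
begin

lemma h_closed [simp]: "k \<in> carrier K \<Longrightarrow> h k \<in> carrier L"
  and h_one [simp]: "h \<one>\<^bsub>K\<^esub> = \<one>\<^bsub>L\<^esub>"
  and h_zero [simp]: "h \<zero>\<^bsub>K\<^esub> = \<zero>\<^bsub>L\<^esub>"
  and h_mult: "\<lbrakk>k \<in> carrier K; l \<in> carrier K\<rbrakk> \<Longrightarrow> h (k \<otimes>\<^bsub>K\<^esub> l) = h k \<otimes>\<^bsub>L\<^esub> h l"
  using h_hom ring_hom_zero[OF h_hom A.K.ring_axioms K.ring_axioms] by (auto simp: ring_hom_def)

lemma \<eta>_closed [simp]: "x \<in> carrier P \<Longrightarrow> \<eta> x \<in> carrier Q"
  and \<eta>_one [simp]: "\<eta> \<one>\<^bsub>P\<^esub> = \<one>"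
  and \<eta>_zero [simp]: "\<eta> \<zero>\<^bsub>P\<^esub> = \<zero>"
  and \<eta>_mult: "\<lbrakk>x \<in> carrier P; y \<in> carrier P\<rbrakk> \<Longrightarrow> \<eta> (x \<otimes>\<^bsub>P\<^esub> y) = \<eta> x \<otimes> \<eta> y"
  and \<eta>_add: "\<lbrakk>x \<in> carrier P; y \<in> carrier P\<rbrakk> \<Longrightarrow> \<eta> (x \<oplus>\<^bsub>P\<^esub> y) = \<eta> x \<oplus> \<eta> y"
  using \<eta>_hom ring_hom_zero[OF \<eta>_hom A.ring_axioms ring_axioms] by (auto simp: ring_hom_def)

lemma h_nonzero:
  assumes "k \<in> carrier K" "k \<noteq> \<zero>\<^bsub>K\<^esub>" shows "h k \<noteq> \<zero>\<^bsub>L\<^esub>"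
proof
  assume "h k = \<zero>\<^bsub>L\<^esub>"
  have k: "inv\<^bsub>K\<^esub> k \<in> carrier K" "inv\<^bsub>K\<^esub> k \<otimes>\<^bsub>K\<^esub> k = \<one>\<^bsub>K\<^esub>"
    using assms A.K.field_Units A.K.Units_l_inv[of k] A.K.Units_inv_closed[of k] by auto
  then have "\<one>\<^bsub>L\<^esub> = h (inv\<^bsub>K\<^esub> k) \<otimes>\<^bsub>L\<^esub> h k" using h_mult[of "inv\<^bsub>K\<^esub> k" k] assms by simp
  then show False using \<open>h k = \<zero>\<^bsub>L\<^esub>\<close> k by simp
qed

section \<open>Subspaces and ideals after extension of scalars\<close>

definition lift :: "'p set \<Rightarrow> 'r set" where
  "lift U = spn (\<eta> ` U)"

lemma subsp_lift [simp]: "subsp (lift U)"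
  by (simp add: lift_def)

lemma lift_mono: "U \<subseteq> V \<Longrightarrow> lift U \<subseteq> lift V"
  unfolding lift_def by (intro spn_mono image_mono)

lemma lift_carrier: "lift (carrier P) = carrier Q"
  by (simp add: lift_def \<eta>_spans)

lemma lift_base: "\<lbrakk>u \<in> U; u \<in> carrier P\<rbrakk> \<Longrightarrow> \<eta> u \<in> lift U"
  unfolding lift_def by (intro spn_base) auto

lemma lift_least: "\<lbrakk>subsp V; \<And>u. \<lbrakk>u \<in> U; u \<in> carrier P\<rbrakk> \<Longrightarrow> \<eta> u \<in> V; U \<subseteq> carrier P\<rbrakk> \<Longrightarrow> lift U \<subseteq> V"
  unfolding lift_def by (intro spn_least) auto

lemma lift_closed: "w \<in> lift U \<Longrightarrow> w \<in> carrier Q"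
  using subsp_carrier[OF subsp_lift] .

lemma lift_spn: assumes "S \<subseteq> carrier P" shows "lift (A.spn S) = lift S"
proof
  have "\<eta> x \<in> lift S" if "x \<in> A.spn S" for x
    using that
  proof induction
    case spn_zero
    then show ?case using subsp_zero[OF subsp_lift] by simp
  next
    case (spn_add x y)
    then show ?case using subsp_add[OF subsp_lift] by (simp add: \<eta>_add A.spn_closed)
  next
    case (spn_smult k x)
    then show ?case using subsp_smult[OF subsp_lift] by (simp add: \<eta>_mult \<eta>_scalar A.spn_closed)
  qed (auto intro: lift_base)
  then show "lift (A.spn S) \<subseteq> lift S"
    by (intro lift_least) (auto intro: A.spn_closed)
  show "lift S \<subseteq> lift (A.spn S)"
    by (intro lift_mono A.spn_superset assms)
qed

lemma lift_mult:
  assumes "m \<in> carrier P" "J \<subseteq> carrier P" "\<And>j. j \<in> J \<Longrightarrow> m \<otimes>\<^bsub>P\<^esub> j \<in> I" "v \<in> lift J"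
  shows "\<eta> m \<otimes> v \<in> lift I"
proof -
  have "lift J \<subseteq> {v \<in> carrier Q. \<eta> m \<otimes> v \<in> lift I}"
  proof (rule lift_least)
    show "subsp {v \<in> carrier Q. \<eta> m \<otimes> v \<in> lift I}"
      unfolding subsp_def
    proof (intro conjI ballI)
      fix k x assume "k \<in> carrier L" "x \<in> {v \<in> carrier Q. \<eta> m \<otimes> v \<in> lift I}"
      then show "d k \<otimes> x \<in> {v \<in> carrier Q. \<eta> m \<otimes> v \<in> lift I}"
        using m_lcomm[of "\<eta> m" "d k" x] assms(1) by (auto intro: subsp_smult)
    qed (use assms(1) subsp_zero[OF subsp_lift] in \<open>auto simp: r_distr intro: subsp_add\<close>)
    fix u assume u: "u \<in> J" "u \<in> carrier P"
    then have "\<eta> (m \<otimes>\<^bsub>P\<^esub> u) \<in> lift I" using assms by (intro lift_base) auto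
    then show "\<eta> u \<in> {v \<in> carrier Q. \<eta> m \<otimes> v \<in> lift I}" using u assms(1) by (simp add: \<eta>_mult)
  qed (use assms in auto)
  then show ?thesis using assms(4) by auto
qed

text \<open>Multiplication by elements of \<eta>(P) preserves the L-span of I, and these elements
  span Q.\<close>

lemma lift_ideal: assumes I: "ideal I P" shows "ideal (lift I) Q"
proof (rule idealI')
  fix a x assume ax: "a \<in> carrier Q" "x \<in> lift I"
  have xc: "x \<in> carrier Q" using ax lift_closed by auto
  have "a \<in> spn (\<eta> ` carrier P)" using ax \<eta>_spans by simp
  then show "a \<otimes> x \<in> lift I"
  proof induction
    case (spn_base y)
    then show ?case using lift_mult[OF _ A.ideal_subset[OF I] A.ideal_lmult[OF I] ax(2)] by auto
  next
    case (spn_add y z)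
    then show ?case using xc subsp_add[OF subsp_lift] by (simp add: l_distr spn_closed)
  next
    case (spn_smult k y)
    then show ?case using xc subsp_smult[OF subsp_lift] by (simp add: m_assoc spn_closed)
  qed (use xc subsp_zero[OF subsp_lift] in auto)
qed (use lift_closed subsp_zero[OF subsp_lift] subsp_add[OF subsp_lift] in auto)

lemma lift_eq_genideal: assumes I: "ideal I P" shows "lift I = genideal Q (\<eta> ` I)"
proof
  have sub: "\<eta> ` I \<subseteq> carrier Q" using A.ideal_carrier[OF I] by auto
  show "lift I \<subseteq> genideal Q (\<eta> ` I)"
    unfolding lift_def
    by (rule spn_least[OF subsp_ideal[OF genideal_ideal[OF sub]]]) (use genideal_self[OF sub] in auto)
  show "genideal Q (\<eta> ` I) \<subseteq> lift I"
    by (rule genideal_minimal[OF lift_ideal[OF I]]) (use A.ideal_carrier[OF I] lift_base in auto)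
qed

section \<open>Extension of forms and its exactness\<close>

definition ext :: "('p \<Rightarrow> 'k) \<Rightarrow> 'r \<Rightarrow> 'l" where
  "ext \<Psi> = (SOME \<Phi>. form \<Phi> \<and> (\<forall>f\<in>carrier P. \<Phi> (\<eta> f) = h (\<Psi> f)))"

lemma
  assumes "A.form \<Psi>"
  shows form_ext: "form (ext \<Psi>)" and ext_\<eta>: "f \<in> carrier P \<Longrightarrow> ext \<Psi> (\<eta> f) = h (\<Psi> f)"
  using someI_ex[OF form_extends[OF assms]] unfolding ext_def[symmetric] by auto

lemma form_eqI:
  assumes "form \<Phi>" "form \<Phi>'" "\<And>f. f \<in> carrier P \<Longrightarrow> \<Phi> (\<eta> f) = \<Phi>' (\<eta> f)" "w \<in> carrier Q"
  shows "\<Phi> w = \<Phi>' w"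
proof -
  have "w \<in> spn (\<eta> ` carrier P)" using assms \<eta>_spans by simp
  then show ?thesis
    by induction (use assms(1-3) in \<open>auto simp: form_zero form_add form_smult spn_closed\<close>)
qed

text \<open>An L-form is determined by its values on \<eta>(P), and there both sides are the same
  translate. So extending a form commutes with multiplying its argument by g.\<close>

lemma ext_translate:
  assumes "A.form \<Psi>" "g \<in> carrier P" "w \<in> carrier Q"
  shows "ext (\<lambda>x. \<Psi> (g \<otimes>\<^bsub>P\<^esub> x)) w = ext \<Psi> (\<eta> g \<otimes> w)"
proof (rule form_eqI[OF form_ext[OF A.form_translate] _ _ assms(3)])
  show "form (\<lambda>w. ext \<Psi> (\<eta> g \<otimes> w))" using form_translate[OF form_ext[OF assms(1)]] assms by simp
  fix f assume f: "f \<in> carrier P"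
  then have "ext \<Psi> (\<eta> g \<otimes> \<eta> f) = ext \<Psi> (\<eta> (g \<otimes>\<^bsub>P\<^esub> f))" using assms by (simp add: \<eta>_mult)
  then show "ext (\<lambda>x. \<Psi> (g \<otimes>\<^bsub>P\<^esub> x)) (\<eta> f) = ext \<Psi> (\<eta> g \<otimes> \<eta> f)"
    using assms f by (simp add: ext_\<eta> A.form_translate)
qed (use assms in auto)

lemma form_vanishes_lift:
  assumes "form \<Phi>" "U \<subseteq> carrier P" "\<And>u. u \<in> U \<Longrightarrow> \<Phi> (\<eta> u) = \<zero>\<^bsub>L\<^esub>" "w \<in> lift U" shows "\<Phi> w = \<zero>\<^bsub>L\<^esub>"
proof -
  have "lift U \<subseteq> ker \<Phi>"
    by (rule lift_least[OF subsp_ker[OF assms(1)]]) (use assms in \<open>auto simp: ker_def\<close>)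
  then show ?thesis using assms(4) by (auto simp: ker_def)
qed

lemma ext_vanishes_lift:
  "\<lbrakk>A.form \<Psi>; U \<subseteq> carrier P; \<And>u. u \<in> U \<Longrightarrow> \<Psi> u = \<zero>\<^bsub>K\<^esub>; w \<in> lift U\<rbrakk> \<Longrightarrow> ext \<Psi> w = \<zero>\<^bsub>L\<^esub>"
  by (rule form_vanishes_lift[OF form_ext]) (auto simp: ext_\<eta> subset_iff)

text \<open>A K-form that vanishes on U and is 1 at f extends to an L-form that vanishes on
  \<open>lift U\<close> and is 1 at \<eta> f. No element of P is gained by extending
  scalars.\<close>

lemma \<eta>_in_lift_iff:
  assumes "A.subsp U" "f \<in> carrier P" shows "\<eta> f \<in> lift U \<longleftrightarrow> f \<in> U"
proof
  assume f: "\<eta> f \<in> lift U"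
  show "f \<in> U"
  proof (rule ccontr)
    assume "f \<notin> U"
    then obtain \<Psi> where \<Psi>: "A.form \<Psi>" "\<And>u. u \<in> U \<Longrightarrow> \<Psi> u = \<zero>\<^bsub>K\<^esub>" "\<Psi> f = \<one>\<^bsub>K\<^esub>"
      using A.form_separation[OF assms] by blast
    have "ext \<Psi> (\<eta> f) = \<zero>\<^bsub>L\<^esub>"
      using ext_vanishes_lift[OF \<Psi>(1) A.subsp_subset[OF assms(1)] \<Psi>(2) f] .
    then show False using ext_\<eta>[OF \<Psi>(1) assms(2)] \<Psi>(3) by simp
  qed
qed (use assms lift_base in auto)

lemma lift_eq_carrier_iff: "A.subsp U \<Longrightarrow> lift U = carrier Q \<longleftrightarrow> U = carrier P"
  using \<eta>_in_lift_iff[of U] A.subsp_subset[of U] lift_carrier by auto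

text \<open>Induction on the number of forms. A new form that is not zero on the previous common
  kernel N cuts out a hyperplane of N, so w is a multiple of one vector \<eta> f modulo the lift of
  the hyperplane, and evaluating the form shows that the multiple is zero.\<close>

lemma flat_finite:
  assumes "finite F" "\<And>\<Psi>. \<Psi> \<in> F \<Longrightarrow> A.form \<Psi>" "w \<in> carrier Q" "\<And>\<Psi>. \<Psi> \<in> F \<Longrightarrow> ext \<Psi> w = \<zero>\<^bsub>L\<^esub>"
  shows "w \<in> lift (carrier P \<inter> \<Inter>(A.ker ` F))"
  using assms(1,2,4)
proof (induction F rule: finite_induct)
  case empty
  then show ?case using assms(3) lift_carrier by simp
next
  case (insert \<Psi> F)
  let ?N = "carrier P \<inter> \<Inter>(A.ker ` F)"
  have \<Psi>: "A.form \<Psi>" using insert by simp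
  have N: "A.subsp ?N"
    using insert.prems(1) A.subsp_ker unfolding A.subsp_def by auto
  have w: "w \<in> lift ?N" using insert by simp
  have eq: "carrier P \<inter> \<Inter>(A.ker ` insert \<Psi> F) = ?N \<inter> A.ker \<Psi>" by auto
  show ?case
  proof (cases "?N \<subseteq> A.ker \<Psi>")
    case True
    then show ?thesis unfolding eq using w by (simp add: inf.absorb1)
  next
    case False
    then obtain f where f: "f \<in> ?N" "\<Psi> f \<noteq> \<zero>\<^bsub>K\<^esub>" by (auto simp: A.ker_def)
    have fc: "f \<in> carrier P" using f by simp
    let ?N' = "?N \<inter> A.ker \<Psi>"
    have "lift ?N = lift (A.spn (insert f ?N'))" using A.ker_split[OF N \<Psi> f] by simp
    also have "\<dots> = lift (insert f ?N')" by (rule lift_spn) (use fc in auto)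
    also have "\<dots> \<subseteq> spn (insert (\<eta> f) (lift ?N'))"
      by (rule lift_least) (use fc lift_base[of _ ?N'] lift_closed in \<open>auto intro!: spn_base\<close>)
    finally have "w \<in> spn (insert (\<eta> f) (lift ?N'))" using w by auto
    then obtain k where k: "k \<in> carrier L" "w \<ominus> d k \<otimes> \<eta> f \<in> lift ?N'"
      using spn_insert_subsp[OF subsp_lift] fc \<eta>_closed by blast
    \<comment> \<open>The extended form vanishes on the lift of the hyperplane and, by assumption,
      on w. This leaves k h(\<Psi> f) = 0, where h(\<Psi> f) is nonzero.\<close>
    have "ext \<Psi> (w \<ominus> d k \<otimes> \<eta> f) = \<zero>\<^bsub>L\<^esub>"
      by (rule ext_vanishes_lift[OF \<Psi> _ _ k(2)]) (auto simp: A.ker_def)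
    moreover have "ext \<Psi> (w \<ominus> d k \<otimes> \<eta> f) = \<zero>\<^bsub>L\<^esub> \<ominus>\<^bsub>L\<^esub> k \<otimes>\<^bsub>L\<^esub> h (\<Psi> f)"
      using k(1) assms(3) fc insert.prems(2)[of \<Psi>] form_ext[OF \<Psi>]
      by (simp add: form_diff form_smult ext_\<eta>[OF \<Psi>])
    ultimately have "k \<otimes>\<^bsub>L\<^esub> h (\<Psi> f) = \<zero>\<^bsub>L\<^esub>"
      using k(1) A.form_closed[OF \<Psi> fc] by (simp add: K.minus_eq)
    then have "k = \<zero>\<^bsub>L\<^esub>"
      using K.integral[OF _ k(1) h_closed] h_nonzero[OF A.form_closed[OF \<Psi> fc] f(2)] A.form_closed[OF \<Psi> fc]
      by blast
    then show ?thesis unfolding eq using k(2) assms(3) fc by (simp add: minus_eq)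
  qed
qed

text \<open>Flatness of the field extension.\<close>

lemma flat:
  assumes F: "\<And>\<Psi>. \<Psi> \<in> F \<Longrightarrow> A.form \<Psi>" and w: "w \<in> carrier Q" "\<And>\<Psi>. \<Psi> \<in> F \<Longrightarrow> ext \<Psi> w = \<zero>\<^bsub>L\<^esub>"
    and fin: "A.fin_codim (carrier P \<inter> \<Inter>(A.ker ` F))"
  shows "w \<in> lift (carrier P \<inter> \<Inter>(A.ker ` F))"
proof -
  let ?N = "\<lambda>F. carrier P \<inter> \<Inter>(A.ker ` F)"
  let ?Q = "\<lambda>G. finite G \<and> G \<subseteq> F"
  have finN: "A.fin_codim (?N G)" if "G \<subseteq> F" for G
    by (rule A.fin_codim_mono[OF fin]) (use that in auto)
  have "A.codim (?N G) \<le> A.codim (?N F)" if "G \<subseteq> F" for G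
    by (rule A.codim_mono[OF fin]) (use that in auto)
  \<comment> \<open>A finite subfamily whose common kernel has the greatest codimension already has
    the same common kernel as F; the finite codimension of the full intersection bounds the
    search.\<close>
  then have "\<exists>G. ?Q G \<and> (\<forall>y. ?Q y \<longrightarrow> A.codim (?N y) \<le> A.codim (?N G))"
    by (intro ex_has_greatest_nat[of ?Q "{}" _ "Suc (A.codim (?N F))"]) (auto simp: less_Suc_eq_le)
  then obtain G where G: "?Q G" and max: "\<And>y. ?Q y \<Longrightarrow> A.codim (?N y) \<le> A.codim (?N G)" by blast
  have "?N G \<subseteq> A.ker \<Psi>" if \<Psi>: "\<Psi> \<in> F" for \<Psi>
  proof (rule ccontr)
    assume "\<not> ?N G \<subseteq> A.ker \<Psi>"
    then have psub: "?N (insert \<Psi> G) \<subset> ?N G" by auto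
    have sub: "A.subsp (?N (insert \<Psi> G))"
      using G F \<Psi> A.subsp_ker unfolding A.subsp_def by auto
    have "A.codim (?N G) < A.codim (?N (insert \<Psi> G))"
      by (rule A.codim_strict[OF sub finN psub]) (use G \<Psi> in auto)
    then show False using max[of "insert \<Psi> G"] G \<Psi> by auto
  qed
  then have "?N G = ?N F" using G by auto
  moreover have "w \<in> lift (?N G)" by (rule flat_finite) (use G F w in auto)
  ultimately show ?thesis by simp
qed

section \<open>Codimension after extension of scalars\<close>

lemma fin_codim_lift:
  assumes "A.fin_codim U" "U \<subseteq> carrier P" shows "fin_codim (lift U)" "codim (lift U) \<le> A.codim U"
proof -
  obtain B where B: "finite B" "card B = A.codim U" "B \<subseteq> carrier P" "A.spn (U \<union> B) = carrier P"
    using A.codim_basis[OF assms(1)] .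
  have "lift (A.spn (U \<union> B)) = lift (U \<union> B)" by (rule lift_spn) (use B assms in auto)
  also have "lift (U \<union> B) \<subseteq> spn (lift U \<union> \<eta> ` B)"
    by (rule lift_least) (use B assms lift_base lift_closed in \<open>auto intro!: spn_base\<close>)
  finally have "carrier Q \<subseteq> spn (lift U \<union> \<eta> ` B)" using B(4) lift_carrier by simp
  then have spans: "spn (lift U \<union> \<eta> ` B) = carrier Q" using subsp_subset[OF subsp_spn] by blast
  have \<eta>B: "finite (\<eta> ` B)" "\<eta> ` B \<subseteq> carrier Q" using B by auto
  show "fin_codim (lift U)" using spans \<eta>B unfolding fin_codim_def by blast
  have "codim (lift U) \<le> card (\<eta> ` B)" by (rule codim_le[OF \<eta>B spans])
  also have "\<dots> \<le> card B" using B(1) by (rule card_image_le)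
  finally show "codim (lift U) \<le> A.codim U" using B(2) by simp
qed

text \<open>Generators modulo U remain generators, which bounds the lift from above. Below, each
  vector added to U enlarges the lift strictly while lowering the codimension of U by at most
  one.\<close>

lemma codim_lift: assumes "A.fin_codim U" "A.subsp U" shows "codim (lift U) = A.codim U"
proof (rule antisym[OF fin_codim_lift(2)[OF assms(1) A.subsp_subset[OF assms(2)]]])
  show "A.codim U \<le> codim (lift U)" using assms
  proof (induction "A.codim U" arbitrary: U rule: less_induct)
    case less
    show ?case
    proof (cases "U = carrier P")
      case True
      then show ?thesis by (simp add: A.codim_carrier)
    next
      case False
      then obtain b where b: "b \<in> carrier P" "b \<notin> U" using A.subsp_subset less by auto
      define V where "V = A.spn (insert b U)"
      have V: "A.subsp V" "U \<subset> V" "b \<in> V"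
        using b A.subsp_subset[OF less.prems(2)] by (auto simp: V_def intro: A.spn_base)
      have fV: "A.fin_codim V" using A.fin_codim_mono[OF less.prems(1)] V by auto
      have "A.codim V < A.codim U" using A.codim_strict[OF less.prems(2,1) V(2)] A.subsp_subset[OF V(1)] by simp
      then have IH: "A.codim V \<le> codim (lift V)" using less.hyps fV V(1) by simp
      have "\<eta> b \<in> lift V" "\<eta> b \<notin> lift U" using b V \<eta>_in_lift_iff less.prems by auto
      then have "lift U \<subset> lift V" using lift_mono[of U V] V by auto
      then have "codim (lift V) < codim (lift U)"
        using fin_codim_lift(1)[OF less.prems(1)] A.subsp_subset[OF less.prems(2)]
        by (intro codim_strict) (auto dest: lift_closed)
      moreover have "A.codim U \<le> Suc (A.codim V)" unfolding V_def by (rule A.codim_insert[OF less.prems(1) b(1)])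
      ultimately show ?thesis using IH by linarith
    qed
  qed
qed

text \<open>Inside J \<otimes> L no ideal larger than I \<otimes> L lies in the kernel. For J = P
  and \<Phi> vanishing on \<open>lift I\<close>, this is the vanishing of the annihilator of the
  induced form; the parameter J allows the work to be done socle by socle.\<close>

definition faithful_on :: "'p set \<Rightarrow> 'p set \<Rightarrow> ('r \<Rightarrow> 'l) \<Rightarrow> bool" where
  "faithful_on I J \<Phi> \<longleftrightarrow> (\<forall>v\<in>lift J. (\<forall>g\<in>carrier Q. \<Phi> (g \<otimes> v) = \<zero>\<^bsub>L\<^esub>) \<longrightarrow> v \<in> lift I)"

definition admissible :: "'p set \<Rightarrow> 'p set \<Rightarrow> ('r \<Rightarrow> 'l) \<Rightarrow> bool" where
  "admissible I W \<Phi> \<longleftrightarrow> form \<Phi> \<and> (\<forall>v\<in>lift I \<union> lift W. \<Phi> v = \<zero>\<^bsub>L\<^esub>)"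

section \<open>Consequences of a faithful form\<close>

lemma ideals_escape_if_faithful:
  assumes I: "ideal I P" and W: "A.subsp W"
    and \<Phi>: "admissible I W \<Phi>" "faithful_on I (carrier P) \<Phi>"
  shows "A.ideals_escape I W"
  unfolding A.ideals_escape_def
proof (intro allI impI notI)
  fix J assume J: "ideal J P" "I \<subset> J" "J \<subseteq> A.spn (I \<union> W)"
  obtain f where f: "f \<in> J" "f \<notin> I" using J by auto
  have fc: "f \<in> carrier P" using f A.ideal_carrier[OF J(1)] by simp
  have sub: "I \<union> W \<subseteq> carrier P" using A.ideal_subset[OF I] A.subsp_subset[OF W] by simp
  have "\<Phi> (g \<otimes> \<eta> f) = \<zero>\<^bsub>L\<^esub>" if g: "g \<in> carrier Q" for g
  proof -
    have "g \<otimes> \<eta> f \<in> lift J" using ideal_lmult[OF lift_ideal[OF J(1)] lift_base[OF f(1) fc] g] .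
    also have "lift J \<subseteq> lift (A.spn (I \<union> W))" by (rule lift_mono[OF J(3)])
    also have "\<dots> = lift (I \<union> W)" by (rule lift_spn[OF sub])
    finally have gf: "g \<otimes> \<eta> f \<in> lift (I \<union> W)" .
    have "\<Phi> (\<eta> u) = \<zero>\<^bsub>L\<^esub>" if "u \<in> I \<union> W" for u
      using \<Phi>(1) that sub lift_base[of u I] lift_base[of u W] by (auto simp: admissible_def)
    then show ?thesis
      using form_vanishes_lift[OF _ sub _ gf] \<Phi>(1) by (simp add: admissible_def)
  qed
  then have "\<eta> f \<in> lift I" using \<Phi>(2) fc by (auto simp: faithful_on_def lift_carrier)
  then show False using \<eta>_in_lift_iff[OF A.subsp_ideal[OF I] fc] f by simp
qed

text \<open>A dimension count. If f' were outside J = I + (f), then E = J + (f') would still satisfy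
  M E \<subseteq> I. Faithfulness limits dim E/I to dim P/M, but J/I already has at least that
  dimension and E is strictly larger.\<close>

lemma gorenstein_if_faithful:
  assumes I: "ideal I P" "A.fin_codim I"
    and \<Phi>: "form \<Phi>" "\<And>v. v \<in> lift I \<Longrightarrow> \<Phi> v = \<zero>\<^bsub>L\<^esub>" "faithful_on I (carrier P) \<Phi>"
  shows "A.gorenstein I"
  unfolding A.gorenstein_def
proof (intro ballI impI, rule ccontr)
  fix M f f' assume M: "M \<in> A.max_over I" and f: "f \<in> A.soc I M" "f \<notin> I"
    and f': "f' \<in> A.soc I M" "f' \<notin> A.adj I f"
  have M': "maximalideal M P" "I \<subseteq> M" using M by (auto simp: A.max_over_def)
  have fc: "f \<in> carrier P" "f' \<in> carrier P" using f f' by (auto simp: A.soc_def)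
  let ?J = "A.adj I f" let ?E = "A.adj ?J f'"
  have J: "ideal ?J P" "I \<subseteq> ?J" using A.adj_ideal A.adj_superset I fc by auto
  have E: "ideal ?E P" "?J \<subset> ?E" using A.adj_ideal A.adj_psubset J fc f' by auto
  note soc = A.soc_ideal[OF I(1) A.maximal_subset[OF M'(1)]]
  have E_soc: "?E \<subseteq> A.soc I M"
    by (rule A.adj_least[OF soc A.adj_least[OF soc A.soc_superset[OF I(1) A.maximal_subset[OF M'(1)]] f(1)] f'(1)])
  have fM: "A.fin_codim M" using A.fin_codim_mono I M' by auto
  obtain B where B: "finite B" "card B = A.codim M" "B \<subseteq> carrier P" "A.spn (M \<union> B) = carrier P"
    using A.codim_basis[OF fM] .
  \<comment> \<open>The elements of E \<otimes> L killed by the translates of \<Phi> by members of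
    S. Each translate costs at most one dimension, and S will be a set of generators of P modulo
    M.\<close>
  let ?V = "\<lambda>S. lift ?E \<inter> {v \<in> carrier Q. \<forall>b\<in>S. \<Phi> (\<eta> b \<otimes> v) = \<zero>\<^bsub>L\<^esub>}"
  have lI: "lift I \<subseteq> ?V S" if "S \<subseteq> carrier P" for S
    using lift_mono[of I ?E] J E that \<Phi>(2) ideal_lmult[OF lift_ideal[OF I(1)]] lift_closed by auto
  have finV: "fin_codim (?V S)" if "S \<subseteq> carrier P" for S
    using fin_codim_mono[OF fin_codim_lift(1)[OF I(2) A.ideal_subset[OF I(1)]] lI[OF that]] .
  have V: "subsp (?V S) \<and> codim (?V S) \<le> codim (lift ?E) + card S" if "finite S" "S \<subseteq> carrier P" for S
    using that
  proof (induction S rule: finite_induct)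
    case empty
    have "?V {} = lift ?E" using lift_closed by auto
    then show ?case by simp
  next
    case (insert b S)
    have b: "b \<in> carrier P" using insert by simp
    have frm: "form (\<lambda>v. \<Phi> (\<eta> b \<otimes> v))" using form_translate[OF \<Phi>(1)] b by simp
    have eq: "?V (insert b S) = ?V S \<inter> ker (\<lambda>v. \<Phi> (\<eta> b \<otimes> v))" by (auto simp: ker_def)
    have "codim (?V S \<inter> ker (\<lambda>v. \<Phi> (\<eta> b \<otimes> v))) \<le> Suc (codim (?V S))"
      by (rule codim_Int_ker[OF _ frm]) (use insert finV[of "insert b S"] eq in auto)
    then show ?case
      using insert subsp_Int[of "?V S", OF _ subsp_ker[OF frm]] unfolding eq by simp
  qed
  \<comment> \<open>M sends E into I, where \<Phi> is zero, and B together with M spans P. So the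
    finitely many conditions for B imply \<Phi>(g v) = 0 for every g.\<close>
  have "?V B \<subseteq> lift I"
  proof
    fix v assume v: "v \<in> ?V B"
    have vc: "v \<in> carrier Q" using v by simp
    have "\<Phi> (g \<otimes> v) = \<zero>\<^bsub>L\<^esub>" if "g \<in> carrier Q" for g
    proof -
      have "g \<in> lift (M \<union> B)"
        using that lift_spn[of "M \<union> B"] B lift_carrier A.maximal_subset[OF M'(1)] by simp
      then have "g \<in> spn (\<eta> ` (M \<union> B))" by (simp add: lift_def)
      then show ?thesis
      proof induction
        case (spn_base x)
        then obtain y where y: "x = \<eta> y" "y \<in> M \<union> B" by auto
        show ?case
        proof (cases "y \<in> B")
          case False
          then have "y \<in> M" using y by simp
          then have "\<eta> y \<otimes> v \<in> lift I"
            using lift_mult[of y ?E I v] v E_soc A.maximal_subset[OF M'(1)] A.ideal_subset[OF E(1)]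
            by (auto simp: A.soc_def)
          then show ?thesis using \<Phi>(2) y by simp
        qed (use v y in auto)
      qed (use vc \<Phi>(1) in \<open>auto simp: form_zero l_distr form_add form_smult m_assoc spn_closed\<close>)
    qed
    then show "v \<in> lift I" using \<Phi>(3) vc by (simp add: faithful_on_def lift_carrier)
  qed
  then have "codim (lift I) \<le> codim (?V B)" by (rule codim_mono[OF finV[OF B(3)]])
  \<comment> \<open>In terms of dimensions: E/I is at most as large as P/M. The remaining three
    facts contradict this.\<close>
  then have 1: "A.codim I \<le> codim (lift ?E) + A.codim M"
    using V[OF B(1,3)] B(2) codim_lift[OF I(2) A.subsp_ideal[OF I(1)]] by simp
  have 2: "codim (lift ?E) = A.codim ?E"
    by (rule codim_lift[OF A.fin_codim_mono[OF I(2)] A.subsp_ideal[OF E(1)]]) (use J E in auto)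
  have 3: "A.codim ?E < A.codim ?J"
    by (rule A.codim_strict[OF A.subsp_ideal[OF J(1)] A.fin_codim_mono[OF I(2) J(2)] E(2) A.ideal_subset[OF E(1)]])
  have 4: "A.codim ?J + A.codim M \<le> A.codim I" by (rule A.codim_adj_soc[OF I M f])
  show False using 1 2 3 4 by linarith
qed

end

context base_change
begin

section \<open>Combining forms over an infinite field\<close>

lemma form_combine:
  assumes "form \<Phi>" "form \<Psi>" "k \<in> carrier L"
  shows "form (\<lambda>w. \<Phi> w \<oplus>\<^bsub>L\<^esub> k \<otimes>\<^bsub>L\<^esub> \<Psi> w)"
  unfolding form_def
proof (intro conjI ballI funcsetI)
  fix x assume x: "x \<in> carrier Q"
  note cl = form_closed[OF assms(1)] form_closed[OF assms(2)]
  show "\<Phi> x \<oplus>\<^bsub>L\<^esub> k \<otimes>\<^bsub>L\<^esub> \<Psi> x \<in> carrier L" using cl x assms by simp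
  { fix y assume y: "y \<in> carrier Q"
    show "\<Phi> (x \<oplus> y) \<oplus>\<^bsub>L\<^esub> k \<otimes>\<^bsub>L\<^esub> \<Psi> (x \<oplus> y) = \<Phi> x \<oplus>\<^bsub>L\<^esub> k \<otimes>\<^bsub>L\<^esub> \<Psi> x \<oplus>\<^bsub>L\<^esub> (\<Phi> y \<oplus>\<^bsub>L\<^esub> k \<otimes>\<^bsub>L\<^esub> \<Psi> y)"
      using cl x y assms by (simp add: form_add K.r_distr K.a_ac) }
next
  fix l x assume lx: "l \<in> carrier L" "x \<in> carrier Q"
  show "\<Phi> (d l \<otimes> x) \<oplus>\<^bsub>L\<^esub> k \<otimes>\<^bsub>L\<^esub> \<Psi> (d l \<otimes> x) = l \<otimes>\<^bsub>L\<^esub> (\<Phi> x \<oplus>\<^bsub>L\<^esub> k \<otimes>\<^bsub>L\<^esub> \<Psi> x)"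
    using form_closed[OF assms(1) lx(2)] form_closed[OF assms(2) lx(2)] lx assms
    by (simp add: form_smult K.r_distr K.m_lcomm)
qed

text \<open>If \<open>\<Psi>\<close> is faithful on \<open>J\<close>, the equation \<open>\<Phi>(g v) = - \<Psi>(g (T v))\<close> determines an
  endomorphism \<open>T\<close> of \<open>J/I\<close> on its domain of definition, and \<open>\<Phi> + k \<Psi>\<close> is faithful on \<open>J\<close> unless
  \<open>k\<close> is an eigenvalue of \<open>T\<close>.\<close>

lemma finite_unfaithful:
  assumes I: "ideal I P" "A.fin_codim I" and J: "ideal J P" "I \<subseteq> J"
    and \<Phi>: "form \<Phi>" "\<And>v. v \<in> lift I \<Longrightarrow> \<Phi> v = \<zero>\<^bsub>L\<^esub>"
    and \<Psi>: "form \<Psi>" "\<And>v. v \<in> lift I \<Longrightarrow> \<Psi> v = \<zero>\<^bsub>L\<^esub>" "faithful_on I J \<Psi>"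
  shows "finite {k \<in> carrier L. \<not> faithful_on I J (\<lambda>w. \<Phi> w \<oplus>\<^bsub>L\<^esub> k \<otimes>\<^bsub>L\<^esub> \<Psi> w)}"
proof -
  \<comment> \<open>The preimage in J \<otimes> L of the eigenspace of T for k: there T v = k v
    modulo \<open>lift I\<close>. The scalar k is an exception iff \<open>V k\<close> is not inside
    \<open>lift I\<close>. \<open>S C\<close> is the sum of the eigenspaces for the scalars in
    C.\<close>
  define V where "V k = {v \<in> lift J. \<forall>g\<in>carrier Q. \<Phi> (g \<otimes> v) \<oplus>\<^bsub>L\<^esub> k \<otimes>\<^bsub>L\<^esub> \<Psi> (g \<otimes> v) = \<zero>\<^bsub>L\<^esub>}" for k
  define S where "S C = spn (lift I \<union> (\<Union>k\<in>C. V k))" for C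
  note cl = form_closed[OF \<Phi>(1)] form_closed[OF \<Psi>(1)]
  have Vc: "v \<in> carrier Q" if "v \<in> V k" for v k using that lift_closed by (auto simp: V_def)
  have Vs: "d l \<otimes> v \<in> V k" if "k \<in> carrier L" "l \<in> carrier L" "v \<in> V k" for k l v
  proof -
    have "\<Phi> (g \<otimes> (d l \<otimes> v)) \<oplus>\<^bsub>L\<^esub> k \<otimes>\<^bsub>L\<^esub> \<Psi> (g \<otimes> (d l \<otimes> v)) = \<zero>\<^bsub>L\<^esub>" if g: "g \<in> carrier Q" for g
    proof -
      have "g \<otimes> (d l \<otimes> v) = d l \<otimes> (g \<otimes> v)" using m_lcomm[of g "d l" v] g \<open>l \<in> carrier L\<close> Vc[OF \<open>v \<in> V k\<close>] by simp
      moreover have "\<Phi> (g \<otimes> v) \<oplus>\<^bsub>L\<^esub> k \<otimes>\<^bsub>L\<^esub> \<Psi> (g \<otimes> v) = \<zero>\<^bsub>L\<^esub>" using g \<open>v \<in> V k\<close> by (simp add: V_def)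
      ultimately show ?thesis
        using form_smult[OF form_combine[OF \<Phi>(1) \<Psi>(1) \<open>k \<in> carrier L\<close>] \<open>l \<in> carrier L\<close>, of "g \<otimes> v"]
          g \<open>l \<in> carrier L\<close> Vc[OF \<open>v \<in> V k\<close>] by simp
    qed
    then show ?thesis using that subsp_smult[OF subsp_lift] by (simp add: V_def)
  qed
  have IJ: "lift I \<subseteq> lift J" by (rule lift_mono[OF J(2)])
  have IS: "lift I \<subseteq> S C" for C
    unfolding S_def using lift_closed by (auto intro: spn_base)
  have VS: "V k \<subseteq> S C" if "k \<in> C" for k C
    unfolding S_def using Vc that by (auto intro: spn_base)
  \<comment> \<open>Independence of eigenspaces: an eigenvector for k in the sum of eigenspaces for
    other scalars is zero modulo \<open>lift I\<close>. One scalar l at a time is removed by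
    applying T - l.\<close>
  have key: "v \<in> lift I" if "finite C" "C \<subseteq> carrier L" "k \<in> carrier L" "k \<notin> C" "v \<in> V k" "v \<in> S C" for C k v
    using that
  proof (induction C arbitrary: v rule: finite_induct)
    case empty
    then show ?case using spn_subsp[OF subsp_lift] by (simp add: S_def)
  next
    case (insert l C)
    have l: "l \<in> carrier L" using insert by simp
    have vc: "v \<in> carrier Q" using insert Vc by blast
    \<comment> \<open>Here u is a value of T at w. Stating its existence, by induction over the
      span, replaces T by a relation, since T is only partially defined and only determined modulo
      \<open>lift I\<close>.\<close>
    have "\<exists>u\<in>lift J. u \<ominus> d l \<otimes> w \<in> S C \<and> (\<forall>g\<in>carrier Q. \<Phi> (g \<otimes> w) \<oplus>\<^bsub>L\<^esub> \<Psi> (g \<otimes> u) = \<zero>\<^bsub>L\<^esub>)"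
      if "w \<in> S (insert l C)" for w
      using that unfolding S_def[of "insert l C"]
    proof induction
      case spn_zero
      have "\<zero> \<in> S C" by (simp add: S_def subsp_zero)
      then show ?case
        using l subsp_zero[OF subsp_lift] form_zero[OF \<Phi>(1)] form_zero[OF \<Psi>(1)]
        by (intro bexI[of _ \<zero>]) (auto simp: minus_eq)
    next
      case (spn_base x)
      then consider "x \<in> lift I" | m where "m \<in> insert l C" "x \<in> V m" by auto
      then show ?case
      proof cases
        case 1
        have "\<zero> \<ominus> d l \<otimes> x \<in> S C"
        proof -
          have "\<zero> \<ominus> d l \<otimes> x \<in> lift I"
            using 1 l by (intro subsp_diff subsp_smult subsp_lift subsp_zero[OF subsp_lift])
          then show ?thesis using IS by blast
        qed
        moreover have "\<Phi> (g \<otimes> x) = \<zero>\<^bsub>L\<^esub>" if "g \<in> carrier Q" for g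
          using \<Phi>(2) ideal_lmult[OF lift_ideal[OF I(1)] 1 that] by blast
        ultimately show ?thesis
          using subsp_zero[OF subsp_lift] form_zero[OF \<Psi>(1)] by (intro bexI[of _ \<zero>]) auto
      next
        case 2
        have m: "m \<in> carrier L" using 2 insert by auto
        \<comment> \<open>On the eigenspace of m the value of T at x is m x. So T - l kills x if m =
          l, and otherwise keeps it in an eigenspace that belongs to C.\<close>
        have dm: "d m \<otimes> x \<ominus> d l \<otimes> x = d (m \<ominus>\<^bsub>L\<^esub> l) \<otimes> x"
          using m l spn_base(2) by (simp add: c_diff diff_mult)
        have "d m \<otimes> x \<ominus> d l \<otimes> x \<in> S C"
        proof (cases "m = l")
          case True
          then show ?thesis using m spn_base(2) by (simp add: minus_eq r_neg S_def subsp_zero)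
        next
          case False
          then show ?thesis using dm Vs[OF m _ 2(2), of "m \<ominus>\<^bsub>L\<^esub> l"] VS[of m C] 2 m l by auto
        qed
        moreover have "\<Phi> (g \<otimes> x) \<oplus>\<^bsub>L\<^esub> \<Psi> (g \<otimes> (d m \<otimes> x)) = \<zero>\<^bsub>L\<^esub>" if g: "g \<in> carrier Q" for g
        proof -
          have "g \<otimes> (d m \<otimes> x) = d m \<otimes> (g \<otimes> x)" using m_lcomm[of g "d m" x] g m spn_base(2) by simp
          then show ?thesis using 2(2) g m spn_base(2) by (simp add: form_smult[OF \<Psi>(1)] V_def)
        qed
        moreover have "d m \<otimes> x \<in> lift J" using subsp_smult[OF subsp_lift m] 2(2) by (auto simp: V_def)
        ultimately show ?thesis by blast
      qed
    next
      case (spn_add x y)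
      then obtain u t where u: "u \<in> lift J" "u \<ominus> d l \<otimes> x \<in> S C" "\<And>g. g \<in> carrier Q \<Longrightarrow> \<Phi> (g \<otimes> x) \<oplus>\<^bsub>L\<^esub> \<Psi> (g \<otimes> u) = \<zero>\<^bsub>L\<^esub>"
        and t: "t \<in> lift J" "t \<ominus> d l \<otimes> y \<in> S C" "\<And>g. g \<in> carrier Q \<Longrightarrow> \<Phi> (g \<otimes> y) \<oplus>\<^bsub>L\<^esub> \<Psi> (g \<otimes> t) = \<zero>\<^bsub>L\<^esub>" by auto
      have c: "x \<in> carrier Q" "y \<in> carrier Q" "u \<in> carrier Q" "t \<in> carrier Q"
        using spn_add spn_closed u t lift_closed by auto
      have "(u \<oplus> t) \<ominus> d l \<otimes> (x \<oplus> y) = (u \<ominus> d l \<otimes> x) \<oplus> (t \<ominus> d l \<otimes> y)"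
        using c l by (simp add: r_distr add_diff_add)
      then have 1: "(u \<oplus> t) \<ominus> d l \<otimes> (x \<oplus> y) \<in> S C" using u t by (simp add: S_def subsp_add)
      have 2: "\<Phi> (g \<otimes> (x \<oplus> y)) \<oplus>\<^bsub>L\<^esub> \<Psi> (g \<otimes> (u \<oplus> t)) = \<zero>\<^bsub>L\<^esub>" if g: "g \<in> carrier Q" for g
      proof -
        have "\<Phi> (g \<otimes> (x \<oplus> y)) \<oplus>\<^bsub>L\<^esub> \<Psi> (g \<otimes> (u \<oplus> t))
            = (\<Phi> (g \<otimes> x) \<oplus>\<^bsub>L\<^esub> \<Psi> (g \<otimes> u)) \<oplus>\<^bsub>L\<^esub> (\<Phi> (g \<otimes> y) \<oplus>\<^bsub>L\<^esub> \<Psi> (g \<otimes> t))"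
          using c g by (simp add: r_distr form_add[OF \<Phi>(1)] form_add[OF \<Psi>(1)] cl K.a_ac)
        then show ?thesis using u(3)[OF g] t(3)[OF g] by simp
      qed
      show ?case using 1 2 subsp_add[OF subsp_lift u(1) t(1)] by blast
    next
      case (spn_smult m x)
      then obtain u where u: "u \<in> lift J" "u \<ominus> d l \<otimes> x \<in> S C" "\<And>g. g \<in> carrier Q \<Longrightarrow> \<Phi> (g \<otimes> x) \<oplus>\<^bsub>L\<^esub> \<Psi> (g \<otimes> u) = \<zero>\<^bsub>L\<^esub>"
        by auto
      have c: "x \<in> carrier Q" "u \<in> carrier Q" "m \<in> carrier L"
        using spn_smult spn_closed u lift_closed by auto
      have "d m \<otimes> u \<ominus> d l \<otimes> (d m \<otimes> x) = d m \<otimes> (u \<ominus> d l \<otimes> x)"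
        using c l m_lcomm[of "d l" "d m" x] by (simp add: mult_diff)
      then have 1: "d m \<otimes> u \<ominus> d l \<otimes> (d m \<otimes> x) \<in> S C" using u c by (simp add: S_def subsp_smult)
      have 2: "\<Phi> (g \<otimes> (d m \<otimes> x)) \<oplus>\<^bsub>L\<^esub> \<Psi> (g \<otimes> (d m \<otimes> u)) = \<zero>\<^bsub>L\<^esub>" if g: "g \<in> carrier Q" for g
      proof -
        have "g \<otimes> (d m \<otimes> x) = d m \<otimes> (g \<otimes> x)" "g \<otimes> (d m \<otimes> u) = d m \<otimes> (g \<otimes> u)"
          using m_lcomm[of g "d m"] g c by auto
        then have "\<Phi> (g \<otimes> (d m \<otimes> x)) \<oplus>\<^bsub>L\<^esub> \<Psi> (g \<otimes> (d m \<otimes> u)) = m \<otimes>\<^bsub>L\<^esub> (\<Phi> (g \<otimes> x) \<oplus>\<^bsub>L\<^esub> \<Psi> (g \<otimes> u))"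
          using c g by (simp add: form_smult[OF \<Phi>(1)] form_smult[OF \<Psi>(1)] cl K.r_distr)
        then show ?thesis using u(3)[OF g] c by simp
      qed
      show ?case using 1 2 subsp_smult[OF subsp_lift c(3) u(1)] by blast
    qed
    from this[OF insert.prems(5)]
    obtain u where u: "u \<in> lift J" "u \<ominus> d l \<otimes> v \<in> S C" "\<And>g. g \<in> carrier Q \<Longrightarrow> \<Phi> (g \<otimes> v) \<oplus>\<^bsub>L\<^esub> \<Psi> (g \<otimes> u) = \<zero>\<^bsub>L\<^esub>"
      by auto
    have uc: "u \<in> carrier Q" using u lift_closed by auto
    have k: "k \<in> carrier L" "k \<noteq> l" using insert by auto
    have vJ: "v \<in> lift J" using insert.prems(4) by (simp add: V_def)
    have ukv: "u \<ominus> d k \<otimes> v \<in> lift J" using subsp_diff[OF subsp_lift u(1) subsp_smult[OF subsp_lift k(1) vJ]] .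
    \<comment> \<open>Both u and k v serve as a value of T at v, and the faithfulness of \<Psi>
      makes such values unique modulo \<open>lift I\<close>.\<close>
    have "\<Psi> (g \<otimes> (u \<ominus> d k \<otimes> v)) = \<zero>\<^bsub>L\<^esub>" if g: "g \<in> carrier Q" for g
    proof -
      have gkv: "g \<otimes> (d k \<otimes> v) = d k \<otimes> (g \<otimes> v)" using m_lcomm[of g "d k" v] g k vc by simp
      have c: "\<Phi> (g \<otimes> v) \<in> carrier L" "\<Psi> (g \<otimes> u) \<in> carrier L" "k \<otimes>\<^bsub>L\<^esub> \<Psi> (g \<otimes> v) \<in> carrier L"
        using cl g vc uc k by auto
      have *: "\<Phi> (g \<otimes> v) \<oplus>\<^bsub>L\<^esub> k \<otimes>\<^bsub>L\<^esub> \<Psi> (g \<otimes> v) = \<Phi> (g \<otimes> v) \<oplus>\<^bsub>L\<^esub> \<Psi> (g \<otimes> u)"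
        using u(3)[OF g] insert.prems(4) g by (simp add: V_def)
      have eq: "\<Psi> (g \<otimes> u) = k \<otimes>\<^bsub>L\<^esub> \<Psi> (g \<otimes> v)"
        by (rule K.add.l_cancel[OF *[symmetric] c(2,3,1)])
      have "\<Psi> (g \<otimes> (u \<ominus> d k \<otimes> v)) = \<Psi> (g \<otimes> u) \<ominus>\<^bsub>L\<^esub> k \<otimes>\<^bsub>L\<^esub> \<Psi> (g \<otimes> v)"
        using g uc vc k gkv by (simp add: mult_diff form_diff[OF \<Psi>(1)] form_smult[OF \<Psi>(1)])
      then show ?thesis using eq c by (simp add: K.minus_eq K.r_neg)
    qed
    then have "u \<ominus> d k \<otimes> v \<in> lift I" using \<Psi>(3) ukv by (simp add: faithful_on_def)
    then have "u \<ominus> d k \<otimes> v \<in> S C" using IS by blast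
    \<comment> \<open>The difference is (k - l) v with k - l nonzero, so v already lies in the sum
      without the eigenspace of l.\<close>
    then have "(u \<ominus> d l \<otimes> v) \<ominus> (u \<ominus> d k \<otimes> v) \<in> S C" using u(2) unfolding S_def by (rule subsp_diff[OF subsp_spn, rotated])
    moreover have "(u \<ominus> d l \<otimes> v) \<ominus> (u \<ominus> d k \<otimes> v) = d (k \<ominus>\<^bsub>L\<^esub> l) \<otimes> v"
      using uc vc k l by (simp add: diff_diff_same c_diff diff_mult)
    moreover have "k \<ominus>\<^bsub>L\<^esub> l \<noteq> \<zero>\<^bsub>L\<^esub>" using k l by simp
    ultimately have "v \<in> S C" using subsp_smult_cancel[of "S C" "k \<ominus>\<^bsub>L\<^esub> l" v] k l vc by (simp add: S_def)
    then show ?case using insert by auto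
  qed
  let ?bad = "{k \<in> carrier L. \<not> faithful_on I J (\<lambda>w. \<Phi> w \<oplus>\<^bsub>L\<^esub> k \<otimes>\<^bsub>L\<^esub> \<Psi> w)}"
  have fI: "fin_codim (lift I)" by (rule fin_codim_lift[OF I(2) A.ideal_subset[OF I(1)]])
  \<comment> \<open>Every exceptional scalar contributes a vector outside the sum for the earlier
    ones, so their number is at most the codimension of \<open>lift I\<close>.\<close>
  have "card C + codim (S C) \<le> codim (lift I)" if "finite C" "C \<subseteq> ?bad" for C
    using that
  proof (induction C rule: finite_induct)
    case empty
    then show ?case using codim_mono[OF fI IS] by simp
  next
    case (insert k C)
    have k: "k \<in> carrier L" "\<not> faithful_on I J (\<lambda>w. \<Phi> w \<oplus>\<^bsub>L\<^esub> k \<otimes>\<^bsub>L\<^esub> \<Psi> w)" using insert by auto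
    then obtain v where v: "v \<in> V k" "v \<notin> lift I" by (auto simp: faithful_on_def V_def)
    have "C \<subseteq> carrier L" using insert.prems by auto
    then have "v \<notin> S C" using key[OF insert.hyps(1) _ k(1) insert.hyps(2) v(1)] v(2) by auto
    moreover have "v \<in> S (insert k C)" using VS[of k "insert k C"] v by auto
    moreover have "S C \<subseteq> S (insert k C)" unfolding S_def by (rule spn_mono) auto
    ultimately have "S C \<subset> S (insert k C)" by auto
    then have "codim (S (insert k C)) < codim (S C)"
      using codim_strict[of "S C" "S (insert k C)"] fin_codim_mono[OF fI IS] subsp_subset[OF subsp_spn]
      by (simp add: S_def)
    then show ?case using insert by auto
  qed
  then have "card C \<le> codim (lift I)" if "finite C" "C \<subseteq> ?bad" for C using that by (meson add_leD1)
  then show ?thesis using finite_if_finite_subsets_card_bdd[of ?bad "codim (lift I)"] by blast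
qed

lemma admissible_combine:
  assumes "admissible I W \<Phi>" "admissible I W \<Psi>" "k \<in> carrier L"
  shows "admissible I W (\<lambda>w. \<Phi> w \<oplus>\<^bsub>L\<^esub> k \<otimes>\<^bsub>L\<^esub> \<Psi> w)"
  using assms form_combine[of \<Phi> \<Psi> k] by (auto simp: admissible_def)

text \<open>\<Phi> + k \<Psi> is k times \<Psi> + k^-1 \<Phi>, so both have the same zeros. This
  lets \<Phi> and \<Psi> exchange roles.\<close>

lemma faithful_on_rescale:
  assumes "form \<Phi>" "form \<Psi>" "k \<in> carrier L" "k \<noteq> \<zero>\<^bsub>L\<^esub>"
    and "faithful_on I J (\<lambda>w. \<Psi> w \<oplus>\<^bsub>L\<^esub> inv\<^bsub>L\<^esub> k \<otimes>\<^bsub>L\<^esub> \<Phi> w)"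
  shows "faithful_on I J (\<lambda>w. \<Phi> w \<oplus>\<^bsub>L\<^esub> k \<otimes>\<^bsub>L\<^esub> \<Psi> w)"
proof -
  have ik: "inv\<^bsub>L\<^esub> k \<in> carrier L" "inv\<^bsub>L\<^esub> k \<otimes>\<^bsub>L\<^esub> k = \<one>\<^bsub>L\<^esub>"
    using assms(3,4) K.field_Units K.Units_l_inv[of k] K.Units_inv_closed[of k] by auto
  have "\<Psi> w \<oplus>\<^bsub>L\<^esub> inv\<^bsub>L\<^esub> k \<otimes>\<^bsub>L\<^esub> \<Phi> w = \<zero>\<^bsub>L\<^esub>"
    if w: "w \<in> carrier Q" "\<Phi> w \<oplus>\<^bsub>L\<^esub> k \<otimes>\<^bsub>L\<^esub> \<Psi> w = \<zero>\<^bsub>L\<^esub>" for w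
  proof -
    have c: "\<Phi> w \<in> carrier L" "\<Psi> w \<in> carrier L" using form_closed assms w by auto
    have "\<Psi> w \<oplus>\<^bsub>L\<^esub> inv\<^bsub>L\<^esub> k \<otimes>\<^bsub>L\<^esub> \<Phi> w = inv\<^bsub>L\<^esub> k \<otimes>\<^bsub>L\<^esub> (\<Phi> w \<oplus>\<^bsub>L\<^esub> k \<otimes>\<^bsub>L\<^esub> \<Psi> w)"
      using c ik assms(3) K.m_assoc[of "inv\<^bsub>L\<^esub> k" k "\<Psi> w"] by (simp add: K.r_distr K.a_comm)
    then show ?thesis using w ik by simp
  qed
  then show ?thesis using assms(5) lift_closed unfolding faithful_on_def by (meson m_closed)
qed

text \<open>For the new J the form \<Psi> is the faithful one, for the earlier ones it is \<Phi>. In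
  each case all but finitely many k keep the combination \<Phi> + k \<Psi> faithful, and an infinite
  field has a k that suits all.\<close>

lemma faithful_on_finitely_many:
  assumes L: "infinite (carrier L)" and I: "ideal I P" "A.fin_codim I" and JS: "finite JS"
    and "\<And>J. J \<in> JS \<Longrightarrow> ideal J P" "\<And>J. J \<in> JS \<Longrightarrow> I \<subseteq> J"
    and "\<And>J. J \<in> JS \<Longrightarrow> \<exists>\<Phi>. admissible I W \<Phi> \<and> faithful_on I J \<Phi>"
  shows "\<exists>\<Phi>. admissible I W \<Phi> \<and> (\<forall>J\<in>JS. faithful_on I J \<Phi>)"
  using JS assms(5-)
proof (induction JS rule: finite_induct)
  case empty
  have "admissible I W (\<lambda>_. \<zero>\<^bsub>L\<^esub>)" by (auto simp: admissible_def form_def)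
  then show ?case by blast
next
  case (insert J JS)
  obtain \<Phi> where \<Phi>: "admissible I W \<Phi>" "\<And>J. J \<in> JS \<Longrightarrow> faithful_on I J \<Phi>"
    using insert.IH insert.prems by (metis insertCI)
  obtain \<Psi> where \<Psi>: "admissible I W \<Psi>" "faithful_on I J \<Psi>" using insert.prems(3) by blast
  have forms: "form \<Phi>" "form \<Psi>" "\<And>v. v \<in> lift I \<Longrightarrow> \<Phi> v = \<zero>\<^bsub>L\<^esub>" "\<And>v. v \<in> lift I \<Longrightarrow> \<Psi> v = \<zero>\<^bsub>L\<^esub>"
    using \<Phi> \<Psi> by (auto simp: admissible_def)
  let ?B = "{k \<in> carrier L. \<not> faithful_on I J (\<lambda>w. \<Phi> w \<oplus>\<^bsub>L\<^esub> k \<otimes>\<^bsub>L\<^esub> \<Psi> w)}"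
  let ?C = "\<lambda>J. {k \<in> carrier L. \<not> faithful_on I J (\<lambda>w. \<Psi> w \<oplus>\<^bsub>L\<^esub> k \<otimes>\<^bsub>L\<^esub> \<Phi> w)}"
  have B: "finite ?B"
    by (rule finite_unfaithful[OF I _ _ forms(1,3,2,4) \<Psi>(2)]) (use insert.prems in auto)
  have C: "finite (?C J')" if "J' \<in> JS" for J'
    by (rule finite_unfaithful[OF I _ _ forms(2,4,1,3) \<Phi>(2)[OF that]]) (use insert.prems that in auto)
  \<comment> \<open>For the earlier ideals the exceptions concern the scalar k^-1 in front of
    \<Phi>. Their inverses are excluded for k, and so is 0.\<close>
  have "finite (?B \<union> {\<zero>\<^bsub>L\<^esub>} \<union> (\<Union>J'\<in>JS. m_inv L ` ?C J'))" using B C insert.hyps by simp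
  then obtain k where k: "k \<in> carrier L" "k \<notin> ?B \<union> {\<zero>\<^bsub>L\<^esub>} \<union> (\<Union>J'\<in>JS. m_inv L ` ?C J')"
    using L by (meson finite_subset subsetI)
  have k0: "k \<noteq> \<zero>\<^bsub>L\<^esub>" using k by simp
  have ik: "inv\<^bsub>L\<^esub> k \<in> carrier L" "inv\<^bsub>L\<^esub> (inv\<^bsub>L\<^esub> k) = k"
    using k(1) k0 K.field_Units K.Units_inv_inv[of k] K.Units_inv_closed[of k] by auto
  have "faithful_on I J' (\<lambda>w. \<Phi> w \<oplus>\<^bsub>L\<^esub> k \<otimes>\<^bsub>L\<^esub> \<Psi> w)" if J': "J' \<in> JS" for J'
  proof (rule faithful_on_rescale[OF forms(1,2) k(1) k0], rule ccontr)
    assume "\<not> faithful_on I J' (\<lambda>w. \<Psi> w \<oplus>\<^bsub>L\<^esub> inv\<^bsub>L\<^esub> k \<otimes>\<^bsub>L\<^esub> \<Phi> w)"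
    then have "inv\<^bsub>L\<^esub> k \<in> ?C J'" using ik by simp
    then have "inv\<^bsub>L\<^esub> (inv\<^bsub>L\<^esub> k) \<in> m_inv L ` ?C J'" by (rule imageI)
    then show False using k(2) J' ik(2) by auto
  qed
  moreover have "faithful_on I J (\<lambda>w. \<Phi> w \<oplus>\<^bsub>L\<^esub> k \<otimes>\<^bsub>L\<^esub> \<Psi> w)" using k by simp
  ultimately show ?case using admissible_combine[OF \<Phi>(1) \<Psi>(1) k(1)] by blast
qed

text \<open>Some x in the socle S is outside the preimage of W; separate it by a form \<psi> that
  vanishes on I and W. As S is generated modulo I by any of its elements v outside I, x is a
  multiple of v modulo I, and a translate of \<psi> is nonzero at v. Flatness carries this to
  L.\<close>

lemma faithful_on_soc:
  assumes I: "ideal I P" "A.fin_codim I" and W: "A.subsp W"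
    and gor: "A.gorenstein I" and esc: "A.ideals_escape I W" and M: "M \<in> A.max_over I"
  shows "\<exists>\<Phi>. admissible I W \<Phi> \<and> faithful_on I (A.soc I M) \<Phi>"
proof (cases "A.soc I M \<subseteq> I")
  case True
  have "admissible I W (\<lambda>_. \<zero>\<^bsub>L\<^esub>)" by (auto simp: admissible_def form_def)
  then show ?thesis using lift_mono[OF True] by (auto simp: faithful_on_def)
next
  case False
  have M': "maximalideal M P" using M by (auto simp: A.max_over_def)
  let ?S = "A.soc I M" let ?U = "A.spn (I \<union> W)"
  have S: "ideal ?S P" "I \<subseteq> ?S" using A.soc_ideal[OF I(1)] A.soc_superset[OF I(1)] A.maximal_subset[OF M'] by auto
  have sub: "I \<union> W \<subseteq> carrier P" using A.ideal_subset[OF I(1)] A.subsp_subset[OF W] by simp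
  have "I \<subset> ?S" using S False by auto
  then have "\<not> ?S \<subseteq> ?U" using esc S(1) unfolding A.ideals_escape_def by blast
  then obtain x where x: "x \<in> ?S" "x \<notin> ?U" by blast
  have xc: "x \<in> carrier P" using x A.ideal_carrier[OF S(1)] by simp
  obtain \<psi> where \<psi>: "A.form \<psi>" "\<And>u. u \<in> ?U \<Longrightarrow> \<psi> u = \<zero>\<^bsub>K\<^esub>" "\<psi> x = \<one>\<^bsub>K\<^esub>"
    using A.form_separation[OF A.subsp_spn xc x(2)] by blast
  have \<psi>0: "\<psi> u = \<zero>\<^bsub>K\<^esub>" if "u \<in> I \<union> W" for u
    using \<psi>(2) A.spn_superset[OF sub] that by blast
  have adm: "admissible I W (ext \<psi>)"
  proof -
    have "ext \<psi> v = \<zero>\<^bsub>L\<^esub>" if "v \<in> lift I \<union> lift W" for v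
      using that ext_vanishes_lift[OF \<psi>(1), of I v] ext_vanishes_lift[OF \<psi>(1), of W v] sub \<psi>0 by auto
    then show ?thesis using form_ext[OF \<psi>(1)] by (simp add: admissible_def)
  qed
  \<comment> \<open>The forms that vanish on S cut P down to S, and the translates of \<psi> cut S
    down to I. Expressing I by kernels alone makes flatness applicable.\<close>
  define F where "F = (\<lambda>g y. \<psi> (g \<otimes>\<^bsub>P\<^esub> y)) ` carrier P \<union> {\<Psi>. A.form \<Psi> \<and> (\<forall>u\<in>?S. \<Psi> u = \<zero>\<^bsub>K\<^esub>)}"
  have Fform: "A.form \<Psi>" if "\<Psi> \<in> F" for \<Psi>
    using that A.form_translate[OF \<psi>(1)] by (auto simp: F_def)
  have N: "carrier P \<inter> \<Inter>(A.ker ` F) = I"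
  proof
    show "I \<subseteq> carrier P \<inter> \<Inter>(A.ker ` F)"
      using A.ideal_carrier[OF I(1)] A.ideal_lmult[OF I(1)] \<psi>0 S(2) by (auto simp: F_def A.ker_def)
    show "carrier P \<inter> \<Inter>(A.ker ` F) \<subseteq> I"
    proof
      fix v assume v: "v \<in> carrier P \<inter> \<Inter>(A.ker ` F)"
      then have vc: "v \<in> carrier P" and v0: "\<And>\<Psi>. \<Psi> \<in> F \<Longrightarrow> \<Psi> v = \<zero>\<^bsub>K\<^esub>" by (auto simp: A.ker_def)
      have vS: "v \<in> ?S"
      proof (rule ccontr)
        assume "v \<notin> ?S"
        then obtain \<Psi> where "A.form \<Psi>" "\<And>u. u \<in> ?S \<Longrightarrow> \<Psi> u = \<zero>\<^bsub>K\<^esub>" "\<Psi> v = \<one>\<^bsub>K\<^esub>"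
          using A.form_separation[OF A.subsp_ideal[OF S(1)] vc] by blast
        then show False using v0[of \<Psi>] by (auto simp: F_def)
      qed
      show "v \<in> I"
      proof (rule ccontr)
        assume "v \<notin> I"
        then have "x \<in> A.adj I v" using gor M vS x(1) by (auto simp: A.gorenstein_def)
        then obtain i a where ia: "i \<in> I" "a \<in> carrier P" "x = i \<oplus>\<^bsub>P\<^esub> a \<otimes>\<^bsub>P\<^esub> v" by (auto simp: A.adj_def)
        have "(\<lambda>y. \<psi> (a \<otimes>\<^bsub>P\<^esub> y)) \<in> F" using ia by (simp add: F_def)
        then have "\<psi> (a \<otimes>\<^bsub>P\<^esub> v) = \<zero>\<^bsub>K\<^esub>" using v0 by blast
        then have "\<psi> x = \<zero>\<^bsub>K\<^esub>"
          using ia \<psi>0 vc A.ideal_carrier[OF I(1)] by (simp add: A.form_add[OF \<psi>(1)])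
        then show False using \<psi>(3) by simp
      qed
    qed
  qed
  have "v \<in> lift I" if v: "v \<in> lift ?S" "\<And>g. g \<in> carrier Q \<Longrightarrow> ext \<psi> (g \<otimes> v) = \<zero>\<^bsub>L\<^esub>" for v
  proof -
    have vc: "v \<in> carrier Q" using v(1) lift_closed by auto
    have "ext \<Psi> v = \<zero>\<^bsub>L\<^esub>" if "\<Psi> \<in> F" for \<Psi>
      using that unfolding F_def
    proof
      assume "\<Psi> \<in> (\<lambda>g y. \<psi> (g \<otimes>\<^bsub>P\<^esub> y)) ` carrier P"
      then obtain g where g: "g \<in> carrier P" "\<Psi> = (\<lambda>y. \<psi> (g \<otimes>\<^bsub>P\<^esub> y))" by auto
      then show ?thesis using ext_translate[OF \<psi>(1) g(1) vc] v(2) by simp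
    next
      assume "\<Psi> \<in> {\<Psi>. A.form \<Psi> \<and> (\<forall>u\<in>?S. \<Psi> u = \<zero>\<^bsub>K\<^esub>)}"
      then show ?thesis using ext_vanishes_lift[of \<Psi> ?S v] A.ideal_subset[OF S(1)] v(1) by auto
    qed
    then show ?thesis using flat[of F v, OF Fform vc] N I(2) by simp
  qed
  then have "faithful_on I ?S (ext \<psi>)" by (simp add: faithful_on_def)
  then show ?thesis using adm by blast
qed

text \<open>I : M is the common kernel of the forms v \<mapsto> \<Psi>(m v) with m in M and \<Psi>
  vanishing on I. By flatness the extended forms have the common kernel
  \<open>lift (A.soc I M)\<close>.\<close>

lemma in_lift_soc:
  assumes I: "ideal I P" "A.fin_codim I" and M: "M \<subseteq> carrier P"
    and w: "w \<in> carrier Q" "\<And>m. m \<in> M \<Longrightarrow> \<eta> m \<otimes> w \<in> lift I"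
  shows "w \<in> lift (A.soc I M)"
proof -
  define G where "G = {\<Psi>. A.form \<Psi> \<and> (\<forall>u\<in>I. \<Psi> u = \<zero>\<^bsub>K\<^esub>)}"
  define F where "F = (\<lambda>(m, \<Psi>) y. \<Psi> (m \<otimes>\<^bsub>P\<^esub> y)) ` (M \<times> G)"
  have Fform: "A.form \<Psi>" if "\<Psi> \<in> F" for \<Psi>
    using that A.form_translate M by (auto simp: F_def G_def)
  have N: "carrier P \<inter> \<Inter>(A.ker ` F) = A.soc I M"
  proof
    show "A.soc I M \<subseteq> carrier P \<inter> \<Inter>(A.ker ` F)" by (auto simp: F_def G_def A.ker_def A.soc_def)
    show "carrier P \<inter> \<Inter>(A.ker ` F) \<subseteq> A.soc I M"
    proof
      fix v assume v: "v \<in> carrier P \<inter> \<Inter>(A.ker ` F)"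
      have "m \<otimes>\<^bsub>P\<^esub> v \<in> I" if m: "m \<in> M" for m
      proof (rule ccontr)
        assume "m \<otimes>\<^bsub>P\<^esub> v \<notin> I"
        moreover have "m \<otimes>\<^bsub>P\<^esub> v \<in> carrier P" using m M v by auto
        ultimately obtain \<Psi> where \<Psi>: "A.form \<Psi>" "\<And>u. u \<in> I \<Longrightarrow> \<Psi> u = \<zero>\<^bsub>K\<^esub>" "\<Psi> (m \<otimes>\<^bsub>P\<^esub> v) = \<one>\<^bsub>K\<^esub>"
          using A.form_separation[OF A.subsp_ideal[OF I(1)]] by blast
        have "(\<lambda>y. \<Psi> (m \<otimes>\<^bsub>P\<^esub> y)) \<in> F"
          unfolding F_def by (rule image_eqI[of _ _ "(m, \<Psi>)"]) (use m \<Psi> in \<open>auto simp: G_def\<close>)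
        then have "v \<in> A.ker (\<lambda>y. \<Psi> (m \<otimes>\<^bsub>P\<^esub> y))" using v by blast
        then show False using \<Psi>(3) by (simp add: A.ker_def)
      qed
      then show "v \<in> A.soc I M" using v by (simp add: A.soc_def)
    qed
  qed
  have "A.fin_codim (A.soc I M)" using A.fin_codim_mono[OF I(2) A.soc_superset[OF I(1) M]] .
  moreover have "ext \<Theta> w = \<zero>\<^bsub>L\<^esub>" if in_F: "\<Theta> \<in> F" for \<Theta>
  proof -
    obtain p where "\<Theta> = (\<lambda>(m, \<Psi>) y. \<Psi> (m \<otimes>\<^bsub>P\<^esub> y)) p" "p \<in> M \<times> G"
      using in_F unfolding F_def by (rule imageE)
    then obtain m \<Psi> where "m \<in> M" "\<Psi> \<in> G" and \<Theta>: "\<Theta> = (\<lambda>y. \<Psi> (m \<otimes>\<^bsub>P\<^esub> y))" by auto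
    then have m: "m \<in> M" "A.form \<Psi>" "\<And>u. u \<in> I \<Longrightarrow> \<Psi> u = \<zero>\<^bsub>K\<^esub>" by (auto simp: G_def)
    have mc: "m \<in> carrier P" using m M by auto
    show ?thesis
      using ext_translate[OF m(2) mc w(1)] ext_vanishes_lift[OF m(2) A.ideal_subset[OF I(1)] m(3) w(2)[OF m(1)]] \<Theta>
      by simp
  qed
  ultimately show ?thesis using flat[of F w, OF Fform w(1)] N by simp
qed

text \<open>The lifted socles are essential in R_L. Maximal ideals over L are avoided by induction
  along ideals of P: pass from I to a minimal J above it, whose quotient J/I is killed by a maximal
  ideal over I.\<close>

lemma multiple_in_lift_soc:
  assumes "ideal I P" "A.fin_codim I" "v \<in> carrier Q" "v \<notin> lift I"
  shows "\<exists>M\<in>A.max_over I. \<exists>g\<in>carrier Q. g \<otimes> v \<notin> lift I \<and> (\<forall>m\<in>M. \<eta> m \<otimes> (g \<otimes> v) \<in> lift I)"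
  using assms
proof (induction "A.codim I" arbitrary: I rule: less_induct)
  case less
  note I = less.prems(1,2)
  have "I \<noteq> carrier P" using less.prems lift_carrier by auto
  then have "I \<subset> carrier P" using A.ideal_subset[OF I(1)] by auto
  then obtain J where J: "A.minimal_over I J" using A.minimal_over_exists[OF I A.oneideal] by blast
  have J': "ideal J P" "I \<subset> J" using J by (auto simp: A.minimal_over_def)
  obtain f where f: "f \<in> J" "f \<notin> I" using J' by auto
  let ?M = "A.colon I f"
  have M: "?M \<in> A.max_over I" "J \<subseteq> A.soc I ?M" using A.minimal_over_maximal[OF I(1) J f] by auto
  have Mc: "?M \<subseteq> carrier P" using M A.maximal_subset by (auto simp: A.max_over_def)
  have MJ: "\<eta> m \<otimes> w \<in> lift I" if "m \<in> ?M" "w \<in> lift J" for m w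
    by (rule lift_mult[OF _ A.ideal_subset[OF J'(1)] _ that(2)]) (use that(1) M(2) Mc in \<open>auto simp: A.soc_def\<close>)
  show ?case
  proof (cases "v \<in> lift J")
    case True
    show ?thesis
      by (rule bexI[OF _ M(1)], rule bexI[of _ \<one>]) (use less.prems MJ[OF _ True] in auto)
  next
    case False
    have "A.codim J < A.codim I" using A.codim_strict[OF A.subsp_ideal[OF I(1)] I(2) J'(2) A.ideal_subset[OF J'(1)]] .
    moreover have "A.fin_codim J" by (rule A.fin_codim_mono[OF I(2)]) (use J' in auto)
    ultimately obtain M' g
      where M': "M' \<in> A.max_over J" and g: "g \<in> carrier Q" "g \<otimes> v \<notin> lift J" "\<And>m. m \<in> M' \<Longrightarrow> \<eta> m \<otimes> (g \<otimes> v) \<in> lift J"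
      using less.hyps[OF _ J'(1) _ less.prems(3) False] by blast
    show ?thesis
    proof (cases "\<forall>m\<in>M'. \<eta> m \<otimes> (g \<otimes> v) \<in> lift I")
      case True
      have "M' \<in> A.max_over I" using M' J' by (auto simp: A.max_over_def)
      moreover have "g \<otimes> v \<notin> lift I" using g lift_mono[of I J] J' by auto
      ultimately show ?thesis using True g(1) by blast
    next
      case False
      \<comment> \<open>The further multiple by m is in J \<otimes> L but not in I \<otimes> L, so
        the maximal ideal that kills J/I serves for it.\<close>
      then obtain m where m: "m \<in> M'" "\<eta> m \<otimes> (g \<otimes> v) \<notin> lift I" by auto
      have mc: "m \<in> carrier P" using m M' A.maximal_subset by (auto simp: A.max_over_def)
      then have eq: "(\<eta> m \<otimes> g) \<otimes> v = \<eta> m \<otimes> (g \<otimes> v)" using g less.prems(3) by (simp add: m_assoc)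
      show ?thesis
        by (rule bexI[OF _ M(1)], rule bexI[of _ "\<eta> m \<otimes> g"])
          (use eq m mc g MJ[OF _ g(3)[OF m(1)]] in auto)
    qed
  qed
qed

text \<open>A form faithful on every lifted socle is faithful everywhere: a counterexample v outside
  \<open>lift I\<close> would have a multiple outside \<open>lift I\<close> in one of these socles,
  again a counterexample.\<close>

lemma faithful_form_exists:
  assumes L: "infinite (carrier L)" and I: "ideal I P" "A.fin_codim I" and W: "A.subsp W"
    and "A.gorenstein I" "A.ideals_escape I W"
  shows "\<exists>\<Phi>. admissible I W \<Phi> \<and> faithful_on I (carrier P) \<Phi>"
proof -
  let ?X = "A.soc I ` A.max_over I"
  have Mc: "M \<subseteq> carrier P" if "M \<in> A.max_over I" for M
    using that A.maximal_subset by (auto simp: A.max_over_def)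
  have "\<exists>\<Phi>. admissible I W \<Phi> \<and> (\<forall>J\<in>?X. faithful_on I J \<Phi>)"
  proof (rule faithful_on_finitely_many[OF L I])
    show "finite ?X" using A.finite_max_over[OF I] by simp
    fix J assume "J \<in> ?X"
    then obtain M where M: "M \<in> A.max_over I" "J = A.soc I M" by blast
    show "ideal J P" "I \<subseteq> J" "\<exists>\<Phi>. admissible I W \<Phi> \<and> faithful_on I J \<Phi>"
      using M(2) A.soc_ideal[OF I(1) Mc[OF M(1)]] A.soc_superset[OF I(1) Mc[OF M(1)]]
        faithful_on_soc[OF I W assms(5,6) M(1)] by blast+
  qed
  then obtain \<Phi> where \<Phi>: "admissible I W \<Phi>" "\<And>M. M \<in> A.max_over I \<Longrightarrow> faithful_on I (A.soc I M) \<Phi>" by blast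
  have "v \<in> lift I" if v: "v \<in> carrier Q" "\<And>g. g \<in> carrier Q \<Longrightarrow> \<Phi> (g \<otimes> v) = \<zero>\<^bsub>L\<^esub>" for v
  proof (rule ccontr)
    assume "v \<notin> lift I"
    then obtain M g where M: "M \<in> A.max_over I" and g: "g \<in> carrier Q" "g \<otimes> v \<notin> lift I"
        "\<And>m. m \<in> M \<Longrightarrow> \<eta> m \<otimes> (g \<otimes> v) \<in> lift I"
      using multiple_in_lift_soc[OF I v(1)] by blast
    have "g \<otimes> v \<in> lift (A.soc I M)" by (rule in_lift_soc[OF I Mc[OF M] _ g(3)]) (use g v in auto)
    moreover have "\<Phi> (g' \<otimes> (g \<otimes> v)) = \<zero>\<^bsub>L\<^esub>" if "g' \<in> carrier Q" for g'
      using v(2)[of "g' \<otimes> g"] that g(1) v(1) by (simp add: m_assoc)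
    ultimately show False using \<Phi>(2)[OF M] g(2) by (simp add: faithful_on_def)
  qed
  then show ?thesis using \<Phi>(1) lift_carrier by (auto simp: faithful_on_def)
qed

end

section \<open>Polynomial rings\<close>

lemma finite_subseteq_mset: "finite {u. u \<subseteq># m}"
proof (induction m)
  case (add x m)
  have "{u. u \<subseteq># add_mset x m} \<subseteq> {u. u \<subseteq># m} \<union> add_mset x ` {u. u \<subseteq># m}"
  proof
    fix u assume u: "u \<in> {u. u \<subseteq># add_mset x m}"
    show "u \<in> {u. u \<subseteq># m} \<union> add_mset x ` {u. u \<subseteq># m}"
    proof (cases "x \<in># u")
      case True
      then obtain v where "u = add_mset x v" by (meson multi_member_split)
      then show ?thesis using u by auto
    next
      case False
      then show ?thesis using u by (auto simp: subset_mset.le_iff_sup subseteq_mset_def split: if_splits)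
    qed
  qed
  then show ?case using add finite_subset by blast
qed simp

section \<open>Monomials and supports\<close>

definition monomials :: "nat \<Rightarrow> nat multiset set" where
  "monomials n = {m. set_mset m \<subseteq> {..<n}}"

definition (in ring) monom_fun :: "'a \<Rightarrow> nat multiset \<Rightarrow> nat multiset \<Rightarrow> 'a" where
  "monom_fun k m = (\<lambda>m'. if m' = m then k else \<zero>)"

context ring
begin

lemma monom_fun_add_mset: "monom_fun k (add_mset i m) = indexed_pmult (monom_fun k m) i"
  by (auto simp: monom_fun_def indexed_pmult_def fun_eq_iff dest: multi_member_split)

lemma indexed_const_eq: "indexed_const k = monom_fun k {#}"
  by (auto simp: monom_fun_def indexed_const_def)

lemma monom_fun_in: "\<lbrakk>m \<in> monomials n; k \<in> carrier R\<rbrakk> \<Longrightarrow> monom_fun k m \<in> indexed_pset {..<n} (carrier R)"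
proof (induction m)
  case empty
  then show ?case using indexed_const[of k "carrier R" "{..<n}"] by (simp add: indexed_const_eq)
next
  case (add x m)
  then show ?case using indexed_pmult[of "monom_fun k m"] by (auto simp: monom_fun_add_mset monomials_def)
qed

lemma indexed_pset_support:
  assumes "f \<in> indexed_pset {..<n} (carrier R)"
  shows "(\<forall>m. f m \<in> carrier R) \<and> finite {m. f m \<noteq> \<zero>} \<and> {m. f m \<noteq> \<zero>} \<subseteq> monomials n"
  using assms
proof induction
  case (indexed_const k)
  have "{m. indexed_const k m \<noteq> \<zero>} \<subseteq> {{#}}" by (auto simp: indexed_const_def)
  then show ?case using indexed_const finite_subset[of _ "{{#}}"]
    by (auto simp: indexed_const_def monomials_def)
next
  case (indexed_padd P Q)
  have "{m. (indexed_padd P Q) m \<noteq> \<zero>} \<subseteq> {m. P m \<noteq> \<zero>} \<union> {m. Q m \<noteq> \<zero>}"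
    by (auto simp: indexed_padd_def)
  then show ?case using indexed_padd.IH finite_subset[OF _ finite_UnI]
    by (auto simp: indexed_padd_def)
next
  case (indexed_pmult P i)
  have sub: "{m. (indexed_pmult P i) m \<noteq> \<zero>} \<subseteq> add_mset i ` {m. P m \<noteq> \<zero>}"
    by (auto simp: indexed_pmult_def split: if_splits dest!: multi_member_split)
  moreover have "add_mset i ` {m. P m \<noteq> \<zero>} \<subseteq> monomials n"
  proof
    fix m assume "m \<in> add_mset i ` {m. P m \<noteq> \<zero>}"
    then obtain m' where "m = add_mset i m'" "m' \<in> monomials n" using indexed_pmult.IH by blast
    then show "m \<in> monomials n" using indexed_pmult.hyps by (auto simp: monomials_def)
  qed
  ultimately have "{m. (indexed_pmult P i) m \<noteq> \<zero>} \<subseteq> monomials n" by (rule subset_trans)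
  moreover have "finite {m. (indexed_pmult P i) m \<noteq> \<zero>}"
    by (rule finite_subset[OF sub]) (use indexed_pmult in auto)
  ultimately show ?case using indexed_pmult.IH by (auto simp: indexed_pmult_def)
qed

text \<open>Terms are added one at a time. The finite set S that bounds the support stays fixed, so
  that conditions on the monomials of f are available in the induction step.\<close>

lemma indexed_pset_induct [consumes 4, case_names zero add]:
  assumes "\<And>m. f m \<in> carrier R" "finite S" "S \<subseteq> monomials n" "{m. f m \<noteq> \<zero>} \<subseteq> S"
    and "T (\<lambda>_. \<zero>)"
    and "\<And>f k m. \<lbrakk>T f; \<And>m. f m \<in> carrier R; finite {m. f m \<noteq> \<zero>}; {m. f m \<noteq> \<zero>} \<subseteq> S; k \<in> carrier R; m \<in> S\<rbrakk>
      \<Longrightarrow> T (indexed_padd f (monom_fun k m))"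
  shows "T f"
proof -
  have "T f" if "finite B" "\<And>m. f m \<in> carrier R" "{m. f m \<noteq> \<zero>} \<subseteq> B" "B \<subseteq> S" for B f
    using that
  proof (induction B arbitrary: f rule: finite_induct)
    case empty
    then have "f = (\<lambda>_. \<zero>)" by auto
    then show ?case using assms(5) by simp
  next
    case (insert m B)
    let ?g = "f(m := \<zero>)"
    have eq: "indexed_padd ?g (monom_fun (f m) m) = f"
      using insert.prems by (auto simp: indexed_padd_def monom_fun_def fun_eq_iff)
    have sub: "{m. ?g m \<noteq> \<zero>} \<subseteq> B" using insert.prems by auto
    have c: "\<And>m. ?g m \<in> carrier R" using insert.prems by auto
    have fin: "finite {m. ?g m \<noteq> \<zero>}" by (rule finite_subset[OF sub insert.hyps(1)])
    have subS: "{m. ?g m \<noteq> \<zero>} \<subseteq> S" using sub insert.prems by blast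
    have "T ?g" by (rule insert.IH[OF c sub]) (use insert in auto)
    then have "T (indexed_padd ?g (monom_fun (f m) m))"
      by (rule assms(6)[OF _ c fin subS]) (use insert.prems in auto)
    then show ?case using eq by simp
  qed
  then show ?thesis using assms(1-4) by blast
qed

text \<open>A finitely supported function is the finite sum of its terms. This trades the inductive
  generation of polynomials for conditions on coefficients.\<close>

lemma indexed_pset_iff:
  "f \<in> indexed_pset {..<n} (carrier R) \<longleftrightarrow>
    (\<forall>m. f m \<in> carrier R) \<and> finite {m. f m \<noteq> \<zero>} \<and> {m. f m \<noteq> \<zero>} \<subseteq> monomials n"
proof
  assume "(\<forall>m. f m \<in> carrier R) \<and> finite {m. f m \<noteq> \<zero>} \<and> {m. f m \<noteq> \<zero>} \<subseteq> monomials n"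
  then have "\<And>m. f m \<in> carrier R" "finite {m. f m \<noteq> \<zero>}" "{m. f m \<noteq> \<zero>} \<subseteq> monomials n" "{m. f m \<noteq> \<zero>} \<subseteq> {m. f m \<noteq> \<zero>}"
    by auto
  then show "f \<in> indexed_pset {..<n} (carrier R)"
  proof (induction rule: indexed_pset_induct)
    case zero
    then show ?case using indexed_const[of \<zero> "carrier R"] by (simp add: indexed_zero_def)
  next
    case (add g k m)
    then show ?case using \<open>{m. f m \<noteq> \<zero>} \<subseteq> monomials n\<close> by (intro indexed_padd monom_fun_in) auto
  qed
qed (rule indexed_pset_support)

end

context cring
begin

section \<open>The product of polynomials and the ring laws\<close>

lemma mpoly_mult_closed: "\<lbrakk>\<And>m. f m \<in> carrier R; \<And>m. g m \<in> carrier R\<rbrakk> \<Longrightarrow> mpoly_mult R f g m \<in> carrier R"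
  by (auto simp: mpoly_mult_def intro!: finsum_closed)

text \<open>The substitution u \<mapsto> m - u is an involution of the divisors of m.\<close>

lemma mpoly_mult_comm:
  assumes "\<And>m. f m \<in> carrier R" "\<And>m. g m \<in> carrier R"
  shows "mpoly_mult R f g = mpoly_mult R g f"
proof
  fix m :: "nat multiset"
  have im: "(\<lambda>u. m - u) ` {u. u \<subseteq># m} = {u. u \<subseteq># m}"
  proof
    show "{u. u \<subseteq># m} \<subseteq> (\<lambda>u. m - u) ` {u. u \<subseteq># m}"
    proof
      fix u assume "u \<in> {u. u \<subseteq># m}"
      then have "u = m - (m - u)" "m - u \<subseteq># m" by (auto simp: subset_mset.diff_diff_right)
      then show "u \<in> (\<lambda>u. m - u) ` {u. u \<subseteq># m}" by auto
    qed
  qed auto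
  have inj: "inj_on (\<lambda>u. m - u) {u. u \<subseteq># m}"
    by (rule inj_onI) (metis mem_Collect_eq subset_mset.diff_diff_right subset_mset.add_diff_inverse add_diff_cancel_left' add_diff_cancel_right' subset_mset.diff_add)
  have "mpoly_mult R g f m = (\<Oplus>u\<in>(\<lambda>u. m - u) ` {u. u \<subseteq># m}. g u \<otimes> f (m - u))"
    unfolding im by (simp add: mpoly_mult_def)
  also have "\<dots> = (\<Oplus>u\<in>{u. u \<subseteq># m}. g (m - u) \<otimes> f (m - (m - u)))"
    by (rule finsum_reindex[OF _ inj]) (use assms in auto)
  also have "\<dots> = mpoly_mult R f g m"
    unfolding mpoly_mult_def
    by (rule finsum_cong') (use assms in \<open>auto simp: subset_mset.diff_diff_right m_comm\<close>)
  finally show "mpoly_mult R f g m = mpoly_mult R g f m" by simp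
qed

lemma mpoly_mult_add:
  assumes "\<And>m. f m \<in> carrier R" "\<And>m. g m \<in> carrier R" "\<And>m. k m \<in> carrier R"
  shows "mpoly_mult R (indexed_padd f g) k = indexed_padd (mpoly_mult R f k) (mpoly_mult R g k)"
proof
  fix m :: "nat multiset"
  have "mpoly_mult R (indexed_padd f g) k m = (\<Oplus>u\<in>{u. u \<subseteq># m}. f u \<otimes> k (m - u) \<oplus> g u \<otimes> k (m - u))"
    unfolding mpoly_mult_def by (rule finsum_cong') (use assms in \<open>auto simp: indexed_padd_def l_distr\<close>)
  also have "\<dots> = mpoly_mult R f k m \<oplus> mpoly_mult R g k m"
    unfolding mpoly_mult_def by (rule finsum_addf) (use assms in auto)
  finally show "mpoly_mult R (indexed_padd f g) k m = indexed_padd (mpoly_mult R f k) (mpoly_mult R g k) m"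
    by (simp add: indexed_padd_def)
qed

lemma mpoly_mult_const:
  assumes "k \<in> carrier R" "\<And>m. f m \<in> carrier R"
  shows "mpoly_mult R (indexed_const k) f = (\<lambda>m. k \<otimes> f m)"
proof
  fix m :: "nat multiset"
  have "mpoly_mult R (indexed_const k) f m = (\<Oplus>u\<in>{u. u \<subseteq># m}. if {#} = u then k \<otimes> f (m - u) else \<zero>)"
    unfolding mpoly_mult_def by (rule finsum_cong') (use assms in \<open>auto simp: indexed_const_def\<close>)
  also have "\<dots> = k \<otimes> f (m - {#})"
    by (rule finsum_singleton) (use assms finite_subseteq_mset in auto)
  finally show "mpoly_mult R (indexed_const k) f m = k \<otimes> f m" by simp
qed

lemma mpoly_mult_scale:
  assumes "k \<in> carrier R" "\<And>m. f m \<in> carrier R" "\<And>m. g m \<in> carrier R"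
  shows "mpoly_mult R (\<lambda>m. k \<otimes> f m) g = (\<lambda>m. k \<otimes> mpoly_mult R f g m)"
proof
  fix m :: "nat multiset"
  have "mpoly_mult R (\<lambda>m. k \<otimes> f m) g m = (\<Oplus>u\<in>{u. u \<subseteq># m}. k \<otimes> (f u \<otimes> g (m - u)))"
    unfolding mpoly_mult_def by (rule finsum_cong') (use assms in \<open>auto simp: m_assoc\<close>)
  also have "\<dots> = k \<otimes> mpoly_mult R f g m"
    unfolding mpoly_mult_def
    by (rule finsum_rdistr[symmetric]) (use assms finite_subseteq_mset in auto)
  finally show "mpoly_mult R (\<lambda>m. k \<otimes> f m) g m = k \<otimes> mpoly_mult R f g m" .
qed

text \<open>Only divisors of m that contain i contribute, and these are i times the divisors of m
  with one i removed.\<close>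

lemma mpoly_mult_pmult:
  assumes "\<And>m. f m \<in> carrier R" "\<And>m. g m \<in> carrier R"
  shows "mpoly_mult R (indexed_pmult f i) g = indexed_pmult (mpoly_mult R f g) i"
proof
  fix m :: "nat multiset"
  have c: "indexed_pmult f i u \<in> carrier R" for u using assms by (simp add: indexed_pmult_def)
  show "mpoly_mult R (indexed_pmult f i) g m = indexed_pmult (mpoly_mult R f g) i m"
  proof (cases "i \<in># m")
    case False
    have "mpoly_mult R (indexed_pmult f i) g m = (\<Oplus>u\<in>{u. u \<subseteq># m}. \<zero>)"
      unfolding mpoly_mult_def
      by (rule finsum_cong') (use assms False in \<open>auto simp: indexed_pmult_def dest: mset_subset_eqD\<close>)
    then show ?thesis using False by (simp add: indexed_pmult_def)
  next
    case True
    then obtain m' where m': "m = add_mset i m'" by (meson multi_member_split)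
    have "mpoly_mult R (indexed_pmult f i) g m
        = (\<Oplus>u\<in>add_mset i ` {u. u \<subseteq># m'}. indexed_pmult f i u \<otimes> g (m - u))"
      unfolding mpoly_mult_def
    proof (rule add.finprod_mono_neutral_cong_left[symmetric])
      show "finite {u. u \<subseteq># m}" by (rule finite_subseteq_mset)
      show "add_mset i ` {u. u \<subseteq># m'} \<subseteq> {u. u \<subseteq># m}" using m' by auto
      fix u assume u: "u \<in> {u. u \<subseteq># m} - add_mset i ` {u. u \<subseteq># m'}"
      have "i \<notin># u"
      proof
        assume "i \<in># u"
        then obtain v where "u = add_mset i v" by (meson multi_member_split)
        then show False using u m' by auto
      qed
      then show "indexed_pmult f i u \<otimes> g (m - u) = \<zero>" using assms by (simp add: indexed_pmult_def)
    qed (use c assms in auto)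
    also have "\<dots> = (\<Oplus>u\<in>{u. u \<subseteq># m'}. indexed_pmult f i (add_mset i u) \<otimes> g (m - add_mset i u))"
      by (rule finsum_reindex) (use c assms in \<open>auto simp: inj_on_def\<close>)
    also have "\<dots> = mpoly_mult R f g m'"
      unfolding mpoly_mult_def m' by (rule finsum_cong') (use assms in \<open>auto simp: indexed_pmult_def\<close>)
    finally show ?thesis using m' by (simp add: indexed_pmult_def)
  qed
qed

lemma mpoly_mult_in:
  assumes f: "f \<in> indexed_pset {..<n} (carrier R)" and g: "g \<in> indexed_pset {..<n} (carrier R)"
  shows "mpoly_mult R f g \<in> indexed_pset {..<n} (carrier R)"
proof -
  have gc: "\<And>m. g m \<in> carrier R" using g by (simp add: indexed_pset_iff)
  show ?thesis using f
  proof induction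
    case (indexed_const k)
    have "{m. k \<otimes> g m \<noteq> \<zero>} \<subseteq> {m. g m \<noteq> \<zero>}" using indexed_const by auto
    then show ?case using g indexed_const gc
      by (auto simp: mpoly_mult_const indexed_pset_iff intro: finite_subset)
  next
    case (indexed_padd P Q)
    have "\<And>m. P m \<in> carrier R" "\<And>m. Q m \<in> carrier R" using indexed_padd by (auto simp: indexed_pset_iff)
    then show ?case
      using indexed_pset.indexed_padd[OF indexed_padd.IH] by (simp add: mpoly_mult_add gc)
  next
    case (indexed_pmult P i)
    have "\<And>m. P m \<in> carrier R" using indexed_pmult by (auto simp: indexed_pset_iff)
    then show ?case
      using indexed_pset.indexed_pmult[OF indexed_pmult.IH indexed_pmult.hyps(2)] by (simp add: mpoly_mult_pmult gc)
  qed
qed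

text \<open>Polynomials are generated by constants, sums and multiplication by variables, and the
  product respects each of these in its first argument. Induction on f thus avoids double
  sums.\<close>

lemma mpoly_mult_assoc:
  assumes f: "f \<in> indexed_pset {..<n} (carrier R)"
    and g: "\<And>m. g m \<in> carrier R" and k: "\<And>m. k m \<in> carrier R"
  shows "mpoly_mult R (mpoly_mult R f g) k = mpoly_mult R f (mpoly_mult R g k)"
  using f
proof induction
  case (indexed_const l)
  then show ?case using g k by (simp add: mpoly_mult_const mpoly_mult_closed mpoly_mult_scale)
next
  case (indexed_padd P Q)
  have c: "\<And>m. P m \<in> carrier R" "\<And>m. Q m \<in> carrier R"
    using indexed_padd by (auto simp: indexed_pset_iff)
  show ?case
    using indexed_padd.IH c g k by (simp add: mpoly_mult_add mpoly_mult_closed)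
next
  case (indexed_pmult P i)
  have c: "\<And>m. P m \<in> carrier R"
    using indexed_pmult by (auto simp: indexed_pset_iff)
  show ?case
    using indexed_pmult.IH c g k by (simp add: mpoly_mult_pmult mpoly_mult_closed)
qed

lemma mpoly_ring_simps [simp]:
  "carrier (mpoly_ring R n) = indexed_pset {..<n} (carrier R)"
  "f \<otimes>\<^bsub>mpoly_ring R n\<^esub> g = mpoly_mult R f g"
  "\<one>\<^bsub>mpoly_ring R n\<^esub> = indexed_const \<one>"
  "\<zero>\<^bsub>mpoly_ring R n\<^esub> = (\<lambda>_. \<zero>)"
  "f \<oplus>\<^bsub>mpoly_ring R n\<^esub> g = indexed_padd f g"
  by (simp_all add: mpoly_ring_def indexed_zero_def)

lemma mpoly_cring: "cring (mpoly_ring R n)"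
proof (rule cringI)
  have zero: "(\<lambda>_. \<zero>) \<in> indexed_pset {..<n} (carrier R)"
    using indexed_const[of \<zero> "carrier R"] by (simp add: indexed_zero_def)
  show "abelian_group (mpoly_ring R n)"
  proof (rule abelian_groupI)
    fix f assume f: "f \<in> carrier (mpoly_ring R n)"
    then have fc: "\<And>m. f m \<in> carrier R" by (simp add: indexed_pset_iff)
    have "{m. \<ominus> f m \<noteq> \<zero>} \<subseteq> {m. f m \<noteq> \<zero>}" by auto
    then have "(\<lambda>m. \<ominus> f m) \<in> carrier (mpoly_ring R n)"
      using f by (auto simp: indexed_pset_iff intro: finite_subset)
    moreover have "indexed_padd (\<lambda>m. \<ominus> f m) f = (\<lambda>_. \<zero>)" using fc by (simp add: indexed_padd_def l_neg)
    ultimately show "\<exists>g\<in>carrier (mpoly_ring R n). g \<oplus>\<^bsub>mpoly_ring R n\<^esub> f = \<zero>\<^bsub>mpoly_ring R n\<^esub>"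
      by (intro bexI[of _ "\<lambda>m. \<ominus> f m"]) auto
    show "\<zero>\<^bsub>mpoly_ring R n\<^esub> \<oplus>\<^bsub>mpoly_ring R n\<^esub> f = f" using fc by (simp add: indexed_padd_def)
  next
    fix f g assume f: "f \<in> carrier (mpoly_ring R n)" "g \<in> carrier (mpoly_ring R n)"
    then have fc: "\<And>m. f m \<in> carrier R" "\<And>m. g m \<in> carrier R" by (auto simp: indexed_pset_iff)
    show "f \<oplus>\<^bsub>mpoly_ring R n\<^esub> g \<in> carrier (mpoly_ring R n)" using f indexed_pset.indexed_padd by simp
    show "f \<oplus>\<^bsub>mpoly_ring R n\<^esub> g = g \<oplus>\<^bsub>mpoly_ring R n\<^esub> f" using fc by (simp add: indexed_padd_def a_comm)
    fix k assume "k \<in> carrier (mpoly_ring R n)"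
    then have "\<And>m. k m \<in> carrier R" by (simp add: indexed_pset_iff)
    then show "f \<oplus>\<^bsub>mpoly_ring R n\<^esub> g \<oplus>\<^bsub>mpoly_ring R n\<^esub> k = f \<oplus>\<^bsub>mpoly_ring R n\<^esub> (g \<oplus>\<^bsub>mpoly_ring R n\<^esub> k)"
      using fc by (simp add: indexed_padd_def a_assoc)
  qed (use zero in simp)
  show "Group.comm_monoid (mpoly_ring R n)"
  proof (rule comm_monoidI)
    fix f g k assume f: "f \<in> carrier (mpoly_ring R n)" and g: "g \<in> carrier (mpoly_ring R n)"
    then have fc: "\<And>m. f m \<in> carrier R" "\<And>m. g m \<in> carrier R" by (auto simp: indexed_pset_iff)
    show "f \<otimes>\<^bsub>mpoly_ring R n\<^esub> g \<in> carrier (mpoly_ring R n)" using f g mpoly_mult_in by simp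
    show "\<one>\<^bsub>mpoly_ring R n\<^esub> \<otimes>\<^bsub>mpoly_ring R n\<^esub> f = f" using fc by (simp add: mpoly_mult_const)
    show "f \<otimes>\<^bsub>mpoly_ring R n\<^esub> g = g \<otimes>\<^bsub>mpoly_ring R n\<^esub> f" using fc by (simp add: mpoly_mult_comm)
    assume k: "k \<in> carrier (mpoly_ring R n)"
    then show "f \<otimes>\<^bsub>mpoly_ring R n\<^esub> g \<otimes>\<^bsub>mpoly_ring R n\<^esub> k = f \<otimes>\<^bsub>mpoly_ring R n\<^esub> (g \<otimes>\<^bsub>mpoly_ring R n\<^esub> k)"
      using mpoly_mult_assoc[of f n g k] f fc by (simp add: indexed_pset_iff[of k])
  qed (use indexed_const[of \<one> "carrier R"] in simp)
  fix f g k assume "f \<in> carrier (mpoly_ring R n)" "g \<in> carrier (mpoly_ring R n)" "k \<in> carrier (mpoly_ring R n)"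
  then show "(f \<oplus>\<^bsub>mpoly_ring R n\<^esub> g) \<otimes>\<^bsub>mpoly_ring R n\<^esub> k
      = f \<otimes>\<^bsub>mpoly_ring R n\<^esub> k \<oplus>\<^bsub>mpoly_ring R n\<^esub> g \<otimes>\<^bsub>mpoly_ring R n\<^esub> k"
    by (simp add: mpoly_mult_add indexed_pset_iff)
qed

end

lemma (in field) mpoly_field_algebra: "field_algebra R (mpoly_ring R n) indexed_const"
proof -
  have "indexed_const \<in> ring_hom R (mpoly_ring R n)"
  proof (rule ring_hom_memI)
    fix x y assume xy: "x \<in> carrier R" "y \<in> carrier R"
    have "\<And>m :: nat multiset. indexed_const y m \<in> carrier R" using xy by (simp add: indexed_const_def)
    then show "indexed_const (x \<otimes> y) = indexed_const x \<otimes>\<^bsub>mpoly_ring R n\<^esub> indexed_const y"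
      using xy by (simp add: mpoly_mult_const) (auto simp: indexed_const_def)
  qed (simp_all add: indexed_padd_const indexed_const)
  then show ?thesis
    using mpoly_cring by (simp add: field_algebra_def field_algebra_axioms_def field_axioms)
qed

context field
begin

lemma mpoly_carrierD: "f \<in> indexed_pset {..<n::nat} (carrier R) \<Longrightarrow> f m \<in> carrier R"
  by (simp add: indexed_pset_iff)

section \<open>The degree filtration and forms with prescribed values on monomials\<close>

lemma monom_fun_scalar:
  "k \<in> carrier R \<Longrightarrow> indexed_const k \<otimes>\<^bsub>mpoly_ring R n\<^esub> monom_fun \<one> m = monom_fun k m"
  by (auto simp: mpoly_mult_const monom_fun_def)

lemma spn_monom:
  assumes f: "f \<in> carrier (mpoly_ring R n)" "{m. f m \<noteq> \<zero>} \<subseteq> S" "S \<subseteq> monomials n"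
  shows "f \<in> field_algebra.spn R (mpoly_ring R n) indexed_const (monom_fun \<one> ` S)"
proof -
  interpret A: field_algebra R "mpoly_ring R n" indexed_const by (rule mpoly_field_algebra)
  define T where "T = {m. f m \<noteq> \<zero>}"
  have TS: "T \<subseteq> S" using f(2) by (simp add: T_def)
  have "\<And>m. f m \<in> carrier R" "finite T" "T \<subseteq> monomials n" "{m. f m \<noteq> \<zero>} \<subseteq> T"
    using f by (auto simp: indexed_pset_iff T_def)
  then have "f \<in> A.spn (monom_fun \<one> ` T)"
  proof (induction rule: indexed_pset_induct)
    case zero
    then show ?case using A.spn_zero by simp
  next
    case (add g k m)
    have "monom_fun \<one> m \<in> A.spn (monom_fun \<one> ` T)"
      using add.hyps TS f(3) by (intro A.spn_base) (auto intro!: monom_fun_in)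
    then have "indexed_const k \<otimes>\<^bsub>mpoly_ring R n\<^esub> monom_fun \<one> m \<in> A.spn (monom_fun \<one> ` T)"
      using A.spn_smult add.hyps by blast
    then show ?case using A.spn_add[OF add.IH] add.hyps by (simp add: monom_fun_scalar del: mpoly_ring_simps(2))
  qed
  then show ?thesis using A.spn_mono[of "monom_fun \<one> ` T" "monom_fun \<one> ` S"] TS by blast
qed

text \<open>The zero polynomial is treated apart, because its \<open>total_degree\<close> is a
  maximum over the empty set. The condition on the support covers both cases.\<close>

lemma filt_poly_iff:
  "f \<in> filt_poly R n i \<longleftrightarrow> f \<in> carrier (mpoly_ring R n) \<and> (\<forall>m. f m \<noteq> \<zero> \<longrightarrow> int (size m) \<le> i)"
proof (cases "f = (\<lambda>_. \<zero>)")
  case True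
  then show ?thesis using indexed_const[of \<zero> "carrier R"] by (auto simp: filt_poly_def)
next
  case False
  then have ne: "{m. f m \<noteq> \<zero>} \<noteq> {}" by auto
  have "int (total_degree R f) \<le> i \<longleftrightarrow> (\<forall>m. f m \<noteq> \<zero> \<longrightarrow> int (size m) \<le> i)"
    if "f \<in> carrier (mpoly_ring R n)"
  proof -
    have fin: "finite (size ` {m. f m \<noteq> \<zero>})" using that by (simp add: indexed_pset_iff)
    have mem: "total_degree R f \<in> size ` {m. f m \<noteq> \<zero>}"
      unfolding total_degree_def using fin ne by (intro Max_in) auto
    have "size m \<le> total_degree R f" if "f m \<noteq> \<zero>" for m
      unfolding total_degree_def using fin that by (intro Max_ge) auto
    then show ?thesis using mem by force
  qed
  then show ?thesis using False by (auto simp: filt_poly_def)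
qed

text \<open>A spanning set of monomials, with coefficients 1, is the same over every field;
  therefore the filtration is compatible with extension of scalars.\<close>

lemma filt_poly_eq_spn:
  "filt_poly R n i = field_algebra.spn R (mpoly_ring R n) indexed_const
     (monom_fun \<one> ` {m \<in> monomials n. int (size m) \<le> i})"
proof -
  interpret A: field_algebra R "mpoly_ring R n" indexed_const by (rule mpoly_field_algebra)
  show ?thesis
  proof
    show "filt_poly R n i \<subseteq> A.spn (monom_fun \<one> ` {m \<in> monomials n. int (size m) \<le> i})"
    proof
      fix f assume "f \<in> filt_poly R n i"
      then have f: "f \<in> carrier (mpoly_ring R n)" "\<And>m. f m \<noteq> \<zero> \<Longrightarrow> int (size m) \<le> i" by (auto simp: filt_poly_iff)
      show "f \<in> A.spn (monom_fun \<one> ` {m \<in> monomials n. int (size m) \<le> i})"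
        by (rule spn_monom[OF f(1)]) (use f in \<open>auto simp: indexed_pset_iff\<close>)
    qed
    have "f \<in> filt_poly R n i" if "f \<in> A.spn (monom_fun \<one> ` {m \<in> monomials n. int (size m) \<le> i})" for f
      using that
    proof induction
      case spn_zero
      show ?case unfolding filt_poly_iff using A.zero_closed by simp
    next
      case (spn_base x)
      then show ?case by (auto simp: filt_poly_iff monom_fun_def split: if_splits)
    next
      case (spn_add x y)
      then show ?case using A.add.m_closed[of x y] unfolding filt_poly_iff
        by (auto simp: indexed_padd_def) (metis l_zero zero_closed)
    next
      case (spn_smult k x)
      have xc: "\<And>m. x m \<in> carrier R" using A.spn_closed[OF spn_smult.hyps(2)] mpoly_carrierD by simp
      have "x m \<noteq> \<zero>" if "k \<otimes> x m \<noteq> \<zero>" for m using that spn_smult.hyps(1) by auto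
      with xc show ?case using A.m_closed[OF A.c_closed[OF spn_smult.hyps(1)], of x] spn_smult unfolding filt_poly_iff
        by (auto simp: mpoly_mult_const)
    qed
    then show "A.spn (monom_fun \<one> ` {m \<in> monomials n. int (size m) \<le> i}) \<subseteq> filt_poly R n i" by blast
  qed
qed

text \<open>The linear form that takes the value w m at the monomial m.\<close>

definition pairing :: "(nat multiset \<Rightarrow> 'a) \<Rightarrow> (nat multiset \<Rightarrow> 'a) \<Rightarrow> 'a" where
  "pairing w f = (\<Oplus>m\<in>{m. f m \<noteq> \<zero>}. f m \<otimes> w m)"

lemma pairing_eq:
  assumes "finite S" "{m. f m \<noteq> \<zero>} \<subseteq> S" "\<And>m. f m \<in> carrier R" "\<And>m. w m \<in> carrier R"
  shows "pairing w f = (\<Oplus>m\<in>S. f m \<otimes> w m)"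
  unfolding pairing_def
  by (rule add.finprod_mono_neutral_cong_left) (use assms in auto)

lemma pairing_form:
  assumes w: "\<And>m. w m \<in> carrier R"
  shows "field_algebra.form R (mpoly_ring R n) indexed_const (pairing w)"
proof -
  interpret A: field_algebra R "mpoly_ring R n" indexed_const by (rule mpoly_field_algebra)
  show ?thesis unfolding A.form_def
  proof (intro conjI ballI funcsetI)
    fix f assume f: "f \<in> carrier (mpoly_ring R n)"
    then have fc: "\<And>m. f m \<in> carrier R" "finite {m. f m \<noteq> \<zero>}" by (auto simp: indexed_pset_iff)
    show "pairing w f \<in> carrier R" unfolding pairing_def using fc w by (intro finsum_closed) auto
    { fix g assume g: "g \<in> carrier (mpoly_ring R n)"
      then have gc: "\<And>m. g m \<in> carrier R" "finite {m. g m \<noteq> \<zero>}" by (auto simp: indexed_pset_iff)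
      let ?S = "{m. f m \<noteq> \<zero>} \<union> {m. g m \<noteq> \<zero>}"
      have S: "finite ?S" using fc gc by simp
      have sub: "{m. indexed_padd f g m \<noteq> \<zero>} \<subseteq> ?S" by (auto simp: indexed_padd_def)
      have "pairing w (indexed_padd f g) = (\<Oplus>m\<in>?S. f m \<otimes> w m \<oplus> g m \<otimes> w m)"
        by (subst pairing_eq[OF S sub _ w])
          (use fc gc w in \<open>auto simp: indexed_padd_def l_distr intro!: finsum_cong'\<close>)
      also have "\<dots> = pairing w f \<oplus> pairing w g"
        unfolding pairing_eq[OF S Un_upper1 fc(1) w] pairing_eq[OF S Un_upper2 gc(1) w]
        by (rule finsum_addf) (use fc gc w in auto)
      finally show "pairing w (f \<oplus>\<^bsub>mpoly_ring R n\<^esub> g) = pairing w f \<oplus> pairing w g" by simp }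
    fix k assume k: "k \<in> carrier R"
    have sub: "{m. k \<otimes> f m \<noteq> \<zero>} \<subseteq> {m. f m \<noteq> \<zero>}" using k by auto
    have "pairing w (\<lambda>m. k \<otimes> f m) = (\<Oplus>m\<in>{m. f m \<noteq> \<zero>}. k \<otimes> (f m \<otimes> w m))"
      by (subst pairing_eq[OF fc(2) sub _ w]) (use fc k w in \<open>auto simp: m_assoc intro!: finsum_cong'\<close>)
    also have "\<dots> = k \<otimes> pairing w f"
      unfolding pairing_def by (rule finsum_rdistr[symmetric]) (use fc k w in auto)
    finally show "pairing w (indexed_const k \<otimes>\<^bsub>mpoly_ring R n\<^esub> f) = k \<otimes> pairing w f"
      using k fc by (simp add: mpoly_mult_const)
  qed
qed

lemma pairing_monom:
  assumes "\<And>m. w m \<in> carrier R" shows "pairing w (monom_fun \<one> m) = w m"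
proof -
  have sub: "{m'. monom_fun \<one> m m' \<noteq> \<zero>} \<subseteq> {m}" by (auto simp: monom_fun_def)
  have "pairing w (monom_fun \<one> m) = (\<Oplus>m'\<in>{m}. monom_fun \<one> m m' \<otimes> w m')"
    by (rule pairing_eq[OF _ sub _ assms]) (auto simp: monom_fun_def)
  then show ?thesis using assms by (simp add: monom_fun_def)
qed

end

section \<open>Extension of scalars for polynomial rings\<close>

lemma mpoly_hom:
  assumes K: "field K" and L: "field L" and h: "h \<in> ring_hom K L"
  shows "(\<lambda>f. h \<circ> f) \<in> ring_hom (mpoly_ring K n) (mpoly_ring L n)"
proof -
  interpret K: field K by (rule K)
  interpret L: field L by (rule L)
  interpret h: ring_hom_ring K L h by (rule ring_hom_ringI2[OF K.ring_axioms L.ring_axioms h])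
  have h0: "h \<zero>\<^bsub>K\<^esub> = \<zero>\<^bsub>L\<^esub>" by simp
  show ?thesis
  proof (rule ring_hom_memI)
    fix f assume f: "f \<in> carrier (mpoly_ring K n)"
    have "{m. (h \<circ> f) m \<noteq> \<zero>\<^bsub>L\<^esub>} \<subseteq> {m. f m \<noteq> \<zero>\<^bsub>K\<^esub>}" using h0 by auto
    then show "h \<circ> f \<in> carrier (mpoly_ring L n)"
      using f finite_subset[of "{m. (h \<circ> f) m \<noteq> \<zero>\<^bsub>L\<^esub>}"] by (auto simp: K.indexed_pset_iff L.indexed_pset_iff)
    fix g assume g: "g \<in> carrier (mpoly_ring K n)"
    have fg: "\<And>m. f m \<in> carrier K" "\<And>m. g m \<in> carrier K" using f g by (auto simp: K.indexed_pset_iff)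
    show "h \<circ> (f \<oplus>\<^bsub>mpoly_ring K n\<^esub> g) = (h \<circ> f) \<oplus>\<^bsub>mpoly_ring L n\<^esub> (h \<circ> g)"
      using fg by (auto simp: K.indexed_padd_def L.indexed_padd_def)
    show "h \<circ> (f \<otimes>\<^bsub>mpoly_ring K n\<^esub> g) = (h \<circ> f) \<otimes>\<^bsub>mpoly_ring L n\<^esub> (h \<circ> g)"
    proof
      fix m
      have "h (\<Oplus>\<^bsub>K\<^esub>u\<in>{u. u \<subseteq># m}. f u \<otimes>\<^bsub>K\<^esub> g (m - u))
          = (\<Oplus>\<^bsub>L\<^esub>u\<in>{u. u \<subseteq># m}. (h \<circ> (\<lambda>u. f u \<otimes>\<^bsub>K\<^esub> g (m - u))) u)"
        by (subst h.hom_finsum) (use fg in \<open>auto simp: comp_def\<close>)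
      also have "\<dots> = (\<Oplus>\<^bsub>L\<^esub>u\<in>{u. u \<subseteq># m}. h (f u) \<otimes>\<^bsub>L\<^esub> h (g (m - u)))"
        by (rule L.finsum_cong') (use fg in auto)
      finally show "(h \<circ> (f \<otimes>\<^bsub>mpoly_ring K n\<^esub> g)) m = ((h \<circ> f) \<otimes>\<^bsub>mpoly_ring L n\<^esub> (h \<circ> g)) m"
        by (simp add: mpoly_mult_def)
    qed
  qed (auto simp: K.indexed_const_def L.indexed_const_def)
qed

text \<open>The monomials are a basis over both fields. They span over L, and a K-form is extended
  by transporting its values on them along h.\<close>

lemma mpoly_base_change:
  assumes K: "field K" and L: "field L" and h: "h \<in> ring_hom K L"
  shows "base_change K (mpoly_ring K n) (ring.indexed_const K) L (mpoly_ring L n) (ring.indexed_const L)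
    h (\<lambda>f. h \<circ> f)"
proof -
  interpret K: field K by (rule K)
  interpret L: field L by (rule L)
  interpret h: ring_hom_ring K L h by (rule ring_hom_ringI2[OF K.ring_axioms L.ring_axioms h])
  interpret A: field_algebra K "mpoly_ring K n" K.indexed_const by (rule K.mpoly_field_algebra)
  interpret B: field_algebra L "mpoly_ring L n" L.indexed_const by (rule L.mpoly_field_algebra)
  note \<eta> = mpoly_hom[OF assms, of n]
  have mon: "h \<circ> K.monom_fun \<one>\<^bsub>K\<^esub> m = L.monom_fun \<one>\<^bsub>L\<^esub> m" for m
    by (auto simp: K.monom_fun_def L.monom_fun_def)
  show ?thesis
  proof (unfold_locales)
    show "h \<in> ring_hom K L" by (rule h)
    show "(\<lambda>f. h \<circ> f) \<in> ring_hom (mpoly_ring K n) (mpoly_ring L n)" by (rule \<eta>)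
    show "h \<circ> K.indexed_const k = L.indexed_const (h k)" if "k \<in> carrier K" for k
      by (auto simp: K.indexed_const_def L.indexed_const_def)
    show "B.spn ((\<lambda>f. h \<circ> f) ` carrier (mpoly_ring K n)) = carrier (mpoly_ring L n)"
    proof
      show "B.spn ((\<lambda>f. h \<circ> f) ` carrier (mpoly_ring K n)) \<subseteq> carrier (mpoly_ring L n)"
        using B.spn_closed by blast
      have sub: "L.monom_fun \<one>\<^bsub>L\<^esub> ` monomials n \<subseteq> (\<lambda>f. h \<circ> f) ` carrier (mpoly_ring K n)"
      proof
        fix x assume "x \<in> L.monom_fun \<one>\<^bsub>L\<^esub> ` monomials n"
        then obtain m where m: "m \<in> monomials n" "x = h \<circ> K.monom_fun \<one>\<^bsub>K\<^esub> m" using mon by auto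
        show "x \<in> (\<lambda>f. h \<circ> f) ` carrier (mpoly_ring K n)"
          unfolding m(2) by (rule imageI[of "K.monom_fun \<one>\<^bsub>K\<^esub> m" _ "\<lambda>f. h \<circ> f"]) (use K.monom_fun_in[OF m(1)] in simp)
      qed
      have "f \<in> B.spn (L.monom_fun \<one>\<^bsub>L\<^esub> ` monomials n)" if f: "f \<in> carrier (mpoly_ring L n)" for f
        by (rule L.spn_monom[OF f]) (use f in \<open>auto simp: L.indexed_pset_iff\<close>)
      then show "carrier (mpoly_ring L n) \<subseteq> B.spn ((\<lambda>f. h \<circ> f) ` carrier (mpoly_ring K n))"
        using B.spn_mono[OF sub] by blast
    qed
    fix \<Psi> assume \<Psi>: "A.form \<Psi>"
    \<comment> \<open>The value 0 at multisets with foreign variables is a default that keeps w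
      inside L.\<close>
    define w where "w m = (if m \<in> monomials n then h (\<Psi> (K.monom_fun \<one>\<^bsub>K\<^esub> m)) else \<zero>\<^bsub>L\<^esub>)" for m
    have wc: "w m \<in> carrier L" for m
      using A.form_closed[OF \<Psi>, of "K.monom_fun \<one>\<^bsub>K\<^esub> m"] K.monom_fun_in[of m n "\<one>\<^bsub>K\<^esub>"] by (simp add: w_def)
    note \<Phi> = L.pairing_form[of w n, OF wc]
    have "L.pairing w (h \<circ> f) = h (\<Psi> f)" if f: "f \<in> carrier (mpoly_ring K n)" for f
    proof -
      have "f \<in> A.spn (K.monom_fun \<one>\<^bsub>K\<^esub> ` monomials n)"
        by (rule K.spn_monom[OF f]) (use f in \<open>auto simp: K.indexed_pset_iff\<close>)
      then show ?thesis
      proof induction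
        case spn_zero
        have "h \<circ> \<zero>\<^bsub>mpoly_ring K n\<^esub> = \<zero>\<^bsub>mpoly_ring L n\<^esub>" by auto
        then show ?case using A.form_zero[OF \<Psi>] B.form_zero[OF \<Phi>] by (simp del: K.mpoly_ring_simps L.mpoly_ring_simps)
      next
        case (spn_base x)
        then obtain m where "x = K.monom_fun \<one>\<^bsub>K\<^esub> m" "m \<in> monomials n" by auto
        moreover from this have "w m = h (\<Psi> x)" by (simp add: w_def)
        ultimately show ?case using L.pairing_monom[of w m, OF wc] mon by metis
      next
        case (spn_add x y)
        have xy: "x \<in> carrier (mpoly_ring K n)" "y \<in> carrier (mpoly_ring K n)" using spn_add A.spn_closed by auto
        have hxy: "h \<circ> x \<in> carrier (mpoly_ring L n)" "h \<circ> y \<in> carrier (mpoly_ring L n)"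
          using ring_hom_closed[OF \<eta>] xy by blast+
        have "h \<circ> (x \<oplus>\<^bsub>mpoly_ring K n\<^esub> y) = (h \<circ> x) \<oplus>\<^bsub>mpoly_ring L n\<^esub> (h \<circ> y)"
          by (rule ring_hom_add[OF \<eta> xy])
        then have "L.pairing w (h \<circ> (x \<oplus>\<^bsub>mpoly_ring K n\<^esub> y)) = L.pairing w (h \<circ> x) \<oplus>\<^bsub>L\<^esub> L.pairing w (h \<circ> y)"
          using B.form_add[OF \<Phi> hxy] by metis
        also have "\<dots> = h (\<Psi> x) \<oplus>\<^bsub>L\<^esub> h (\<Psi> y)" unfolding spn_add.IH ..
        also have "\<dots> = h (\<Psi> (x \<oplus>\<^bsub>mpoly_ring K n\<^esub> y))"
          using h.hom_add A.form_closed[OF \<Psi>] xy A.form_add[OF \<Psi> xy] by metis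
        finally show ?case .
      next
        case (spn_smult k x)
        have x: "x \<in> carrier (mpoly_ring K n)" using spn_smult A.spn_closed by auto
        have hx: "h \<circ> x \<in> carrier (mpoly_ring L n)" by (rule ring_hom_closed[OF \<eta> x])
        have hk: "h k \<in> carrier L" using spn_smult.hyps(1) by simp
        have "h \<circ> (K.indexed_const k \<otimes>\<^bsub>mpoly_ring K n\<^esub> x)
            = (h \<circ> K.indexed_const k) \<otimes>\<^bsub>mpoly_ring L n\<^esub> (h \<circ> x)"
          by (rule ring_hom_mult[OF \<eta> A.c_closed[OF spn_smult.hyps(1)] x])
        moreover have "h \<circ> K.indexed_const k = L.indexed_const (h k)"
          by (auto simp: K.indexed_const_def L.indexed_const_def)
        ultimately have "L.pairing w (h \<circ> (K.indexed_const k \<otimes>\<^bsub>mpoly_ring K n\<^esub> x)) = h k \<otimes>\<^bsub>L\<^esub> L.pairing w (h \<circ> x)"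
          using B.form_smult[OF \<Phi> hk hx] by metis
        also have "\<dots> = h k \<otimes>\<^bsub>L\<^esub> h (\<Psi> x)" unfolding spn_smult.IH ..
        also have "\<dots> = h (\<Psi> (K.indexed_const k \<otimes>\<^bsub>mpoly_ring K n\<^esub> x))"
          using h.hom_mult A.form_closed[OF \<Psi> x] spn_smult.hyps(1) A.form_smult[OF \<Psi> spn_smult.hyps(1) x] by metis
        finally show ?case .
      qed
    qed
    then show "\<exists>\<Phi>. B.form \<Phi> \<and> (\<forall>f\<in>carrier (mpoly_ring K n). \<Phi> (h \<circ> f) = h (\<Psi> f))" using \<Phi> by blast
  qed
qed

lemma lift_filt_poly:
  assumes K: "field K" and L: "field L" and h: "h \<in> ring_hom K L"
  shows "base_change.lift L (mpoly_ring L n) (ring.indexed_const L) (\<lambda>f. h \<circ> f) (filt_poly K n i) = filt_poly L n i"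
proof -
  interpret K: field K by (rule K)
  interpret L: field L by (rule L)
  interpret h: ring_hom_ring K L h by (rule ring_hom_ringI2[OF K.ring_axioms L.ring_axioms h])
  interpret base_change K "mpoly_ring K n" K.indexed_const L "mpoly_ring L n" L.indexed_const h "\<lambda>f. h \<circ> f"
    by (rule mpoly_base_change[OF assms])
  have mon: "h \<circ> K.monom_fun \<one>\<^bsub>K\<^esub> m = L.monom_fun \<one>\<^bsub>L\<^esub> m" for m
    by (auto simp: K.monom_fun_def L.monom_fun_def)
  let ?M = "{m \<in> monomials n. int (size m) \<le> i}"
  have "lift (filt_poly K n i) = lift (K.monom_fun \<one>\<^bsub>K\<^esub> ` ?M)"
    unfolding K.filt_poly_eq_spn by (rule lift_spn) (auto intro!: K.monom_fun_in)
  also have "\<dots> = spn (L.monom_fun \<one>\<^bsub>L\<^esub> ` ?M)"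
    unfolding lift_def by (simp add: image_image mon)
  finally show ?thesis by (simp add: L.filt_poly_eq_spn)
qed

section \<open>The Cayley-Bacharach property and the canonical module\<close>

text \<open>In a field with q elements every a satisfies a^q = a, so X^q - X + 1 takes only the
  value 1 and has no root.\<close>

lemma (in algebraically_closed) infinite_carrier: "infinite (carrier L)"
proof
  assume fin: "finite (carrier L)"
  define q where "q = card (carrier L)"
  have "{\<zero>, \<one>} \<subseteq> carrier L" "card {\<zero>, \<one>} = 2" by auto
  then have q2: "2 \<le> q" using card_mono[OF fin, of "{\<zero>, \<one>}"] by (simp add: q_def)
  have pow_q: "a [^] q = a" if a: "a \<in> carrier L" for a
  proof (cases "a = \<zero>")
    case True
    then show ?thesis using q2 by (simp add: nat_pow_zero)
  next
    case False
    interpret G: group "Multiplicative_Group.mult_of L" by (rule field_mult_group)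
    have "a [^] (q - 1) = \<one>"
      using G.pow_order_eq_1[of a] a False order_mult_of[OF fin] by (simp add: q_def order_def Multiplicative_Group.nat_pow_mult_of)
    then have "a [^] Suc (q - 1) = a" using a by simp
    then show ?thesis using q2 by simp
  qed
  \<comment> \<open>Coefficients are listed from the highest degree down, so appending two entries
    multiplies X^(q-2) by X^2 and adds -X + 1. This is X^q - X + 1, and q \<ge> 2 makes it well
    formed.\<close>
  define p where "p = monom \<one> (q - 2) @ [\<ominus> \<one>, \<one>]"
  have set: "set (monom \<one> (q - 2)) \<subseteq> carrier L" "set [\<ominus> \<one>, \<one>] \<subseteq> carrier L"
    by (auto simp: monom_def)
  have eval: "eval p a = \<one>" if a: "a \<in> carrier L" for a
  proof -
    have "eval p a = eval (monom \<one> (q - 2)) a \<otimes> a [^] length [\<ominus> \<one>, \<one>] \<oplus> eval [\<ominus> \<one>, \<one>] a"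
      unfolding p_def by (rule eval_append[OF set a])
    also have "\<dots> = a [^] (q - 2) \<otimes> a [^] (2::nat) \<oplus> (\<ominus> a \<oplus> \<one>)"
      using a by (simp add: eval_monom l_minus numeral_2_eq_2)
    also have "a [^] (q - 2) \<otimes> a [^] (2::nat) = a [^] (q - 2 + 2)" by (rule nat_pow_mult[OF a])
    also have "q - 2 + 2 = q" using q2 by simp
    also have "a [^] q = a" by (rule pow_q[OF a])
    also have "a \<oplus> (\<ominus> a \<oplus> \<one>) = \<one>" using a by (simp add: a_assoc[symmetric] r_neg)
    finally show ?thesis .
  qed
  have "p \<in> carrier (poly_ring L)"
    using set by (simp add: p_def univ_poly_carrier[symmetric] polynomial_def monom_def)
  then have "size (roots p) = degree p" using roots_over_carrier by (simp add: splitted_def)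
  also have "\<dots> \<noteq> 0" by (simp add: p_def monom_def)
  finally obtain a where "a \<in># roots p" by (metis multiset_nonemptyE size_empty)
  then have "is_root p a"
    using roots_mem_iff_is_root[OF \<open>p \<in> carrier (poly_ring L)\<close>] by simp
  then show False using eval[of a] by (simp add: is_root_def)
qed

text \<open>The integers are not well-ordered, so \<open>LEAST\<close> needs a lower bound: T fails
  at a, hence everywhere below, and the least element is found among the natural distances from
  a.\<close>

lemma int_Least_le_iff:
  fixes T :: "int \<Rightarrow> bool"
  assumes mono: "\<And>i j. \<lbrakk>T i; i \<le> j\<rbrakk> \<Longrightarrow> T j" and "\<not> T a" "T b"
  shows "(LEAST i. T i) \<le> j \<longleftrightarrow> T j"
proof -
  let ?k = "LEAST k::nat. T (a + int k)"
  have a: "a < i" if "T i" for i using mono[OF that] assms(2) by (meson not_le)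
  have ex: "T (a + int ?k)"
    by (rule LeastI[of "\<lambda>k. T (a + int k)" "nat (b - a)"]) (use assms(3) a[OF assms(3)] in simp)
  have le: "a + int ?k \<le> i" if i: "T i" for i
  proof -
    have "?k \<le> nat (i - a)" by (rule Least_le) (use i a[OF i] in simp)
    then show ?thesis using a[OF i] by linarith
  qed
  have eq: "(LEAST i. T i) = a + int ?k" using ex le by (rule Least_equality)
  show ?thesis
  proof
    assume "(LEAST i. T i) \<le> j"
    then show "T j" unfolding eq by (rule mono[OF ex])
  next
    assume "T j"
    then show "(LEAST i. T i) \<le> j" unfolding eq by (rule le)
  qed
qed

context field
begin

interpretation A: field_algebra R "mpoly_ring R n" indexed_const for n by (rule mpoly_field_algebra)

lemma quot_alg_eq: "quot_alg R n I = A.quot_mod n I"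
  by (simp add: quot_alg_def A.quot_mod_def Let_def)

lemma image_in_quot_eq: "image_in_quot R n I S = (\<lambda>f. I +>\<^bsub>mpoly_ring R n\<^esub> f) ` S"
  by (simp add: image_in_quot_def)

lemma zero_dim_ideal_iff:
  "zero_dim_ideal R n I \<longleftrightarrow> ideal I (mpoly_ring R n) \<and> I \<noteq> carrier (mpoly_ring R n) \<and> A.fin_codim n I"
  using A.fin_dim_iff[of I n] by (auto simp: zero_dim_ideal_def quot_alg_eq)

lemma filt_poly_subsp: "A.subsp n (filt_poly R n i)"
  unfolding filt_poly_eq_spn by simp

lemma filt_poly_mono: "i \<le> j \<Longrightarrow> filt_poly R n i \<subseteq> filt_poly R n j"
  unfolding filt_poly_iff subset_iff by (meson order_trans)

lemma filt_poly_neg: "i < 0 \<Longrightarrow> filt_poly R n i \<subseteq> {\<zero>\<^bsub>mpoly_ring R n\<^esub>}"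
  unfolding filt_poly_def by auto

text \<open>For an ideal I, the preimage in P of the filtration step F_i R. Despite the name it is
  only a subspace.\<close>

definition filt_ideal :: "nat \<Rightarrow> (nat multiset \<Rightarrow> 'a) set \<Rightarrow> int \<Rightarrow> (nat multiset \<Rightarrow> 'a) set" where
  "filt_ideal n I i = A.spn n (I \<union> filt_poly R n i)"

lemma filt_ideal_mono: "i \<le> j \<Longrightarrow> filt_ideal n I i \<subseteq> filt_ideal n I j"
  unfolding filt_ideal_def by (intro A.spn_mono Un_mono filt_poly_mono) auto

lemma filt_ideal_subset: "filt_ideal n I i \<subseteq> carrier (mpoly_ring R n)"
  unfolding filt_ideal_def using A.subsp_subset[OF A.subsp_spn] .

lemma filt_ideal_superset: "ideal I (mpoly_ring R n) \<Longrightarrow> I \<subseteq> filt_ideal n I i"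
  unfolding filt_ideal_def using A.ideal_carrier by (auto intro: A.spn_base)

lemma filt_ideal_neg:
  assumes I: "ideal I (mpoly_ring R n)" and i: "i < 0" shows "filt_ideal n I i = I"
proof
  have "A.spn n (I \<union> filt_poly R n i) \<subseteq> I"
    by (rule A.spn_least[OF A.subsp_ideal[OF I]]) (use filt_poly_neg[OF i] A.ideal_zero[OF I] in blast)
  then show "filt_ideal n I i \<subseteq> I" by (simp add: filt_ideal_def)
qed (rule filt_ideal_superset[OF I])

lemma filt_mem_iff:
  assumes "ideal I (mpoly_ring R n)" "f \<in> carrier (mpoly_ring R n)"
  shows "I +>\<^bsub>mpoly_ring R n\<^esub> f \<in> filt R n I i \<longleftrightarrow> f \<in> filt_ideal n I i"
  unfolding filt_def image_in_quot_eq filt_ideal_def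
  by (rule A.coset_mem_image_iff[OF assms(1) filt_poly_subsp assms(2)])

text \<open>Finitely many generators of P modulo I have bounded degree.\<close>

lemma filt_ideal_full:
  assumes I: "ideal I (mpoly_ring R n)" "A.fin_codim n I"
  shows "\<exists>i. filt_ideal n I i = carrier (mpoly_ring R n)"
proof -
  obtain B where B: "finite B" "B \<subseteq> carrier (mpoly_ring R n)" "A.spn n (I \<union> B) = carrier (mpoly_ring R n)"
    using I(2) unfolding A.fin_codim_def by auto
  have "\<exists>i. B \<subseteq> filt_poly R n i"
    using B(1,2)
  proof (induction B rule: finite_induct)
    case (insert f B)
    then obtain i where i: "B \<subseteq> filt_poly R n i" by auto
    have "f \<in> filt_poly R n (int (total_degree R f))" using insert.prems by (simp add: filt_poly_def)
    then have "insert f B \<subseteq> filt_poly R n (max i (int (total_degree R f)))"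
      using i filt_poly_mono[of i "max i (int (total_degree R f))" n]
        filt_poly_mono[of "int (total_degree R f)" "max i (int (total_degree R f))" n] by auto
    then show ?case by blast
  qed simp
  then obtain i where i: "B \<subseteq> filt_poly R n i" by blast
  have "A.spn n (I \<union> B) \<subseteq> filt_ideal n I i" unfolding filt_ideal_def by (rule A.spn_mono) (use i in auto)
  then show ?thesis using B(3) filt_ideal_subset by blast
qed

text \<open>The filtration increases, so stability from i onwards amounts to fullness at i, and full
  dimension amounts to equality with R.\<close>

lemma reg_index_le_iff:
  assumes I: "ideal I (mpoly_ring R n)" "I \<noteq> carrier (mpoly_ring R n)" "A.fin_codim n I"
  shows "reg_index R n I \<le> i \<longleftrightarrow> filt_ideal n I i = carrier (mpoly_ring R n)"
proof -
  let ?T = "\<lambda>i. filt_ideal n I i = carrier (mpoly_ring R n)"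
  have mono: "?T j" if "?T i" "i \<le> j" for i j
    using filt_ideal_mono[OF that(2), of n I] filt_ideal_subset[of n I j] that(1) by blast
  have HF: "affine_HF R n I j = vectorspace.dim R (quot_alg R n I) \<longleftrightarrow> ?T j" for j
    using A.dim_image_eq_iff[OF I(1,3) filt_poly_subsp]
    by (simp add: affine_HF_def subspace_dim_def filt_def image_in_quot_eq quot_alg_eq filt_ideal_def del: mpoly_ring_simps)
  have "(\<forall>j\<ge>i. ?T j) \<longleftrightarrow> ?T i" for i using mono by blast
  then have eq: "reg_index R n I = (LEAST i. ?T i)" unfolding reg_index_def HF by simp
  obtain b where b: "?T b" using filt_ideal_full[OF I(1,3)] by blast
  \<comment> \<open>F_{-1} R is zero and R is not; this is the lower bound that the least index
    requires.\<close>
  have "\<not> ?T (-1)" using filt_ideal_neg[OF I(1), of "-1"] I(2) by simp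
  from int_Least_le_iff[of ?T, OF mono this b] show ?thesis unfolding eq .
qed

lemma filt_reg_index:
  assumes I: "ideal I (mpoly_ring R n)" "I \<noteq> carrier (mpoly_ring R n)" "A.fin_codim n I"
  shows "filt_ideal n I (reg_index R n I) = carrier (mpoly_ring R n)"
  using reg_index_le_iff[OF I] by blast

lemma ord_filt_le_iff:
  assumes I: "ideal I (mpoly_ring R n)" "A.fin_codim n I"
    and f: "f \<in> carrier (mpoly_ring R n)" "f \<notin> I"
  shows "ord_filt R n I (I +>\<^bsub>mpoly_ring R n\<^esub> f) \<le> i \<longleftrightarrow> f \<in> filt_ideal n I i"
proof -
  have eq: "ord_filt R n I (I +>\<^bsub>mpoly_ring R n\<^esub> f) = (LEAST i. f \<in> filt_ideal n I i)"
    unfolding ord_filt_def filt_mem_iff[OF I(1) f(1)] ..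
  obtain b where b: "f \<in> filt_ideal n I b" using filt_ideal_full[OF I] f(1) by blast
  have n: "f \<notin> filt_ideal n I (-1)" using filt_ideal_neg[OF I(1), of "-1"] f(2) by simp
  have m: "f \<in> filt_ideal n I j" if "f \<in> filt_ideal n I i" "i \<le> j" for i j
    using filt_ideal_mono[OF that(2)] that(1) by blast
  from int_Least_le_iff[of "\<lambda>i. f \<in> filt_ideal n I i", OF m n b] show ?thesis unfolding eq .
qed

lemma quot_alg_zero_iff:
  assumes "ideal I (mpoly_ring R n)" "f \<in> carrier (mpoly_ring R n)"
  shows "I +>\<^bsub>mpoly_ring R n\<^esub> f = \<zero>\<^bsub>quot_alg R n I\<^esub> \<longleftrightarrow> f \<in> I"
  unfolding quot_alg_eq by (rule quotient_map.eq_zero_iff[OF A.quotient_map_mod[OF assms(1)] assms(2)])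

text \<open>No order exceeds r, since F_r R = R. The maximum therefore equals r iff some element of
  J is not in the step r - 1.\<close>

lemma reg_index_ideal_eq_iff:
  assumes I: "ideal I (mpoly_ring R n)" "I \<noteq> carrier (mpoly_ring R n)" "A.fin_codim n I"
    and J: "ideal J (mpoly_ring R n)" "I \<subset> J"
  shows "reg_index_ideal R n I (image_in_quot R n I J) = reg_index R n I
    \<longleftrightarrow> \<not> J \<subseteq> filt_ideal n I (reg_index R n I - 1)"
proof -
  let ?r = "reg_index R n I"
  let ?o = "\<lambda>f. ord_filt R n I (I +>\<^bsub>mpoly_ring R n\<^esub> f)"
  let ?O = "ord_filt R n I ` (image_in_quot R n I J - {\<zero>\<^bsub>quot_alg R n I\<^esub>})"
  have Jc: "f \<in> carrier (mpoly_ring R n)" if "f \<in> J" for f using A.ideal_carrier[OF J(1) that] .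
  have O: "?O = ?o ` (J - I)"
  proof -
    have "image_in_quot R n I J - {\<zero>\<^bsub>quot_alg R n I\<^esub>} = (\<lambda>f. I +>\<^bsub>mpoly_ring R n\<^esub> f) ` (J - I)"
      unfolding image_in_quot_eq using quot_alg_zero_iff[OF I(1) Jc] by blast
    then show ?thesis by (simp add: image_image)
  qed
  have iff: "?o f \<le> i \<longleftrightarrow> f \<in> filt_ideal n I i" if "f \<in> J - I" for f i
    using ord_filt_le_iff[OF I(1,3) Jc] that by blast
  have le: "?o f \<le> ?r" if "f \<in> J - I" for f
    using iff[OF that] filt_reg_index[OF I] Jc that by blast
  have ge: "0 \<le> ?o f" if "f \<in> J - I" for f
    using iff[OF that, of "-1"] filt_ideal_neg[OF I(1), of "-1"] that by auto
  \<comment> \<open>The orders are bounded on both sides, so the set is finite and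
    \<open>Max\<close> is attained even if J/I is infinite.\<close>
  have "?O \<subseteq> {0..?r}" unfolding O using le ge by auto
  then have fin: "finite ?O" by (rule finite_subset) simp
  have ne: "?O \<noteq> {}" unfolding O using J(2) by auto
  have sub: "I \<subseteq> filt_ideal n I i" for i using filt_ideal_superset[OF I(1)] .
  have "Max ?O = ?r \<longleftrightarrow> \<not> (\<forall>f\<in>J - I. ?o f \<le> ?r - 1)"
  proof
    assume "Max ?O = ?r"
    then have "?r \<in> ?o ` (J - I)" using Max_in[OF fin ne] O by simp
    then show "\<not> (\<forall>f\<in>J - I. ?o f \<le> ?r - 1)" by force
  next
    assume "\<not> (\<forall>f\<in>J - I. ?o f \<le> ?r - 1)"
    then obtain f where f: "f \<in> J - I" "?o f = ?r" using le by force
    have "?o f \<in> ?O" unfolding O using f(1) by (rule imageI)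
    moreover have "y \<le> ?r" if "y \<in> ?O" for y using that le unfolding O by blast
    ultimately show "Max ?O = ?r" using f(2) by (intro Max_eqI[OF fin]) auto
  qed
  also have "(\<forall>f\<in>J - I. ?o f \<le> ?r - 1) \<longleftrightarrow> J \<subseteq> filt_ideal n I (?r - 1)"
    using iff sub[of "?r - 1"] by blast
  finally show ?thesis unfolding reg_index_ideal_def .
qed

text \<open>Every divisor is an ideal strictly above I, so escape implies the property. Conversely
  each ideal strictly above I contains a minimal one, and minimal ideals over I are minimal
  divisors.\<close>

lemma cayley_bacharach_iff:
  assumes I: "ideal I (mpoly_ring R n)" "I \<noteq> carrier (mpoly_ring R n)" "A.fin_codim n I"
  shows "cayley_bacharach R n I \<longleftrightarrow> A.ideals_escape n I (filt_poly R n (reg_index R n I - 1))"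
proof
  assume esc: "A.ideals_escape n I (filt_poly R n (reg_index R n I - 1))"
  show "cayley_bacharach R n I"
    unfolding cayley_bacharach_def A.primary_components_eq[OF I(1,3)]
  proof (intro ballI allI impI)
    fix Q J assume "Q \<in> A.pcomp n I ` A.max_over n I" and "minimal_ideal_divisor R n I Q J"
    then obtain M Q' where M: "M \<in> A.max_over n I" "Q = A.pcomp n I M"
      and Q': "ideal Q' (mpoly_ring R n)" "Q \<subset> Q'"
      and J: "J = Q' \<inter> \<Inter>(A.pcomp n I ` A.max_over n I - {Q})"
      unfolding minimal_ideal_divisor_def ideal_divisor_def A.primary_components_eq[OF I(1,3)] by blast
    note J' = A.divisor_strict[OF I(1,3) M(1) Q'(1) Q'(2)[unfolded M(2)] J[unfolded M(2)]]
    show "reg_index_ideal R n I (image_in_quot R n I J) = reg_index R n I"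
      unfolding reg_index_ideal_eq_iff[OF I J'] filt_ideal_def
      using esc J' unfolding A.ideals_escape_def by blast
  qed
next
  assume cb: "cayley_bacharach R n I"
  show "A.ideals_escape n I (filt_poly R n (reg_index R n I - 1))"
    unfolding A.ideals_escape_def filt_ideal_def[symmetric]
  proof (intro allI impI)
    fix J assume J: "ideal J (mpoly_ring R n)" "I \<subset> J"
    \<comment> \<open>J' is generated over I by a socle element, which exhibits it as a divisor with
      the required dimension; if J' escapes, so does J.\<close>
    obtain J' where J': "A.minimal_over n I J'" "J' \<subseteq> J" using A.minimal_over_exists[OF I(1,3) J] .
    then obtain f where f: "f \<in> J'" "f \<notin> I" by (auto simp: A.minimal_over_def)
    define M where "M = A.colon n I f"
    have M: "M \<in> A.max_over n I" and fs: "f \<in> A.soc n I M"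
      using A.minimal_over_maximal[OF I(1) J'(1) f] f(1) by (auto simp: M_def)
    have eq: "J' = A.adj n I f" by (rule A.minimal_over_adj[OF I(1) J'(1) f])
    have fc: "f \<in> carrier (mpoly_ring R n)" using fs by (simp add: A.soc_def del: mpoly_ring_simps)
    have M': "maximalideal M (mpoly_ring R n)" using M by (simp add: A.max_over_def)
    let ?Q = "A.pcomp n I M"
    note d = A.adj_soc_divisor[OF I(1,3) M fs f(2)]
    have "ideal_divisor R n I ?Q J'"
      unfolding ideal_divisor_def A.primary_components_eq[OF I(1,3)] eq
      using d A.adj_ideal[OF A.pcomp_ideal[OF I(1) M'] fc] by blast
    moreover have "subspace_dim R n I (image_in_quot R n I J')
        = vectorspace.dim R (quot_alg R n (radical (mpoly_ring R n) ?Q))"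
      unfolding subspace_dim_def image_in_quot_eq quot_alg_eq A.radical_pcomp[OF I(1,3) M] eq
      by (rule A.dim_adj_soc[OF I(1,3) M fs f(2)])
    ultimately have "minimal_ideal_divisor R n I ?Q J'" by (simp add: minimal_ideal_divisor_def)
    moreover have "?Q \<in> primary_components (mpoly_ring R n) I"
      unfolding A.primary_components_eq[OF I(1,3)] using M by simp
    ultimately have "reg_index_ideal R n I (image_in_quot R n I J') = reg_index R n I"
      using cb by (simp add: cayley_bacharach_def)
    moreover have "ideal J' (mpoly_ring R n)" "I \<subset> J'" using J'(1) by (auto simp: A.minimal_over_def)
    ultimately show "\<not> J \<subseteq> filt_ideal n I (reg_index R n I - 1)"
      using reg_index_ideal_eq_iff[OF I] J'(2) by blast
  qed
qed

text \<open>The local factor, a quotient of R by the image of a component, is read as the quotient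
  of P by that component, over which M is the only maximal ideal.\<close>

lemma locally_gorenstein_iff:
  assumes I: "ideal I (mpoly_ring R n)" "A.fin_codim n I"
  shows "locally_gorenstein R n I \<longleftrightarrow> A.gorenstein n I"
proof -
  have "gorenstein_local (quot_alg R n I Quot image_in_quot R n I (A.pcomp n I M))
      \<longleftrightarrow> A.simple_socle n (A.pcomp n I M) M" if M: "M \<in> A.max_over n I" for M
  proof -
    have M': "maximalideal M (mpoly_ring R n)" using M by (simp add: A.max_over_def)
    let ?P = "mpoly_ring R n" let ?Q = "A.pcomp n I M" let ?N = "image_in_quot R n I ?Q"
    note Q = A.pcomp_ideal[OF I(1) M'] and IQ = A.pcomp_superset[OF I(1) M']
    interpret q: quotient_map ?P "quot_alg R n I" "\<lambda>f. I +>\<^bsub>?P\<^esub> f" I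
      unfolding quot_alg_eq by (rule A.quotient_map_mod[OF I(1)])
    have N: "ideal ?N (quot_alg R n I)" unfolding image_in_quot_eq by (rule q.image_ideal[OF Q])
    have "{f \<in> carrier ?P. I +>\<^bsub>?P\<^esub> f \<in> ?N} = ?Q"
      using q.image_mem_iff[OF Q IQ] A.ideal_carrier[OF Q] unfolding image_in_quot_eq by blast
    with q.quotient_compose[OF N]
    have "quotient_map ?P (quot_alg R n I Quot ?N) (\<lambda>f. ?N +>\<^bsub>quot_alg R n I\<^esub> (I +>\<^bsub>?P\<^esub> f)) ?Q" by simp
    from A.gorenstein_local_iff[OF this A.fin_codim_mono[OF I(2) IQ] A.max_over_pcomp[OF I M]]
    show ?thesis .
  qed
  then show ?thesis
    unfolding locally_gorenstein_def A.primary_components_eq[OF I] A.gorenstein_iff_pcomp[OF I] by blast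
qed

text \<open>Forms on R are the same as forms on P that vanish on I. Under this correspondence the
  annihilator becomes the set of v modulo I all of whose multiples lie in the kernel.\<close>

lemma has_faithful_form_iff:
  assumes I: "ideal I (mpoly_ring R n)" "I \<noteq> carrier (mpoly_ring R n)" "A.fin_codim n I"
  shows "has_faithful_form_of_min_order R n I \<longleftrightarrow>
    (\<exists>\<Phi>. A.form n \<Phi> \<and> (\<forall>v\<in>I \<union> filt_poly R n (reg_index R n I - 1). \<Phi> v = \<zero>)
      \<and> (\<forall>v\<in>carrier (mpoly_ring R n). (\<forall>g\<in>carrier (mpoly_ring R n). \<Phi> (g \<otimes>\<^bsub>mpoly_ring R n\<^esub> v) = \<zero>) \<longrightarrow> v \<in> I))"
    (is "_ \<longleftrightarrow> (\<exists>\<Phi>. ?good \<Phi>)")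
proof -
  let ?P = "mpoly_ring R n" let ?r = "reg_index R n I" let ?R = "quot_alg R n I" let ?W = "canonical_module R n I"
  let ?pi = "\<lambda>f. I +>\<^bsub>?P\<^esub> f"
  interpret q: quotient_map ?P ?R ?pi I
    unfolding quot_alg_eq by (rule A.quotient_map_mod[OF I(1)])
  have sm: "k \<odot>\<^bsub>?R\<^esub> ?pi f = ?pi (indexed_const k \<otimes>\<^bsub>?P\<^esub> f)" if "k \<in> carrier R" "f \<in> carrier ?P" for k f
    unfolding quot_alg_eq by (rule A.quot_mod_smult[OF I(1) that])
  have self: "carrier (self_module R) = carrier R" "a \<oplus>\<^bsub>self_module R\<^esub> b = a \<oplus> b" "a \<odot>\<^bsub>self_module R\<^esub> b = a \<otimes> b" for a b
    by (simp_all add: self_module_def)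
  have Wc: "carrier ?W = module_hom R ?R (self_module R) \<inter> extensional (carrier ?R)"
    and Wz: "\<zero>\<^bsub>?W\<^esub> = (\<lambda>x\<in>carrier ?R. \<zero>)"
    and Ws: "x \<odot>\<^bsub>?W\<^esub> \<phi> = (\<lambda>g\<in>carrier ?R. \<phi> (x \<otimes>\<^bsub>?R\<^esub> g))" for x \<phi>
    by (simp_all add: canonical_module_def Let_def)
  have filt: "filt R n I i = ?pi ` filt_poly R n i" for i by (simp add: filt_def image_in_quot_eq)
  have Fc: "f \<in> carrier ?P" if "f \<in> filt_poly R n i" for f i using that unfolding filt_poly_iff by blast
  have formW: "A.form n (\<lambda>f. \<phi> (?pi f))" if \<phi>: "\<phi> \<in> carrier ?W" for \<phi>
  proof -
    have hom: "\<And>x y. \<lbrakk>x \<in> carrier ?R; y \<in> carrier ?R\<rbrakk> \<Longrightarrow> \<phi> (x \<oplus>\<^bsub>?R\<^esub> y) = \<phi> x \<oplus> \<phi> y"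
      "\<And>k x. \<lbrakk>k \<in> carrier R; x \<in> carrier ?R\<rbrakk> \<Longrightarrow> \<phi> (k \<odot>\<^bsub>?R\<^esub> x) = k \<otimes> \<phi> x"
      "\<And>x. x \<in> carrier ?R \<Longrightarrow> \<phi> x \<in> carrier R"
      using \<phi> by (auto simp: Wc module_hom_def self)
    show ?thesis
      unfolding A.form_def
    proof (intro conjI ballI funcsetI)
      fix x assume x: "x \<in> carrier ?P"
      show "\<phi> (?pi x) \<in> carrier R" using hom(3) q.\<sigma>_closed[OF x] .
      show "\<phi> (?pi (x \<oplus>\<^bsub>?P\<^esub> y)) = \<phi> (?pi x) \<oplus> \<phi> (?pi y)" if y: "y \<in> carrier ?P" for y
        using hom(1)[OF q.\<sigma>_closed[OF x] q.\<sigma>_closed[OF y]] q.\<sigma>_add[OF x y] by simp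
      show "\<phi> (?pi (indexed_const k \<otimes>\<^bsub>?P\<^esub> x)) = k \<otimes> \<phi> (?pi x)" if k: "k \<in> carrier R" for k
        using hom(2)[OF k q.\<sigma>_closed[OF x]] sm[OF k x] by simp
    qed
  qed
  have zeroW: "\<phi> (?pi f) = \<zero>" if \<phi>: "\<phi> \<in> carrier ?W" "f \<in> I" for \<phi> f
  proof -
    have fc: "f \<in> carrier ?P" using A.ideal_carrier[OF I(1) \<phi>(2)] .
    have "?pi f = ?pi \<zero>\<^bsub>?P\<^esub>" using q.eq_zero_iff[OF fc] \<phi>(2) q.\<sigma>_zero by simp
    then show ?thesis using A.form_zero[OF formW[OF \<phi>(1)]] by simp
  qed
  \<comment> \<open>Membership in the step i of the canonical filtration means vanishing on
    F_{-i-1}. The index -r thus gives F_{r-1}, and -r - 1 gives F_r = R.\<close>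
  have core: "ord_canonical R n I \<phi> = - ?r \<longleftrightarrow> (\<forall>f\<in>filt_poly R n (?r - 1). \<phi> (?pi f) = \<zero>)"
    if \<phi>: "\<phi> \<in> carrier ?W" "\<phi> \<noteq> \<zero>\<^bsub>?W\<^esub>" for \<phi>
  proof -
    let ?T = "\<lambda>i. \<phi> \<in> canonical_filt R n I i"
    have T: "?T i \<longleftrightarrow> (\<forall>f\<in>filt_poly R n (- i - 1). \<phi> (?pi f) = \<zero>)" for i
      using \<phi>(1) by (simp add: canonical_filt_def filt)
    note form = formW[OF \<phi>(1)]
    have mono: "?T j" if "?T i" "i \<le> j" for i j
      using that filt_poly_mono[of "- j - 1" "- i - 1" n] unfolding T by auto
    have T0: "?T 0"
      unfolding T using filt_poly_neg[of "- 0 - 1" n] A.form_zero[OF form] by auto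
    \<comment> \<open>A form of order below -r would vanish on all of R, so -r is the least order
      that a nonzero form can have.\<close>
    have nT: "\<not> ?T (- ?r - 1)"
    proof
      assume "?T (- ?r - 1)"
      then have v: "\<phi> (?pi f) = \<zero>" if "f \<in> filt_poly R n ?r" for f using that unfolding T by simp
      note vI = zeroW[OF \<phi>(1)]
      have "filt_ideal n I ?r \<subseteq> A.ker n (\<lambda>f. \<phi> (?pi f))"
        unfolding filt_ideal_def
        by (rule A.spn_least[OF A.subsp_ker[OF form]]) (use v vI in \<open>auto simp: A.ker_def simp del: mpoly_ring_simps\<close>)
      then have all: "\<phi> (?pi f) = \<zero>" if "f \<in> carrier ?P" for f
        using that unfolding filt_reg_index[OF I] by (auto simp: A.ker_def simp del: mpoly_ring_simps)
      have "\<phi> = \<zero>\<^bsub>?W\<^esub>"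
        by (rule extensionalityI[of _ "carrier ?R"])
          (use \<phi>(1) all in \<open>auto simp: Wc Wz q.image simp del: mpoly_ring_simps\<close>)
      then show False using \<phi>(2) by simp
    qed
    have le: "ord_canonical R n I \<phi> \<le> j \<longleftrightarrow> ?T j" for j
      unfolding ord_canonical_def by (rule int_Least_le_iff[of ?T, OF mono nT T0])
    have "ord_canonical R n I \<phi> = - ?r \<longleftrightarrow> ?T (- ?r)"
      using le[of "- ?r"] le[of "- ?r - 1"] nT by linarith
    then show ?thesis unfolding T by simp
  qed
  show ?thesis
  proof
    assume "has_faithful_form_of_min_order R n I"
    then obtain \<phi> where \<phi>: "\<phi> \<in> carrier ?W" "ord_canonical R n I \<phi> = - ?r" "annihilator ?R ?W \<phi> = {\<zero>\<^bsub>?R\<^esub>}"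
      by (auto simp: has_faithful_form_of_min_order_def)
    note form = formW[OF \<phi>(1)]
    have ann: "v \<in> I" if v: "v \<in> carrier ?P" "\<And>g. g \<in> carrier ?P \<Longrightarrow> \<phi> (?pi (g \<otimes>\<^bsub>?P\<^esub> v)) = \<zero>" for v
    proof -
      have "\<phi> (?pi v \<otimes>\<^bsub>?R\<^esub> x) = \<zero>" if x: "x \<in> carrier ?R" for x
      proof -
        obtain g where g: "g \<in> carrier ?P" "x = ?pi g" using x unfolding q.image by blast
        then show ?thesis using v(2)[OF g(1)] q.\<sigma>_mult[OF v(1) g(1)] A.m_comm[OF v(1) g(1)] by simp
      qed
      then have "?pi v \<odot>\<^bsub>?W\<^esub> \<phi> = \<zero>\<^bsub>?W\<^esub>" unfolding Ws Wz by (intro restrict_ext) auto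
      then have "?pi v \<in> annihilator ?R ?W \<phi>" using q.\<sigma>_closed[OF v(1)] by (simp add: annihilator_def)
      then show ?thesis using \<phi>(3) q.eq_zero_iff[OF v(1)] by simp
    qed
    have "\<phi> \<noteq> \<zero>\<^bsub>?W\<^esub>"
    proof
      assume "\<phi> = \<zero>\<^bsub>?W\<^esub>"
      then have "\<phi> (?pi g) = \<zero>" if "g \<in> carrier ?P" for g using q.\<sigma>_closed[OF that] by (simp add: Wz)
      then have "\<one>\<^bsub>?P\<^esub> \<in> I" by (intro ann) (auto simp del: mpoly_ring_simps)
      then show False using A.ideal_one[OF I(1)] I(2) by simp
    qed
    then have "\<phi> (?pi f) = \<zero>" if "f \<in> filt_poly R n (?r - 1)" for f
      using core[OF \<phi>(1)] \<phi>(2) that by blast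
    moreover note zeroW[OF \<phi>(1)]
    ultimately have "?good (\<lambda>f. \<phi> (?pi f))" using form ann by blast
    then show "\<exists>\<Phi>. ?good \<Phi>" by blast
  next
    assume "\<exists>\<Phi>. ?good \<Phi>"
    then obtain \<Phi> where form: "A.form n \<Phi>" and v0: "\<And>v. v \<in> I \<union> filt_poly R n (?r - 1) \<Longrightarrow> \<Phi> v = \<zero>"
      and ann: "\<And>v. \<lbrakk>v \<in> carrier ?P; \<And>g. g \<in> carrier ?P \<Longrightarrow> \<Phi> (g \<otimes>\<^bsub>?P\<^esub> v) = \<zero>\<rbrakk> \<Longrightarrow> v \<in> I" by blast
    \<comment> \<open>The induced form on R, evaluated at a chosen representative; the choice is
      immaterial because \<Phi> vanishes on I. The restriction makes it extensional, as the
      canonical module demands.\<close>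
    define \<phi> where "\<phi> = (\<lambda>x\<in>carrier ?R. \<Phi> (SOME f. f \<in> carrier ?P \<and> ?pi f = x))"
    have \<phi>: "\<phi> (?pi f) = \<Phi> f" if f: "f \<in> carrier ?P" for f
    proof -
      let ?g = "SOME g. g \<in> carrier ?P \<and> ?pi g = ?pi f"
      have g: "?g \<in> carrier ?P \<and> ?pi ?g = ?pi f" by (rule someI[of _ f]) (use f in simp)
      then have "?g \<ominus>\<^bsub>?P\<^esub> f \<in> I" using q.eq_iff[of ?g f] f by metis
      then have "\<Phi> ?g \<ominus> \<Phi> f = \<zero>" using v0 A.form_diff[OF form, of ?g f] g f by simp
      then have "\<Phi> ?g = \<Phi> f" using A.form_closed[OF form] g f by simp
      then show ?thesis unfolding \<phi>_def using q.\<sigma>_closed[OF f] by simp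
    qed
    have \<phi>W: "\<phi> \<in> carrier ?W"
      unfolding Wc module_hom_def
    proof (intro IntI CollectI conjI allI impI)
      show "\<phi> \<in> extensional (carrier ?R)" by (simp add: \<phi>_def)
      show "\<phi> \<in> carrier ?R \<rightarrow> carrier (self_module R)"
        unfolding self q.image using \<phi> A.form_closed[OF form] by auto
      fix x y assume "x \<in> carrier ?R \<and> y \<in> carrier ?R"
      then obtain f g where fg: "f \<in> carrier ?P" "g \<in> carrier ?P" "x = ?pi f" "y = ?pi g" unfolding q.image by blast
      show "\<phi> (x \<oplus>\<^bsub>?R\<^esub> y) = \<phi> x \<oplus>\<^bsub>self_module R\<^esub> \<phi> y"
        unfolding self fg(3,4) q.\<sigma>_add[OF fg(1,2)] \<phi>[OF fg(1)] \<phi>[OF fg(2)] \<phi>[OF A.add.m_closed[OF fg(1,2)]]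
        by (rule A.form_add[OF form fg(1,2)])
    next
      fix k x assume "k \<in> carrier R \<and> x \<in> carrier ?R"
      then obtain f where f: "k \<in> carrier R" "f \<in> carrier ?P" "x = ?pi f" unfolding q.image by blast
      show "\<phi> (k \<odot>\<^bsub>?R\<^esub> x) = k \<odot>\<^bsub>self_module R\<^esub> \<phi> x"
        unfolding self f(3) sm[OF f(1,2)] \<phi>[OF f(2)] \<phi>[OF A.m_closed[OF A.c_closed[OF f(1)] f(2)]]
        by (rule A.form_smult[OF form f(1,2)])
    qed
    have in_ann: "v \<in> I" if v: "v \<in> carrier ?P" "?pi v \<odot>\<^bsub>?W\<^esub> \<phi> = \<zero>\<^bsub>?W\<^esub>" for v
    proof (rule ann[OF v(1)])
      fix g assume g: "g \<in> carrier ?P"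
      have "(?pi v \<odot>\<^bsub>?W\<^esub> \<phi>) (?pi g) = \<zero>" unfolding v(2) Wz using q.\<sigma>_closed[OF g] by simp
      then show "\<Phi> (g \<otimes>\<^bsub>?P\<^esub> v) = \<zero>"
        unfolding Ws using q.\<sigma>_closed[OF g] q.\<sigma>_mult[OF v(1) g] \<phi>[OF A.m_closed[OF v(1) g]] A.m_comm[OF v(1) g]
        by simp
    qed
    have zero: "\<zero>\<^bsub>?R\<^esub> \<odot>\<^bsub>?W\<^esub> \<phi> = \<zero>\<^bsub>?W\<^esub>"
      unfolding Ws Wz
    proof (rule restrict_ext)
      fix x assume x: "x \<in> carrier ?R"
      show "\<phi> (\<zero>\<^bsub>?R\<^esub> \<otimes>\<^bsub>?R\<^esub> x) = \<zero>"
        by (metis q.A.l_null[OF x] q.\<sigma>_zero \<phi>[OF A.zero_closed] A.form_zero[OF form])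
    qed
    have "annihilator ?R ?W \<phi> = {\<zero>\<^bsub>?R\<^esub>}"
    proof
      show "annihilator ?R ?W \<phi> \<subseteq> {\<zero>\<^bsub>?R\<^esub>}"
      proof
        fix x assume x: "x \<in> annihilator ?R ?W \<phi>"
        then have "x \<in> carrier ?R" by (simp add: annihilator_def)
        then obtain v where v: "v \<in> carrier ?P" "x = ?pi v" unfolding q.image by blast
        then show "x \<in> {\<zero>\<^bsub>?R\<^esub>}" using in_ann[OF v(1)] x q.eq_zero_iff[OF v(1)] by (simp add: annihilator_def)
      qed
      show "{\<zero>\<^bsub>?R\<^esub>} \<subseteq> annihilator ?R ?W \<phi>" using zero q.A.zero_closed by (simp add: annihilator_def)
    qed
    moreover have "\<phi> \<noteq> \<zero>\<^bsub>?W\<^esub>"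
    proof
      assume eq: "\<phi> = \<zero>\<^bsub>?W\<^esub>"
      have "\<Phi> g = \<zero>" if "g \<in> carrier ?P" for g
        using \<phi>[OF that] q.\<sigma>_closed[OF that] unfolding eq Wz by simp
      then have "\<one>\<^bsub>?P\<^esub> \<in> I" by (intro ann) (auto simp del: mpoly_ring_simps)
      then show False using A.ideal_one[OF I(1)] I(2) by simp
    qed
    then have "ord_canonical R n I \<phi> = - ?r"
      using core[OF \<phi>W] \<phi>[OF Fc] v0 by simp
    ultimately show "has_faithful_form_of_min_order R n I"
      unfolding has_faithful_form_of_min_order_def using \<phi>W by blast
  qed
qed

end

text \<open>Both directions for one given extension field L. They can be compared with conditions
  over K because the regularity index and the filtration are unchanged by extension of
  scalars.\<close>

lemma faithful_form_base_change:
  assumes K: "field K" and L: "field L" and h: "h \<in> ring_hom K L" and I: "zero_dim_ideal K n I"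
  shows "has_faithful_form_of_min_order L n (extend_ideal L h n I)
      \<Longrightarrow> locally_gorenstein K n I \<and> cayley_bacharach K n I"
    and "\<lbrakk>infinite (carrier L); locally_gorenstein K n I; cayley_bacharach K n I\<rbrakk>
      \<Longrightarrow> has_faithful_form_of_min_order L n (extend_ideal L h n I)"
proof -
  interpret K: field K by (rule K)
  interpret L: field L by (rule L)
  interpret base_change K "mpoly_ring K n" K.indexed_const L "mpoly_ring L n" L.indexed_const h "\<lambda>f. h \<circ> f"
    by (rule mpoly_base_change[OF K L h])
  have I': "ideal I (mpoly_ring K n)" "I \<noteq> carrier (mpoly_ring K n)" "A.fin_codim I"
    using I K.zero_dim_ideal_iff by auto
  let ?I = "extend_ideal L h n I"
  have ext: "?I = lift I" by (simp add: extend_ideal_def lift_eq_genideal[OF I'(1)])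
  have J: "ideal ?I (mpoly_ring L n)" "?I \<noteq> carrier (mpoly_ring L n)" "fin_codim ?I"
    unfolding ext using lift_ideal[OF I'(1)] lift_eq_carrier_iff[OF A.subsp_ideal[OF I'(1)]] I'(2)
      fin_codim_lift(1)[OF I'(3) A.ideal_subset[OF I'(1)]] by auto
  have sub: "I \<union> filt_poly K n i \<subseteq> carrier (mpoly_ring K n)" for i
    using A.ideal_subset[OF I'(1)] A.subsp_subset[OF K.filt_poly_subsp] by blast
  \<comment> \<open>The filtration over L is the extension of the filtration over K. Since a lift is
    everything only if the subspace is, the regularity indices agree.\<close>
  have filt: "L.filt_ideal n ?I i = lift (K.filt_ideal n I i)" for i
  proof -
    have "lift (K.filt_ideal n I i) = lift (I \<union> filt_poly K n i)"
      unfolding K.filt_ideal_def by (rule lift_spn[OF sub])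
    also have "\<dots> = spn (lift I \<union> lift (filt_poly K n i))"
    proof
      show "lift (I \<union> filt_poly K n i) \<subseteq> spn (lift I \<union> lift (filt_poly K n i))"
        by (rule lift_least[OF subsp_spn _ sub])
          (use lift_base lift_closed in \<open>blast intro: spn_base\<close>)
      show "spn (lift I \<union> lift (filt_poly K n i)) \<subseteq> lift (I \<union> filt_poly K n i)"
        by (rule spn_least[OF subsp_lift]) (use lift_mono in blast)
    qed
    finally show ?thesis by (simp add: L.filt_ideal_def ext lift_filt_poly[OF K L h])
  qed
  have "L.filt_ideal n ?I i = carrier (mpoly_ring L n) \<longleftrightarrow> K.filt_ideal n I i = carrier (mpoly_ring K n)" for i
    unfolding filt K.filt_ideal_def by (rule lift_eq_carrier_iff[OF A.subsp_spn])
  then have "reg_index L n ?I \<le> i \<longleftrightarrow> reg_index K n I \<le> i" for i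
    using L.reg_index_le_iff[OF J] K.reg_index_le_iff[OF I'] by simp
  then have reg: "reg_index L n ?I = reg_index K n I" by (meson order_antisym order_refl)
  let ?W = "filt_poly K n (reg_index K n I - 1)"
  have faith: "has_faithful_form_of_min_order L n ?I \<longleftrightarrow>
      (\<exists>\<Phi>. admissible I ?W \<Phi> \<and> faithful_on I (carrier (mpoly_ring K n)) \<Phi>)"
    using L.has_faithful_form_iff[OF J]
    unfolding ext reg[unfolded ext] admissible_def faithful_on_def lift_carrier lift_filt_poly[OF K L h] conj_assoc .
  show "has_faithful_form_of_min_order L n ?I \<Longrightarrow> locally_gorenstein K n I \<and> cayley_bacharach K n I"
  proof -
    assume "has_faithful_form_of_min_order L n ?I"
    then obtain \<Phi> where \<Phi>: "admissible I ?W \<Phi>" "faithful_on I (carrier (mpoly_ring K n)) \<Phi>"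
      using faith by blast
    have "A.ideals_escape I ?W" by (rule ideals_escape_if_faithful[OF I'(1) K.filt_poly_subsp \<Phi>])
    moreover have "A.gorenstein I"
      by (rule gorenstein_if_faithful[OF I'(1,3) _ _ \<Phi>(2)]) (use \<Phi>(1) in \<open>auto simp: admissible_def\<close>)
    ultimately show ?thesis
      using K.locally_gorenstein_iff[OF I'(1,3)] K.cayley_bacharach_iff[OF I'] by simp
  qed
  show "\<lbrakk>infinite (carrier L); locally_gorenstein K n I; cayley_bacharach K n I\<rbrakk>
      \<Longrightarrow> has_faithful_form_of_min_order L n ?I"
    unfolding faith
    using faithful_form_exists[OF _ I'(1,3) K.filt_poly_subsp]
      K.locally_gorenstein_iff[OF I'(1,3)] K.cayley_bacharach_iff[OF I'] by blast
qed

lemma extend_ideal_id: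
  assumes "field K" "ideal I (mpoly_ring K n)" shows "extend_ideal K id n I = I"
proof -
  interpret K: field K by fact
  interpret P: cring "mpoly_ring K n" by (rule K.mpoly_cring)
  interpret I: ideal I "mpoly_ring K n" by fact
  have "(\<lambda>f. id \<circ> f) ` I = I" by simp
  then show ?thesis
    unfolding extend_ideal_def
    using P.genideal_minimal[OF assms(2) subset_refl] P.genideal_self[OF I.a_subset] by auto
qed

theorem theorem5p6:
  fixes K :: "'k ring" and n :: nat and I :: "(nat multiset \<Rightarrow> 'k) set"
  assumes "field K" and "zero_dim_ideal K n I"
  shows
    "(faithful_form_over_extension TYPE('k closure_type) K n I
        \<longleftrightarrow> locally_gorenstein K n I \<and> cayley_bacharach K n I)
     \<and> (faithful_form_over_extension TYPE('l) K n I
        \<longrightarrow> locally_gorenstein K n I \<and> cayley_bacharach K n I)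
     \<and> (infinite (carrier K) \<and> locally_gorenstein K n I \<and> cayley_bacharach K n I
        \<longrightarrow> has_faithful_form_of_min_order K n I)"
proof (intro conjI impI iffI)
  interpret K: field K by fact
  show "locally_gorenstein K n I" "cayley_bacharach K n I"
    if "faithful_form_over_extension TYPE('k closure_type) K n I"
    using that faithful_form_base_change(1)[OF assms(1) _ _ assms(2)]
    unfolding faithful_form_over_extension_def by blast+
  show "locally_gorenstein K n I" "cayley_bacharach K n I"
    if "faithful_form_over_extension TYPE('l) K n I"
    using that faithful_form_base_change(1)[OF assms(1) _ _ assms(2)]
    unfolding faithful_form_over_extension_def by blast+
  show "faithful_form_over_extension TYPE('k closure_type) K n I"
    if b: "locally_gorenstein K n I \<and> cayley_bacharach K n I"
  proof -
    \<comment> \<open>The algebraic closure is infinite whether or not K is, so it serves as the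
      extension field for every K.\<close>
    interpret L: algebraic_closure K.alg_closure "K.indexed_const ` carrier K"
      by (rule K.alg_closureE(1))
    show ?thesis
      unfolding faithful_form_over_extension_def
      using faithful_form_base_change(2)[OF assms(1) L.field_axioms K.alg_closureE(2) assms(2)]
        L.infinite_carrier K.alg_closureE(2) L.field_axioms b by blast
  qed
  show "has_faithful_form_of_min_order K n I"
    if b: "infinite (carrier K) \<and> locally_gorenstein K n I \<and> cayley_bacharach K n I"
  proof -
    \<comment> \<open>An infinite K is taken as an extension of itself; along the identity the
      extended ideal is I again.\<close>
    have "id \<in> ring_hom K K" by (simp add: ring_hom_def)
    moreover have "ideal I (mpoly_ring K n)" using assms(2) by (simp add: zero_dim_ideal_def)
    ultimately show ?thesis
      using faithful_form_base_change(2)[OF assms(1,1) _ assms(2), of id] b extend_ideal_id[OF assms(1)] by simp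
  qed
qed

end
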